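(* The problem \textsc{Grid-Embedded Circuit Satisfiability} is $\mathbf{NP}$-complete.
   Context: A grid-embedded Boolean circuit $C$ is an $n\times n$ grid of cells with coordinates $(i,j)$, $0\le i,j\le n-1$ (indices mod $n$), each cell carrying a block. A block at $(i,j)$ receives a north input $s_N$ (the south output of the block at $(i-1,j)$) and a west input $s_W$ (the east output of the block at $(i,j-1)$), and produces an east output $g_E(s_N,s_W)$ and a south output $g_S(s_N,s_W)$. Block types: conjunction ($g_E=g_S=s_N\wedge s_W$); disjunction ($g_E=g_S=s_N\vee s_W$); crossing ($g_E=s_W$, $g_S=s_N$); fixed-value ($g_E=g_S=0$); signal-multiplier (either $g_E=g_S=s_N$ or $g_E=g_S=s_W$, the variant being fixed as part of the block); selector (ignores its inputs; it is either an east-selector with $g_E=1,g_S=0$ or a south-selector with $g_E=0,g_S=1$). Every cell $(i,j)$ with $i=0$ or $j=0$ carries a fixed-value block. If $v_1,\dots,v_s$ are the selector blocks, a truth-assignment is $u\in\{0,1\}^s$ making $v_i$ an east-selector if $u_i=1$ and a south-selector if $u_i=0$. Given $u$, the outputs of all blocks are computed in order of increasing $i+j$ (for $i+j=0,1,\dots,2(n-1)$); $C(u)_v$ denotes the value of block $v$ (its output). A block $v$ is satisfiable if some truth-assignment $u$ has $C(u)_v=1$. \textsc{Grid-Embedded Circuit Satisfiability}: given a grid-embedded Boolean circuit $C$ and a block $v$ of $C$, decide whether $v$ is satisfiable. *)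

theory Defs
  imports "HOL-Computational_Algebra.Polynomial"
begin

text \<open>
  States and tape symbols are natural numbers below bounds given by the machine. Tapes are
  two-way infinite. Symbol 0 is the blank; 1 and 2 encode the bits 0 and 1.
\<close>

datatype direction = Go_Left | Stay | Go_Right

type_synonym tape = "(int \<Rightarrow> nat) \<times> int"   \<comment> \<open>contents and head position\<close>
type_synonym config = "nat \<times> tape list"    \<comment> \<open>state and tapes\<close>
type_synonym action = "nat \<times> direction"    \<comment> \<open>symbol to write, then move\<close>

record tm =
  num_tapes :: nat
  num_states :: nat
  num_symbols :: nat
  start_state :: nat
  accept_states :: "nat set"
  trans :: "nat \<Rightarrow> nat list \<Rightarrow> (nat \<times> action list) set"

definition wf_tm :: "tm \<Rightarrow> bool" where
  "wf_tm M \<longleftrightarrow>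
     num_tapes M \<ge> 1 \<and> num_symbols M \<ge> 3 \<and> start_state M < num_states M \<and>
     (\<forall>q < num_states M. \<forall>ss. length ss = num_tapes M \<and> set ss \<subseteq> {..<num_symbols M} \<longrightarrow>
        (\<forall>(q', as) \<in> trans M q ss.
           q' < num_states M \<and> length as = num_tapes M \<and> fst ` set as \<subseteq> {..<num_symbols M}))"

definition deterministic :: "tm \<Rightarrow> bool" where
  "deterministic M \<longleftrightarrow> (\<forall>q ss. \<forall>a \<in> trans M q ss. \<forall>b \<in> trans M q ss. a = b)"

fun shift :: "direction \<Rightarrow> int \<Rightarrow> int" where
  "shift Go_Left h = h - 1"
| "shift Stay h = h"
| "shift Go_Right h = h + 1"

fun read :: "tape \<Rightarrow> nat" where
  "read (f, h) = f h"

fun act :: "action \<Rightarrow> tape \<Rightarrow> tape" where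
  "act (s, d) (f, h) = (f(h := s), shift d h)"

definition step :: "tm \<Rightarrow> config \<Rightarrow> config \<Rightarrow> bool" where
  "step M c c' \<longleftrightarrow>
     (\<exists>(q', as) \<in> trans M (fst c) (map read (snd c)). c' = (q', map2 act as (snd c)))"

definition halting :: "tm \<Rightarrow> config \<Rightarrow> bool" where
  "halting M c \<longleftrightarrow> (\<nexists>c'. step M c c')"

definition contents :: "bool list \<Rightarrow> int \<Rightarrow> nat" where
  "contents x p = (if 0 \<le> p \<and> p < int (length x) then (if x ! nat p then 2 else 1) else 0)"

definition init :: "tm \<Rightarrow> bool list \<Rightarrow> config" where
  "init M x =
     (start_state M, (contents x, 0) # replicate (num_tapes M - 1) (contents [], 0))"

type_synonym language = "bool list set"

text \<open>The output of a function-computing machine is the word left on its last tape.\<close>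

definition polytime_computable :: "(bool list \<Rightarrow> bool list) \<Rightarrow> bool" where
  "polytime_computable f \<longleftrightarrow>
     (\<exists>M (p :: nat poly). wf_tm M \<and> deterministic M \<and>
        (\<forall>x. \<exists>t c. t \<le> poly p (length x) \<and> (step M ^^ t) (init M x) c \<and> halting M c \<and>
                   fst (last (snd c)) = contents (f x)))"

definition tm_accepts :: "tm \<Rightarrow> bool list \<Rightarrow> bool" where
  "tm_accepts M x \<longleftrightarrow>
     (\<exists>c. (step M)\<^sup>*\<^sup>* (init M x) c \<and> halting M c \<and> fst c \<in> accept_states M)"

text \<open>Every computation path, accepting or not, obeys the time bound.\<close>

definition NP :: "language set" where
  "NP = {L. \<exists>M (p :: nat poly). wf_tm M \<and>
             (\<forall>x t c. (step M ^^ t) (init M x) c \<longrightarrow> t \<le> poly p (length x)) \<and>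
             (\<forall>x. x \<in> L \<longleftrightarrow> tm_accepts M x)}"

definition poly_reducible :: "language \<Rightarrow> language \<Rightarrow> bool" where
  "poly_reducible L L' \<longleftrightarrow> (\<exists>f. polytime_computable f \<and> (\<forall>x. x \<in> L \<longleftrightarrow> f x \<in> L'))"

definition NP_hard :: "language \<Rightarrow> bool" where
  "NP_hard L \<longleftrightarrow> (\<forall>L' \<in> NP. poly_reducible L' L)"

definition NP_complete :: "language \<Rightarrow> bool" where
  "NP_complete L \<longleftrightarrow> L \<in> NP \<and> NP_hard L"

datatype block =
  Conjunction | Disjunction | Crossing | Fixed | Multiplier_N | Multiplier_W | Selector

type_synonym cell = "nat \<times> nat"
type_synonym circuit = "block list list"   \<comment> \<open>list of rows\<close>

definition grid_circuit :: "circuit \<Rightarrow> bool" where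
  "grid_circuit C \<longleftrightarrow>
     (\<forall>row \<in> set C. length row = length C) \<and>
     (\<forall>i < length C. \<forall>j < length C. i = 0 \<or> j = 0 \<longrightarrow> C ! i ! j = Fixed)"

text \<open>
  \<open>block_out b e s\<^sub>N s\<^sub>W\<close> is the pair (east output, south output); \<open>e\<close> is the
  assigned truth value, used by selectors only.
\<close>

fun block_out :: "block \<Rightarrow> bool \<Rightarrow> bool \<Rightarrow> bool \<Rightarrow> bool \<times> bool" where
  "block_out Conjunction e sN sW = (sN \<and> sW, sN \<and> sW)"
| "block_out Disjunction e sN sW = (sN \<or> sW, sN \<or> sW)"
| "block_out Crossing e sN sW = (sW, sN)"
| "block_out Fixed e sN sW = (False, False)"
| "block_out Multiplier_N e sN sW = (sN, sN)"
| "block_out Multiplier_W e sN sW = (sW, sW)"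
| "block_out Selector e sN sW = (e, \<not> e)"

text \<open>
  A truth-assignment is given as a function on cells; only its values on selector cells matter.
  \<open>eval_diags C u d\<close> holds the outputs once the diagonals \<open>i + j = 0, \<dots>, d - 1\<close> have been
  computed. Outputs not yet computed are set to False; they are only ever read, through the
  wrap-around, by the fixed-value blocks in row or column 0, which ignore their inputs.
\<close>

primrec eval_diags :: "circuit \<Rightarrow> (cell \<Rightarrow> bool) \<Rightarrow> nat \<Rightarrow> cell \<Rightarrow> bool \<times> bool" where
  "eval_diags C u 0 = (\<lambda>_. (False, False))"
| "eval_diags C u (Suc d) = (\<lambda>(i, j).
     if i < length C \<and> j < length C \<and> i + j = d then
       let n = length C;
           sN = snd (eval_diags C u d ((i + n - 1) mod n, j));
           sW = fst (eval_diags C u d (i, (j + n - 1) mod n))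
       in block_out (C ! i ! j) (u (i, j)) sN sW
     else eval_diags C u d (i, j))"

definition outputs :: "circuit \<Rightarrow> (cell \<Rightarrow> bool) \<Rightarrow> cell \<Rightarrow> bool \<times> bool" where
  "outputs C u = eval_diags C u (2 * length C - 1)"

text \<open>
  Crossings and selectors may have different east and south outputs, so the value of a block
  depends on a convention \<open>val\<close> turning the pair (east output, south output) into one bit. A
  convention is admissible if it agrees with the common output whenever both outputs coincide;
  the four admissible ones are \<open>fst\<close>, \<open>snd\<close>, disjunction and conjunction of the outputs.
\<close>

definition value_convention :: "(bool \<times> bool \<Rightarrow> bool) \<Rightarrow> bool" where
  "value_convention val \<longleftrightarrow> (\<forall>b. val (b, b) = b)"

definition satisfiable :: "(bool \<times> bool \<Rightarrow> bool) \<Rightarrow> circuit \<Rightarrow> cell \<Rightarrow> bool" where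
  "satisfiable val C v \<longleftrightarrow> (\<exists>u. val (outputs C u v))"

fun block_code :: "block \<Rightarrow> bool list" where
  "block_code Conjunction  = [False, False, False]"
| "block_code Disjunction  = [False, False, True]"
| "block_code Crossing     = [False, True, False]"
| "block_code Fixed        = [False, True, True]"
| "block_code Multiplier_N = [True, False, False]"
| "block_code Multiplier_W = [True, False, True]"
| "block_code Selector     = [True, True, False]"

text \<open>
  Side length and target coordinates are written in unary, followed by the block codes in
  row-major order. As the grid has \<open>n\<^sup>2\<close> cells, unary numbers do not inflate the input size.
\<close>

definition unary :: "nat \<Rightarrow> bool list" where
  "unary m = replicate m True @ [False]"

fun encode :: "circuit \<Rightarrow> cell \<Rightarrow> bool list" where
  "encode C (i, j) =
     unary (length C) @ unary i @ unary j @ concat (map block_code (concat C))"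

definition grid_circuit_sat :: "(bool \<times> bool \<Rightarrow> bool) \<Rightarrow> language" where
  "grid_circuit_sat val =
     {encode C (i, j) | C i j.
        grid_circuit C \<and> i < length C \<and> j < length C \<and> satisfiable val C (i, j)}"

end

theory Submission imports Defs begin

text \<open>
  Membership: a nondeterministic machine reads the circuit once in row-major order, guessing the
  selectors and keeping the latest south output of every column on a work tape.

  Hardness: the computations of a nondeterministic machine within a polynomial time bound are the
  satisfying assignments of a formula in conjunctive normal form. Its incidence matrix becomes a
  grid: each literal travels east along a row, each clause is a disjunction accumulated along a
  column, and the last row forms the conjunction. Whether a literal occurs in a clause depends only
  on local comparisons of their times and positions. Hence a deterministic machine writes the circuit
  with nested loops whose counters are head positions; for every comparison an additional head stays at
  the difference of two counters.
\<close>

section \<open>Evaluation and encoding of grid circuits\<close>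

text \<open>The obstacle is uniformity: the circuit grows with the input, but the machine writing it
  has finitely many states and cannot hold indices in them. Every literal and clause index is
  therefore a triple (time, position, kind). The kinds are finite in number and unrolled in the
  program; times and positions are loop counters, subject only to tests for equality, adjacency,
  zero and origin. Such a full product leaves no room for exceptions: clauses that make no sense at
  some time get a harmless stand-in, and the kinds are padded because a square grid needs as many
  clauses as literals. All counters share one range, so one word serves them all. Its length is
  built from a power of n + 2, since nested loops yield powers directly, whereas an arbitrary
  polynomial would have to be evaluated. For hardness every value convention gives the same result,
  because the target is a conjunction block, whose outputs coincide; for membership the guessing
  machine has both outputs of the target at hand. All its paths, also on malformed inputs, must halt
  in time; a potential that decreases at every step shows this.\<close>

lemma eval_diags_stable:
  "i + j < d \<Longrightarrow> eval_diags C u (d + k) (i, j) = eval_diags C u d (i, j)"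
  by (induction k) auto

lemma outputs_eval_diags:
  assumes "i < length C" "j < length C" "i + j < d"
  shows "eval_diags C u d (i, j) = outputs C u (i, j)"
proof -
  have *: "eval_diags C u (Suc (i + j) + k) (i, j) = eval_diags C u (Suc (i + j)) (i, j)" for k
    by (rule eval_diags_stable) simp
  have "eval_diags C u d (i, j) = eval_diags C u (Suc (i + j)) (i, j)"
    using *[of "d - Suc (i + j)"] assms by (simp del: eval_diags.simps)
  moreover have "outputs C u (i, j) = eval_diags C u (Suc (i + j)) (i, j)"
  proof -
    have "2 * length C - 1 = Suc (i + j) + (2 * length C - 1 - Suc (i + j))" using assms by simp
    then show ?thesis using * unfolding outputs_def by metis
  qed
  ultimately show ?thesis by simp
qed

text \<open>Away from row 0 and column 0 the indices modulo the side never wrap around, so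
  evaluation by diagonals becomes a recurrence on the two neighbours.\<close>

lemma outputs_rec:
  assumes "i < length C" "j < length C" "0 < i" "0 < j"
  shows "outputs C u (i, j) =
    block_out (C ! i ! j) (u (i, j)) (snd (outputs C u (i - 1, j))) (fst (outputs C u (i, j - 1)))"
proof -
  have "outputs C u (i, j) = eval_diags C u (Suc (i + j)) (i, j)"
    using assms by (simp add: outputs_eval_diags del: eval_diags.simps)
  moreover have "(i + length C - 1) mod length C = i - 1" "(j + length C - 1) mod length C = j - 1"
    using assms by (simp_all add: mod_if)
  moreover have "eval_diags C u (i + j) (i - 1, j) = outputs C u (i - 1, j)"
    "eval_diags C u (i + j) (i, j - 1) = outputs C u (i, j - 1)"
    using assms by (auto intro: outputs_eval_diags)
  ultimately show ?thesis using assms by (simp add: Let_def)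
qed

lemma outputs_border:
  assumes "grid_circuit C" "i < length C" "j < length C" "i = 0 \<or> j = 0"
  shows "outputs C u (i, j) = (False, False)"
proof -
  have "outputs C u (i, j) = eval_diags C u (Suc (i + j)) (i, j)"
    using assms by (simp add: outputs_eval_diags del: eval_diags.simps)
  moreover have "C ! i ! j = Fixed" using assms by (auto simp: grid_circuit_def)
  ultimately show ?thesis using assms by (simp add: Let_def)
qed

section \<open>Unique decoding of the bit encoding\<close>

lemma unary_append_inject: "unary m @ xs = unary n @ ys \<longleftrightarrow> m = n \<and> xs = ys"
proof (induction m arbitrary: n)
  case 0 then show ?case by (cases n) (auto simp: unary_def)
next
  case (Suc m) then show ?case by (cases n) (auto simp: unary_def)
qed

lemma length_block_code [simp]: "length (block_code b) = 3"
  by (cases b) auto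

lemma block_code_inject [simp]: "block_code b = block_code c \<longleftrightarrow> b = c"
  by (cases b; cases c) auto

lemma concat_block_code_inject:
  "concat (map block_code bs) = concat (map block_code cs) \<longleftrightarrow> bs = cs"
proof (induction bs arbitrary: cs)
  case Nil
  have "block_code c \<noteq> []" for c by (cases c) auto
  then show ?case by (cases cs) auto
next
  case (Cons b bs)
  have "block_code c \<noteq> []" for c by (cases c) auto
  then show ?case using Cons by (cases cs) (auto simp: append_eq_append_conv)
qed

lemma concat_square_inject:
  assumes "concat C = concat C'" "length C = length C'"
    "\<forall>row \<in> set C. length row = n" "\<forall>row \<in> set C'. length row = n"
  shows "C = C'"
  using assms
proof (induction C arbitrary: C')
  case Nil then show ?case by auto
next
  case (Cons r C)
  then obtain r' C'' where "C' = r' # C''" by (cases C') auto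
  with Cons show ?case by (auto simp: append_eq_append_conv)
qed

text \<open>Unary numbers are self-delimiting and all block codes have length 3; the side length
  then tells where to cut the list of blocks into rows. Unique decoding is what lets membership of a
  code word determine satisfiability of the circuit behind it.\<close>

lemma encode_inject:
  assumes "encode C (i, j) = encode C' (i', j')" "grid_circuit C" "grid_circuit C'"
  shows "C = C' \<and> i = i' \<and> j = j'"
proof -
  have *: "length C = length C'" "i = i'" "j = j'" "concat C = concat C'"
    using assms(1) by (simp_all add: unary_append_inject concat_block_code_inject)
  then have "C = C'"
    using assms(2,3) by (intro concat_square_inject[where n = "length C"]) (auto simp: grid_circuit_def)
  with * show ?thesis by simp
qed

lemma encode_in_grid_circuit_sat:
  assumes "grid_circuit C" "i < length C" "j < length C"
  shows "encode C (i, j) \<in> grid_circuit_sat val \<longleftrightarrow> satisfiable val C (i, j)"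
  unfolding grid_circuit_sat_def using assms encode_inject[OF _ assms(1)] by blast

section \<open>From incidence matrices to grid circuits\<close>

text \<open>
  \<open>mem r c\<close> says that literal \<open>r\<close> occurs in clause \<open>c\<close>. The literal with even index \<open>2 * v\<close> is
  variable \<open>v\<close>, the next one its negation. Literal \<open>r\<close> travels east along row \<open>1 + 2 * r\<close>, and the
  disjunction for clause \<open>c\<close> travels south along column \<open>3 + 2 * c\<close>. The last row forms the
  conjunction of all clauses and a fresh selector, which stands in for the constant true.
\<close>

definition lit :: "(nat \<Rightarrow> bool) \<Rightarrow> nat \<Rightarrow> bool" where
  "lit \<alpha> r \<longleftrightarrow> \<alpha> (r div 2) = even r"

text \<open>The crosspoint of a literal and a clause is a 2 by 2 gadget. If the literal occurs,
  \<open>Multiplier_W\<close> taps it southward, \<open>Multiplier_N\<close> below turns it east,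
  and \<open>Disjunction\<close> adds it to the clause column; otherwise four crossings keep the
  signals apart. Stray copies are forwarded or ignored and never reach a disjunction.\<close>

fun upper_pair :: "bool \<Rightarrow> block list" where
  "upper_pair b = (if b then [Multiplier_W, Crossing] else [Crossing, Crossing])"

fun lower_pair :: "bool \<Rightarrow> block list" where
  "lower_pair b = (if b then [Multiplier_N, Disjunction] else [Crossing, Crossing])"

text \<open>In column 1 a selector starts each variable: its east output is the positive literal;
  its south output, the negation, passes a crossing and is turned east by
  \<open>Multiplier_N\<close> two rows further down. This is why a literal and its negation have
  consecutive indices.\<close>

definition mat_block :: "nat \<Rightarrow> (nat \<Rightarrow> nat \<Rightarrow> bool) \<Rightarrow> nat \<Rightarrow> nat \<Rightarrow> block" where
  "mat_block m mem i j =
     (let r = (i - 1) div 2; c = (j - 2) div 2 in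
      if i = 0 \<or> j = 0 then Fixed
      else if i = 2 * m + 1 then (if j = 1 then Selector else [Crossing, Conjunction] ! (j mod 2))
      else if odd i then
        (if j = 1 then (if even r then Selector else Multiplier_N) else upper_pair (mem r c) ! (j mod 2))
      else (if j = 1 then Crossing else lower_pair (mem r c) ! (j mod 2)))"

text \<open>Rows: one border row, two per literal, and the last row. Columns: one border column, the
  column of sources, and two per clause. Both counts are \<open>2 * m + 2\<close> because there are
  \<open>m\<close> literals and \<open>m\<close> clauses.\<close>

definition mat_circuit :: "nat \<Rightarrow> (nat \<Rightarrow> nat \<Rightarrow> bool) \<Rightarrow> circuit" where
  "mat_circuit m mem = map (\<lambda>i. map (mat_block m mem i) [0..<2 * m + 2]) [0..<2 * m + 2]"

lemma length_mat_circuit [simp]: "length (mat_circuit m mem) = 2 * m + 2"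
  by (simp add: mat_circuit_def)

lemma mat_circuit_nth [simp]:
  "i < 2 * m + 2 \<Longrightarrow> j < 2 * m + 2 \<Longrightarrow> mat_circuit m mem ! i ! j = mat_block m mem i j"
  by (simp add: mat_circuit_def del: upt_Suc)

lemma grid_mat_circuit: "grid_circuit (mat_circuit m mem)"
  unfolding grid_circuit_def
  by (auto simp: mat_block_def simp del: upt_Suc) (auto simp: mat_circuit_def simp del: upt_Suc)

context
  fixes m :: nat and mem :: "nat \<Rightarrow> nat \<Rightarrow> bool" and u :: "cell \<Rightarrow> bool"
begin

abbreviation "mout i j \<equiv> outputs (mat_circuit m mem) u (i, j)"

text \<open>Two literals of two rows each take four rows per variable, so the selector of variable
  \<open>v\<close> is in row \<open>1 + 4 * v\<close>.\<close>

definition "row_lit r \<longleftrightarrow> lit (\<lambda>v. u (1 + 4 * v, 1)) r"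

lemma mout_rec:
  "0 < i \<Longrightarrow> 0 < j \<Longrightarrow> i < 2 * m + 2 \<Longrightarrow> j < 2 * m + 2 \<Longrightarrow>
   mout i j = block_out (mat_block m mem i j) (u (i, j)) (snd (mout (i - 1) j)) (fst (mout i (j - 1)))"
  by (subst outputs_rec) auto

lemma mout_head:
  assumes "even m" "r < m"
  shows "fst (mout (1 + 2 * r) 1) = row_lit r"
proof (cases "even r")
  case True
  then obtain v where v: "r = 2 * v" by auto
  have "mat_block m mem (1 + 2 * r) 1 = Selector" using assms True by (simp add: mat_block_def)
  then show ?thesis using assms v by (subst mout_rec) (auto simp: row_lit_def lit_def)
next
  case False
  then obtain v where v: "r = 2 * v + 1" by (auto elim: oddE)
  have 1: "mat_block m mem (1 + 4 * v) 1 = Selector"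
    "mat_block m mem (2 + 4 * v) 1 = Crossing"
    "mat_block m mem (3 + 4 * v) 1 = Multiplier_N"
    using assms v by (auto simp: mat_block_def)
  have "fst (mout (3 + 4 * v) 1) = snd (mout (2 + 4 * v) 1)"
    using assms v 1 by (subst mout_rec) auto
  also have "\<dots> = snd (mout (1 + 4 * v) 1)"
    using assms v 1 by (subst mout_rec) auto
  also have "\<dots> = (\<not> u (1 + 4 * v, 1))"
    using assms v 1 by (subst mout_rec) auto
  finally have "fst (mout (3 + 4 * v) 1) = (\<not> u (1 + 4 * v, 1))" .
  moreover have "1 + 2 * r = 3 + 4 * v" using v by simp
  ultimately show ?thesis using v by (simp only: row_lit_def lit_def) simp
qed

lemma mout_row:
  assumes "even m" "r < m" "j < 2 * m + 1"
  shows "fst (mout (1 + 2 * r) (1 + j)) = row_lit r"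
  using assms(3)
proof (induction j)
  case 0 then show ?case using mout_head[OF assms(1,2)] by simp
next
  case (Suc j)
  have "mat_block m mem (1 + 2 * r) (2 + j) \<in> {Multiplier_W, Crossing}"
    using assms by (auto simp: mat_block_def nth_Cons split: nat.splits)
  then have "fst (mout (1 + 2 * r) (2 + j)) = fst (mout (1 + 2 * r) (1 + j))"
    using assms Suc.prems by (subst mout_rec) auto
  then show ?case using Suc by simp
qed

text \<open>Induction down the literals: the fixed border supplies the empty disjunction, and the
  two rows of each literal add it exactly if it occurs in the clause.\<close>

lemma mout_column:
  assumes "even m" "c < m" "r \<le> m"
  shows "snd (mout (2 * r) (3 + 2 * c)) \<longleftrightarrow> (\<exists>r'<r. mem r' c \<and> row_lit r')"
  using assms(3)
proof (induction r)
  case 0 then show ?case using assms by (simp add: outputs_border grid_mat_circuit)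
next
  case (Suc r)
  have up: "mat_block m mem (1 + 2 * r) (3 + 2 * c) = Crossing"
    using Suc.prems assms by (auto simp: mat_block_def)
  have 1: "snd (mout (1 + 2 * r) (3 + 2 * c)) = snd (mout (2 * r) (3 + 2 * c))"
    using Suc.prems assms up by (subst mout_rec) auto
  show ?case
  proof (cases "mem r c")
    case False
    then have "mat_block m mem (2 + 2 * r) (3 + 2 * c) = Crossing"
      using Suc.prems assms by (auto simp: mat_block_def)
    then have "snd (mout (2 + 2 * r) (3 + 2 * c)) = snd (mout (1 + 2 * r) (3 + 2 * c))"
      using Suc.prems assms by (subst mout_rec) auto
    then show ?thesis using 1 Suc False by (auto simp: less_Suc_eq)
  next
    case True
    then have 2: "mat_block m mem (2 + 2 * r) (3 + 2 * c) = Disjunction"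
      "mat_block m mem (2 + 2 * r) (2 + 2 * c) = Multiplier_N"
      "mat_block m mem (1 + 2 * r) (2 + 2 * c) = Multiplier_W"
      using Suc.prems assms by (auto simp: mat_block_def)
    have "snd (mout (2 + 2 * r) (3 + 2 * c)) \<longleftrightarrow>
      snd (mout (1 + 2 * r) (3 + 2 * c)) \<or> fst (mout (2 + 2 * r) (2 + 2 * c))"
      using Suc.prems assms 2 by (subst mout_rec) auto
    also have "fst (mout (2 + 2 * r) (2 + 2 * c)) = snd (mout (1 + 2 * r) (2 + 2 * c))"
      using Suc.prems assms 2 by (subst mout_rec) auto
    also have "\<dots> = fst (mout (1 + 2 * r) (1 + 2 * c))"
      using Suc.prems assms 2 by (subst mout_rec) auto
    also have "\<dots> = row_lit r"
      using mout_row[OF assms(1), of r "2 * c"] Suc.prems assms by simp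
    finally show ?thesis using 1 Suc True by (auto simp: less_Suc_eq)
  qed
qed

text \<open>Both outputs are stated, not just one: as they coincide, the value of the target is the
  same under every admissible convention.\<close>

lemma mout_last_row:
  assumes "even m" "c < m"
  shows "mout (2 * m + 1) (3 + 2 * c) =
    (let b = u (2 * m + 1, 1) \<and> (\<forall>c'\<le>c. \<exists>r<m. mem r c' \<and> row_lit r) in (b, b))"
  using assms(2)
proof (induction c)
  case 0
  have b: "mat_block m mem (2 * m + 1) 1 = Selector" "mat_block m mem (2 * m + 1) 2 = Crossing"
    "mat_block m mem (2 * m + 1) 3 = Conjunction"
    by (auto simp: mat_block_def)
  have "fst (mout (2 * m + 1) 2) = fst (mout (2 * m + 1) 1)"
    using b 0 by (subst mout_rec) auto
  also have "\<dots> = u (2 * m + 1, 1)"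
    using b by (subst mout_rec) auto
  finally show ?case using b 0 mout_column[OF assms(1), of 0 m]
    by (subst mout_rec) (auto simp: Let_def)
next
  case (Suc c)
  have b: "mat_block m mem (2 * m + 1) (4 + 2 * c) = Crossing"
    "mat_block m mem (2 * m + 1) (5 + 2 * c) = Conjunction"
    by (auto simp: mat_block_def)
  have "fst (mout (2 * m + 1) (4 + 2 * c)) = fst (mout (2 * m + 1) (3 + 2 * c))"
    using b Suc.prems by (subst mout_rec) auto
  moreover have "mout (2 * m + 1) (5 + 2 * c) =
    (let b = snd (mout (2 * m) (5 + 2 * c)) \<and> fst (mout (2 * m + 1) (4 + 2 * c)) in (b, b))"
    using b Suc.prems by (subst mout_rec) (auto simp: Let_def)
  ultimately show ?case using Suc mout_column[OF assms(1), of "Suc c" m]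
    by (auto simp: Let_def le_Suc_eq)
qed

end

lemma satisfiable_mat_circuit:
  assumes val: "value_convention val" and m: "even m" "0 < m"
  shows "satisfiable val (mat_circuit m mem) (2 * m + 1, 2 * m + 1) \<longleftrightarrow>
    (\<exists>\<alpha>. \<forall>c<m. \<exists>r<m. mem r c \<and> lit \<alpha> r)"
proof -
  have *: "val (outputs (mat_circuit m mem) u (2 * m + 1, 2 * m + 1)) \<longleftrightarrow>
    u (2 * m + 1, 1) \<and> (\<forall>c<m. \<exists>r<m. mem r c \<and> lit (\<lambda>v. u (1 + 4 * v, 1)) r)" for u
  proof -
    obtain k where k: "m = Suc k" using m by (cases m) auto
    then show ?thesis
      using mout_last_row[OF m(1), of k mem u] val
      by (simp add: Let_def value_convention_def row_lit_def less_Suc_eq_le numeral_eq_Suc)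
  qed
  show ?thesis
  proof
    assume "\<exists>\<alpha>. \<forall>c<m. \<exists>r<m. mem r c \<and> lit \<alpha> r"
    then obtain \<alpha> where \<alpha>: "\<forall>c<m. \<exists>r<m. mem r c \<and> lit \<alpha> r" by blast
    \<comment> \<open>Division by 4 recovers the variable from the row of its selector; row
      \<open>2 * m + 1\<close> holds the extra selector, which must be true.\<close>
    define u :: "cell \<Rightarrow> bool" where "u = (\<lambda>(i, j). i = 2 * m + 1 \<or> \<alpha> ((i - 1) div 4))"
    have "lit (\<lambda>v. u (1 + 4 * v, 1)) r = lit \<alpha> r" if "r < m" for r
    proof -
      \<comment> \<open>The selectors of the variables lie strictly above row
        \<open>2 * m + 1\<close>, so the two disjuncts defining \<open>u\<close> do not
        interfere.\<close>
      have "4 * (r div 2) < 2 * m" using that m by (auto elim!: evenE)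
      then show ?thesis using that by (simp add: lit_def u_def)
    qed
    then have "\<forall>c<m. \<exists>r<m. mem r c \<and> lit (\<lambda>v. u (1 + 4 * v, 1)) r" using \<alpha> by blast
    moreover have "u (2 * m + 1, 1)" by (simp add: u_def)
    ultimately show "satisfiable val (mat_circuit m mem) (2 * m + 1, 2 * m + 1)"
      unfolding satisfiable_def * by blast
  qed (unfold satisfiable_def *, blast)
qed

section \<open>Row-major listing of the circuit\<close>

lemma map_upt_pairs:
  "map f [0..<2 * m + 2] = f 0 # f 1 # concat (map (\<lambda>c. [f (2 + 2 * c), f (3 + 2 * c)]) [0..<m])"
  by (induction m) (auto simp: numeral_eq_Suc)

lemma map_upt_pairs':
  "map f [0..<2 * m + 2] = f 0 # concat (map (\<lambda>r. [f (1 + 2 * r), f (2 + 2 * r)]) [0..<m]) @ [f (2 * m + 1)]"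
  by (induction m) (auto simp: numeral_eq_Suc)

text \<open>This is the order in which \<open>emit_instance\<close> writes the blocks: columns are
  grouped as two single ones followed by pairs, rows as one, pairs, one.\<close>

lemma concat_mat_circuit:
  "concat (mat_circuit m mem) =
     replicate (2 * m + 2) Fixed @
     concat (map (\<lambda>r.
       Fixed # (if even r then Selector else Multiplier_N) #
         concat (map (\<lambda>c. upper_pair (mem r c)) [0..<m]) @
       Fixed # Crossing # concat (map (\<lambda>c. lower_pair (mem r c)) [0..<m])) [0..<m]) @
     Fixed # Selector # concat (map (\<lambda>c. [Crossing, Conjunction]) [0..<m])"
proof -
  have 0: "map (mat_block m mem 0) [0..<2 * m + 2] = replicate (2 * m + 2) Fixed"
    by (intro replicate_eqI) (auto simp: mat_block_def)
  have 1: "map (mat_block m mem (1 + 2 * r)) [0..<2 * m + 2] =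
      Fixed # (if even r then Selector else Multiplier_N) #
         concat (map (\<lambda>c. upper_pair (mem r c)) [0..<m])" if "r < m" for r
    unfolding map_upt_pairs using that
    by (auto simp: mat_block_def intro!: arg_cong[where f = concat])
  have 2: "map (mat_block m mem (2 + 2 * r)) [0..<2 * m + 2] =
      Fixed # Crossing # concat (map (\<lambda>c. lower_pair (mem r c)) [0..<m])" if "r < m" for r
    unfolding map_upt_pairs using that
    by (auto simp: mat_block_def intro!: arg_cong[where f = concat])
  have 3: "map (mat_block m mem (2 * m + 1)) [0..<2 * m + 2] =
      Fixed # Selector # concat (map (\<lambda>c. [Crossing, Conjunction]) [0..<m])"
    unfolding map_upt_pairs by (auto simp: mat_block_def intro!: arg_cong[where f = concat])
  have *: "concat (a # concat (map (\<lambda>r. [g r, h r]) rs) @ [b]) =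
    a @ concat (map (\<lambda>r. g r @ h r) rs) @ b"
    for a b :: "block list" and g h and rs :: "nat list"
  proof -
    have "concat (concat (map (\<lambda>r. [g r, h r]) rs)) = concat (map (\<lambda>r. g r @ h r) rs)"
      by (induction rs) auto
    then show ?thesis by simp
  qed
  have "concat (map (\<lambda>r. map (mat_block m mem (1 + 2 * r)) [0..<2 * m + 2] @
      map (mat_block m mem (2 + 2 * r)) [0..<2 * m + 2]) [0..<m]) =
    concat (map (\<lambda>r.
       Fixed # (if even r then Selector else Multiplier_N) #
         concat (map (\<lambda>c. upper_pair (mem r c)) [0..<m]) @
       Fixed # Crossing # concat (map (\<lambda>c. lower_pair (mem r c)) [0..<m])) [0..<m])"
    using 1 2 by (intro arg_cong[where f = concat] map_cong) (simp_all del: upt_Suc)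
  then show ?thesis
    unfolding mat_circuit_def map_upt_pairs'[of "\<lambda>i. map (mat_block m mem i) [0..<2 * m + 2]"]
      * 0 3 by simp
qed

section \<open>A structured language for deterministic machines\<close>

type_synonym store = "nat \<Rightarrow> tape"

text \<open>\<open>Do g\<close> acts on all tapes in one step, as a machine does. A store has
  infinitely many tapes, which spares programs any bookkeeping about their number.\<close>

datatype prog =
    Do "(nat \<Rightarrow> nat) \<Rightarrow> nat \<Rightarrow> action"
  | Seq prog prog
  | While "(nat \<Rightarrow> nat) \<Rightarrow> bool" prog

abbreviation reads :: "store \<Rightarrow> nat \<Rightarrow> nat" where
  "reads \<sigma> \<equiv> (\<lambda>i. read (\<sigma> i))"

inductive exec :: "prog \<Rightarrow> store \<Rightarrow> nat \<Rightarrow> store \<Rightarrow> bool" where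
  Do: "exec (Do g) \<sigma> 1 (\<lambda>i. act (g (reads \<sigma>) i) (\<sigma> i))"
| Seq: "exec p \<sigma> t \<sigma>' \<Longrightarrow> exec q \<sigma>' t' \<sigma>'' \<Longrightarrow> exec (Seq p q) \<sigma> (t + t') \<sigma>''"
| While_False: "\<not> b (reads \<sigma>) \<Longrightarrow> exec (While b p) \<sigma> 1 \<sigma>"
| While_True: "b (reads \<sigma>) \<Longrightarrow> exec p \<sigma> t \<sigma>' \<Longrightarrow> exec (While b p) \<sigma>' t' \<sigma>'' \<Longrightarrow>
    exec (While b p) \<sigma> (Suc (t + t')) \<sigma>''"

primrec psize :: "prog \<Rightarrow> nat" where
  "psize (Do g) = 1"
| "psize (Seq p q) = psize p + psize q"
| "psize (While b p) = Suc (psize p)"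

text \<open>State \<open>psize p\<close> stands for leaving \<open>p\<close>. In a sequence the exit
  of the first part is thus the entry of the second, shifted by the size of the first; a loop tests
  in state 0, and the exit of its body leads back there.\<close>

primrec delta :: "prog \<Rightarrow> nat \<Rightarrow> (nat \<Rightarrow> nat) \<Rightarrow> nat \<times> (nat \<Rightarrow> action)" where
  "delta (Do g) s \<rho> = (1, g \<rho>)"
| "delta (Seq p q) s \<rho> =
     (if s < psize p then delta p s \<rho>
      else map_prod (\<lambda>s'. s' + psize p) id (delta q (s - psize p) \<rho>))"
| "delta (While b p) s \<rho> =
     (if s = 0 then (if b \<rho> then 1 else Suc (psize p), \<lambda>i. (\<rho> i, Stay))
      else map_prod (\<lambda>s'. if s' = psize p then 0 else Suc s') id (delta p (s - 1) \<rho>))"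

definition sstep :: "prog \<Rightarrow> nat \<times> store \<Rightarrow> nat \<times> store \<Rightarrow> bool" where
  "sstep p c c' \<longleftrightarrow> fst c < psize p \<and>
     c' = (fst (delta p (fst c) (reads (snd c))),
           \<lambda>i. act (snd (delta p (fst c) (reads (snd c))) i) (snd c i))"

lemma psize_pos [simp]: "0 < psize p"
  by (induction p) auto

lemma relpow_map:
  assumes "(R ^^ n) x y" "\<And>x y. R x y \<Longrightarrow> R' (f x) (f y)"
  shows "(R' ^^ n) (f x) (f y)"
  using assms(1)
proof (induction n arbitrary: y)
  case (Suc n)
  then show ?case using assms(2) by (auto intro!: relcomppI)
qed simp

lemma act_stay [simp]: "act (read tp, Stay) tp = tp"
  by (cases tp) simp

text \<open>Subprograms are embedded by shifting their states, and \<open>relpow_map\<close>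
  transports their runs along the embedding with exact step counts.\<close>

lemma exec_sstep: "exec p \<sigma> t \<sigma>' \<Longrightarrow> (sstep p ^^ t) (0, \<sigma>) (psize p, \<sigma>')"
proof (induction rule: exec.induct)
  case (Do g \<sigma>)
  have "sstep (Do g) (0, \<sigma>) (1, \<lambda>i. act (g (reads \<sigma>) i) (\<sigma> i))" by (simp add: sstep_def)
  then show ?case by (auto simp: eq_OO)
next
  case (Seq p \<sigma> t \<sigma>' q t' \<sigma>'')
  have 1: "(sstep (Seq p q) ^^ t) (id (0, \<sigma>)) (id (psize p, \<sigma>'))"
    by (rule relpow_map[OF Seq.IH(1)]) (auto simp: sstep_def)
  have 2: "(sstep (Seq p q) ^^ t') (map_prod (\<lambda>s. s + psize p) id (0, \<sigma>'))
      (map_prod (\<lambda>s. s + psize p) id (psize q, \<sigma>''))"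
    by (rule relpow_map[OF Seq.IH(2)]) (auto simp: sstep_def)
  from relpowp_trans[of t "sstep (Seq p q)" "(0, \<sigma>)" "(psize p, \<sigma>')"] 1 2
  show ?case by (simp add: add.commute[of _ "psize p"])
next
  case (While_False b \<sigma> p)
  then have "sstep (While b p) (0, \<sigma>) (Suc (psize p), \<sigma>)" by (simp add: sstep_def)
  then show ?case by (auto simp: eq_OO)
next
  case (While_True b \<sigma> p t \<sigma>' t' \<sigma>'')
  let ?f = "map_prod (\<lambda>s. if s = psize p then 0 else Suc s) (id :: store \<Rightarrow> store)"
  have "sstep (While b p) (0, \<sigma>) (?f (0, \<sigma>))"
    using While_True.hyps by (simp add: sstep_def)
  moreover have "(sstep (While b p) ^^ t) (?f (0, \<sigma>)) (?f (psize p, \<sigma>'))"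
    by (rule relpow_map[OF While_True.IH(1)]) (auto simp: sstep_def)
  ultimately have "(sstep (While b p) ^^ (Suc t)) (0, \<sigma>) (?f (psize p, \<sigma>'))"
    by (rule relpowp_Suc_I2)
  then have "(sstep (While b p) ^^ (Suc t)) (0, \<sigma>) (0, \<sigma>')" by simp
  from relpowp_trans[OF this While_True.IH(2)] show ?case by simp
qed

primrec wf_prog :: "nat \<Rightarrow> nat \<Rightarrow> prog \<Rightarrow> bool" where
  "wf_prog K S (Do g) \<longleftrightarrow>
     (\<forall>\<rho> i. K \<le> i \<longrightarrow> \<rho> i = 0 \<longrightarrow> g \<rho> i = (0, Stay)) \<and>
     (\<forall>\<rho> i. (\<forall>j. \<rho> j < S) \<longrightarrow> fst (g \<rho> i) < S)"
| "wf_prog K S (Seq p q) \<longleftrightarrow> wf_prog K S p \<and> wf_prog K S q"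
| "wf_prog K S (While b p) \<longleftrightarrow> wf_prog K S p"

definition prog_tm :: "nat \<Rightarrow> nat \<Rightarrow> prog \<Rightarrow> tm" where
  "prog_tm K S p = \<lparr>num_tapes = K, num_states = Suc (psize p), num_symbols = S,
     start_state = 0, accept_states = {},
     trans = (\<lambda>q ss. if q < psize p then
       {map_prod id (\<lambda>a. map a [0..<K]) (delta p q (\<lambda>i. if i < K then ss ! i else 0))} else {})\<rparr>"

lemma delta_le: "s < psize p \<Longrightarrow> fst (delta p s \<rho>) \<le> psize p"
proof (induction p arbitrary: s)
  case (Seq p q)
  then show ?case by (auto intro: trans_le_add1)
next
  case (While b p)
  have "fst (delta p (s - 1) \<rho>) \<le> psize p" if "s \<noteq> 0" using While that by auto
  then show ?case by auto
qed auto

lemma delta_symbols: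
  "wf_prog K S p \<Longrightarrow> (\<forall>j. \<rho> j < S) \<Longrightarrow> fst (snd (delta p s \<rho>) i) < S"
  by (induction p arbitrary: s) auto

lemma delta_outside:
  "wf_prog K S p \<Longrightarrow> K \<le> i \<Longrightarrow> \<rho> i = 0 \<Longrightarrow> snd (delta p s \<rho>) i = (0, Stay)"
  by (induction p arbitrary: s) auto

lemma wf_prog_tm:
  assumes "wf_prog K S p" "1 \<le> K" "3 \<le> S"
  shows "wf_tm (prog_tm K S p)"
proof -
  have "fst (delta p q (\<lambda>i. if i < K then ss ! i else 0)) < Suc (psize p)"
    "fst (snd (delta p q (\<lambda>i. if i < K then ss ! i else 0)) i) < S"
    if "q < psize p" "length ss = K" "set ss \<subseteq> {..<S}" for q ss i
  proof -
    have "(if j < K then ss ! j else 0) < S" for j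
      using that assms nth_mem[of j ss] by (auto simp del: nth_mem)
    then show "fst (snd (delta p q (\<lambda>i. if i < K then ss ! i else 0)) i) < S"
      using assms by (intro delta_symbols) auto
  qed (use that delta_le in \<open>simp add: less_Suc_eq_le\<close>)
  then show ?thesis
    using assms by (auto simp: wf_tm_def prog_tm_def map_prod_def split: prod.splits) (metis fst_conv snd_conv)+
qed

lemma deterministic_prog_tm: "deterministic (prog_tm K S p)"
  by (auto simp: deterministic_def prog_tm_def)

section \<open>Simulation of programs by machines with finitely many tapes\<close>

definition tapes :: "nat \<Rightarrow> store \<Rightarrow> tape list" where
  "tapes K \<sigma> = map \<sigma> [0..<K]"

definition blank_outside :: "nat \<Rightarrow> store \<Rightarrow> bool" where
  "blank_outside K \<sigma> \<longleftrightarrow> (\<forall>i\<ge>K. \<sigma> i = (\<lambda>_. 0, 0))"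

text \<open>The machine supplies 0 for the tapes it does not have. This agrees with the store as
  long as those tapes are blank, so the invariant is carried along in the conclusion.\<close>

lemma sstep_step:
  assumes "sstep p (s, \<sigma>) (s', \<sigma>')" "wf_prog K S p" "blank_outside K \<sigma>"
  shows "step (prog_tm K S p) (s, tapes K \<sigma>) (s', tapes K \<sigma>') \<and> blank_outside K \<sigma>'"
proof -
  have r: "(\<lambda>i. if i < K then map read (tapes K \<sigma>) ! i else 0) = reads \<sigma>"
    using assms(3) by (auto simp: tapes_def blank_outside_def not_less)
  have "map2 act (map a [0..<K]) (tapes K \<sigma>) = map (\<lambda>i. act (a i) (\<sigma> i)) [0..<K]" for a
    by (simp add: tapes_def zip_map_map comp_def zip_same_conv_map)
  moreover have "s < psize p" "s' = fst (delta p s (reads \<sigma>))"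
    "\<sigma>' = (\<lambda>i. act (snd (delta p s (reads \<sigma>)) i) (\<sigma> i))"
    using assms(1) by (auto simp: sstep_def)
  ultimately have "step (prog_tm K S p) (s, tapes K \<sigma>) (s', tapes K \<sigma>')"
    unfolding step_def prog_tm_def by (simp add: r map_prod_def split: prod.splits) (simp add: tapes_def)
  moreover have "blank_outside K \<sigma>'"
    using assms delta_outside[OF assms(2), of _ "reads \<sigma>" s]
    by (auto simp: sstep_def blank_outside_def)
  ultimately show ?thesis by blast
qed

lemma ssteps_steps:
  assumes "(sstep p ^^ t) (s, \<sigma>) (s', \<sigma>')" "wf_prog K S p" "blank_outside K \<sigma>"
  shows "(step (prog_tm K S p) ^^ t) (s, tapes K \<sigma>) (s', tapes K \<sigma>') \<and> blank_outside K \<sigma>'"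
  using assms(1)
proof (induction t arbitrary: s' \<sigma>')
  case (Suc t)
  then obtain s1 \<sigma>1 where "(sstep p ^^ t) (s, \<sigma>) (s1, \<sigma>1)" "sstep p (s1, \<sigma>1) (s', \<sigma>')"
    by auto
  then show ?case using Suc.IH sstep_step[OF _ assms(2)] by (auto intro!: relcomppI)
qed (use assms in auto)

definition init_store :: "bool list \<Rightarrow> store" where
  "init_store x = (\<lambda>i. (if i = 0 then contents x else (\<lambda>_. 0), 0))"

lemma polytime_computableI:
  assumes "wf_prog K S p" "1 \<le> K" "3 \<le> S"
    and "\<And>x. \<exists>t \<sigma>. t \<le> poly B (length x) \<and> exec p (init_store x) t \<sigma> \<and>
      fst (\<sigma> (K - 1)) = contents (f x)"
  shows "polytime_computable f"
  unfolding polytime_computable_def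
proof (intro exI[of _ "prog_tm K S p"] exI[of _ B] conjI allI)
  show "wf_tm (prog_tm K S p)" "deterministic (prog_tm K S p)"
    using assms wf_prog_tm deterministic_prog_tm by auto
  fix x
  obtain t \<sigma> where t: "t \<le> poly B (length x)" and ex: "exec p (init_store x) t \<sigma>"
    and f: "fst (\<sigma> (K - 1)) = contents (f x)" using assms(4) by blast
  obtain k where k: "K = Suc k" using assms(2) by (cases K) auto
  have "contents [] = (\<lambda>_. 0)" by (auto simp: contents_def)
  then have "map (init_store x) [0..<K] = (contents x, 0) # replicate k (contents [], 0)"
    unfolding k by (subst upt_conv_Cons, simp, subst list.map(2), intro arg_cong2[where f = Cons])
      (auto simp: init_store_def intro!: replicate_eqI)
  then have i: "init (prog_tm K S p) x = (0, tapes K (init_store x))"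
    using k by (simp add: init_def prog_tm_def tapes_def)
  have "blank_outside K (init_store x)"
    using assms(2) by (auto simp: blank_outside_def init_store_def)
  then have "(step (prog_tm K S p) ^^ t) (init (prog_tm K S p) x) (psize p, tapes K \<sigma>)"
    using ssteps_steps[OF exec_sstep[OF ex] assms(1)] i by simp
  moreover have "halting (prog_tm K S p) (psize p, tapes K \<sigma>)"
    by (auto simp: halting_def step_def prog_tm_def)
  moreover have "fst (last (tapes K \<sigma>)) = contents (f x)"
    using f k by (simp add: tapes_def)
  ultimately show "\<exists>t c. t \<le> poly B (length x) \<and>
      (step (prog_tm K S p) ^^ t) (init (prog_tm K S p) x) c \<and>
      halting (prog_tm K S p) c \<and> fst (last (snd c)) = contents (f x)"
    using t by (intro exI[of _ t] exI[of _ "(psize p, tapes K \<sigma>)"]) simp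
qed

section \<open>Loops over marked tapes\<close>

definition dirv :: "direction \<Rightarrow> int" where
  "dirv d = shift d 0"

lemma dirv_simps [simp]: "dirv Go_Left = -1" "dirv Stay = 0" "dirv Go_Right = 1"
  by (auto simp: dirv_def)

lemma shift_dirv: "shift d h = h + dirv d"
  by (cases d) auto

definition cfg :: "(nat \<Rightarrow> int \<Rightarrow> nat) \<Rightarrow> (nat \<Rightarrow> int) \<Rightarrow> store" where
  "cfg f h = (\<lambda>i. (f i, h i))"

text \<open>The integer \<open>z\<close> counts applications of the move; negative values undo it,
  so the return trip of a loop is the same function.\<close>

definition adv :: "(nat \<Rightarrow> direction) \<Rightarrow> int \<Rightarrow> (nat \<Rightarrow> int) \<Rightarrow> nat \<Rightarrow> int" where
  "adv m z h = (\<lambda>i. h i + z * dirv (m i))"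

definition Move :: "(nat \<Rightarrow> direction) \<Rightarrow> prog" where
  "Move m = Do (\<lambda>\<rho> i. (\<rho> i, m i))"

lemma adv_0 [simp]: "adv m 0 h = h"
  by (simp add: adv_def)

lemma adv_adv [simp]: "adv m y (adv m z h) = adv m (y + z) h"
  by (auto simp: adv_def algebra_simps)

lemma exec_Do': "\<sigma>' = (\<lambda>i. act (g (reads \<sigma>) i) (\<sigma> i)) \<Longrightarrow> t = 1 \<Longrightarrow> exec (Do g) \<sigma> t \<sigma>'"
  using exec.Do by simp

lemma exec_Move: "exec (Move m) (cfg f h) 1 (cfg f (adv m 1 h))"
  unfolding Move_def by (rule exec_Do') (auto simp: cfg_def adv_def shift_dirv)

lemma exec_scan:
  assumes "\<And>i. i < n \<Longrightarrow> f r (h r + int i * dirv (m r)) \<noteq> 0"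
    and "f r (h r + int n * dirv (m r)) = 0"
  shows "exec (While (\<lambda>\<rho>. \<rho> r \<noteq> 0) (Move m)) (cfg f h) (2 * n + 1) (cfg f (adv m (int n) h))"
  using assms
proof (induction n arbitrary: h)
  case 0
  then show ?case using exec.While_False[of "\<lambda>\<rho>. \<rho> r \<noteq> 0" "cfg f h"] by (simp add: cfg_def)
next
  case (Suc n)
  have *: "adv m 1 h r + int i * dirv (m r) = h r + int (Suc i) * dirv (m r)" for i
    by (simp add: adv_def algebra_simps)
  have IH: "exec (While (\<lambda>\<rho>. \<rho> r \<noteq> 0) (Move m)) (cfg f (adv m 1 h)) (2 * n + 1)
      (cfg f (adv m (int n) (adv m 1 h)))"
    using Suc.prems unfolding *[symmetric] by (intro Suc.IH) (auto simp: * simp del: of_nat_Suc)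
  have "reads (cfg f h) r \<noteq> 0" using Suc.prems(1)[of 0] by (simp add: cfg_def)
  from exec.While_True[of "\<lambda>\<rho>. \<rho> r \<noteq> 0", OF this exec_Move IH] show ?case
    by (simp add: add.commute)
qed

section \<open>Programs that append to an output word\<close>

definition word :: "nat list \<Rightarrow> int \<Rightarrow> nat" where
  "word l z = (if 0 \<le> z \<and> z < int (length l) then l ! nat z else 0)"

lemma word_Nil [simp]: "word [] = (\<lambda>_. 0)"
  by (auto simp: word_def)

lemma word_snoc: "word (l @ [s]) = (word l)(int (length l) := s)"
  by (auto simp: word_def nth_append fun_eq_iff nat_less_iff)

text \<open>The tapes in \<open>W\<close> all hold the output written so far, with the head just behind it.\<close>

definition st :: "(nat \<Rightarrow> int \<Rightarrow> nat) \<Rightarrow> nat set \<Rightarrow> (nat \<Rightarrow> int) \<Rightarrow> nat list \<Rightarrow> store" where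
  "st f W h l = (\<lambda>i. if i \<in> W then (word l, int (length l)) else (f i, h i))"

text \<open>On an output tape the head is just behind the word and reads a blank, so what a program
  reads does not depend on what it has written.\<close>

definition rd :: "(nat \<Rightarrow> int \<Rightarrow> nat) \<Rightarrow> nat set \<Rightarrow> (nat \<Rightarrow> int) \<Rightarrow> nat \<Rightarrow> nat" where
  "rd f W h = (\<lambda>i. if i \<in> W then 0 else f i (h i))"

lemma st_cfg: "st f W h l = cfg (\<lambda>i. if i \<in> W then word l else f i) (\<lambda>i. if i \<in> W then int (length l) else h i)"
  by (auto simp: st_def cfg_def)

lemma read_st: "read (st f W h l i) = rd f W h i"
  by (auto simp: st_def rd_def word_def)

text \<open>Quantifying over the word \<open>l\<close> already written, and restoring all heads
  \<open>h\<close>, makes a fragment independent of its context: fragments are sequenced and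
  repeated by concatenating their words.\<close>

definition gen where
  "gen f W p h w \<tau> \<longleftrightarrow> (\<forall>l. \<exists>t\<le>\<tau>. exec p (st f W h l) t (st f W h (l @ w)))"

lemma gen_Seq:
  assumes "gen f W p h v \<tau>" "gen f W q h w \<tau>'"
  shows "gen f W (Seq p q) h (v @ w) (\<tau> + \<tau>')"
  unfolding gen_def
proof
  fix l
  obtain t where "t \<le> \<tau>" "exec p (st f W h l) t (st f W h (l @ v))"
    using assms(1) unfolding gen_def by blast
  moreover obtain t' where "t' \<le> \<tau>'" "exec q (st f W h (l @ v)) t' (st f W h ((l @ v) @ w))"
    using assms(2) unfolding gen_def by blast
  ultimately show "\<exists>t\<le>\<tau> + \<tau>'. exec (Seq p q) (st f W h l) t (st f W h (l @ v @ w))"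
    by (intro exI[of _ "t + t'"]) (auto intro: exec.Seq)
qed

definition Emit :: "nat set \<Rightarrow> ((nat \<Rightarrow> nat) \<Rightarrow> nat) \<Rightarrow> prog" where
  "Emit W g = Do (\<lambda>\<rho> i. if i \<in> W then (g \<rho>, Go_Right) else (\<rho> i, Stay))"

lemma gen_Emit: "gen f W (Emit W g) h [g (rd f W h)] 1"
  unfolding gen_def Emit_def
proof
  fix l
  have "exec (Do (\<lambda>\<rho> i. if i \<in> W then (g \<rho>, Go_Right) else (\<rho> i, Stay))) (st f W h l) 1
    (st f W h (l @ [g (rd f W h)]))"
    by (rule exec_Do', unfold read_st) (auto simp: st_def rd_def word_snoc fun_eq_iff)
  then show "\<exists>t\<le>1. exec (Do (\<lambda>\<rho> i. if i \<in> W then (g \<rho>, Go_Right) else (\<rho> i, Stay))) (st f W h l) t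
    (st f W h (l @ [g (rd f W h)]))" by blast
qed

definition Skip :: prog where
  "Skip = Move (\<lambda>_. Stay)"

lemma gen_Skip: "gen f W Skip h [] 1"
proof -
  have "exec Skip (cfg F H) 1 (cfg F H)" for F H
    using exec_Move[of "\<lambda>_. Stay" F H] unfolding Skip_def by (simp add: adv_def)
  then show ?thesis unfolding gen_def st_cfg append_Nil2 by blast
qed

primrec Seqs :: "prog list \<Rightarrow> prog" where
  "Seqs [] = Skip"
| "Seqs (p # ps) = Seq p (Seqs ps)"

lemma gen_Seqs:
  assumes "\<And>x. x \<in> set xs \<Longrightarrow> gen f W (P x) h (w x) \<tau>"
  shows "gen f W (Seqs (map P xs)) h (concat (map w xs)) (Suc (length xs * \<tau>))"
  using assms
proof (induction xs)
  case Nil then show ?case using gen_Skip by simp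
next
  case (Cons x xs)
  then have "gen f W (P x) h (w x) \<tau>"
    "gen f W (Seqs (map P xs)) h (concat (map w xs)) (Suc (length xs * \<tau>))" by auto
  from gen_Seq[OF this] show ?case by simp
qed

definition opp :: "direction \<Rightarrow> direction" where
  "opp d = (case d of Go_Left \<Rightarrow> Go_Right | Stay \<Rightarrow> Stay | Go_Right \<Rightarrow> Go_Left)"

lemma dirv_opp [simp]: "dirv (opp d) = - dirv d"
  by (cases d) (auto simp: opp_def)

lemma opp_Stay [simp]: "opp Stay = Stay"
  by (auto simp: opp_def)

lemma adv_opp [simp]: "adv (\<lambda>i. opp (m i)) z h = adv m (- z) h"
  by (auto simp: adv_def)

text \<open>The loop ends with the counter head on the blank behind its word. The second half steps
  back, scans to the blank on the left and moves forward once; all heads coupled by \<open>m\<close>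
  retrace their way.\<close>

definition For :: "nat \<Rightarrow> (nat \<Rightarrow> direction) \<Rightarrow> prog \<Rightarrow> prog" where
  "For r m p = Seq (While (\<lambda>\<rho>. \<rho> r \<noteq> 0) (Seq p (Move m)))
     (Seq (Move (\<lambda>i. opp (m i))) (Seq (While (\<lambda>\<rho>. \<rho> r \<noteq> 0) (Move (\<lambda>i. opp (m i)))) (Move m)))"

text \<open>The loop takes \<open>n * (\<tau> + 2) + 1\<close> steps, the scan back
  \<open>2 * n + 1\<close>, and there are two single moves.\<close>

definition for_time :: "nat \<Rightarrow> nat \<Rightarrow> nat" where
  "for_time n \<tau> = n * (\<tau> + 4) + 4"

lemma adv_st:
  assumes "\<forall>i\<in>W. m i = Stay"
  shows "cfg (\<lambda>i. if i \<in> W then word l else f i) (adv m z (\<lambda>i. if i \<in> W then int (length l) else h i)) =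
    st f W (adv m z h) l"
  using assms by (auto simp: cfg_def st_def adv_def)

lemma gen_For:
  assumes body: "\<And>i. i < n \<Longrightarrow> gen f W p (adv m (int i) h) (w i) \<tau>"
    and r: "h r = 0" "m r = Go_Right" "\<forall>i\<in>W. m i = Stay"
      "\<And>z. f r z \<noteq> 0 \<longleftrightarrow> 0 \<le> z \<and> z < int n"
  shows "gen f W (For r m p) h (concat (map w [0..<n])) (for_time n \<tau>)"
  unfolding gen_def
proof
  fix l
  have rW: "r \<notin> W" using r(2,3) by auto
  have move: "exec (Move m) (st f W h l) 1 (st f W (adv m 1 h) l)" for h l
    by (subst adv_st[OF r(3), symmetric], subst st_cfg[of f W h l], rule exec_Move)
  have counter: "adv m z h r = z" for z
    using r(1,2) by (simp add: adv_def)
  \<comment> \<open>Induction on the number \<open>k\<close> of remaining iterations, with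
    \<open>l\<close> arbitrary because the written word grows.\<close>
  have loop: "\<exists>t. t \<le> k * (\<tau> + 2) + 1 \<and> exec (While (\<lambda>\<rho>. \<rho> r \<noteq> 0) (Seq p (Move m)))
      (st f W (adv m (int (n - k)) h) l) t
      (st f W (adv m (int n) h) (l @ concat (map w [n - k..<n])))" if "k \<le> n" for k l
    using that
  proof (induction k arbitrary: l)
    case 0
    have "\<not> reads (st f W (adv m (int n) h) l) r \<noteq> 0"
      unfolding read_st using r(4)[of "int n"] rW by (simp add: rd_def counter)
    from exec.While_False[of "\<lambda>\<rho>. \<rho> r \<noteq> 0" "st f W (adv m (int n) h) l", OF this] show ?case
      by (intro exI[of _ 1]) simp
  next
    case (Suc k)
    let ?i = "n - Suc k"
    have "?i < n" using Suc.prems by simp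
    from body[OF this, unfolded gen_def] obtain t1 where t1: "t1 \<le> \<tau>"
      "exec p (st f W (adv m (int ?i) h) l) t1 (st f W (adv m (int ?i) h) (l @ w ?i))"
      by (elim allE[of _ l] exE conjE)
    have i: "int ?i + 1 = int (n - k)" "1 + int ?i = int (n - k)" "[?i..<n] = ?i # [n - k..<n]"
      using Suc.prems by (auto simp: upt_conv_Cons Suc_diff_Suc)
    have s: "exec (Seq p (Move m)) (st f W (adv m (int ?i) h) l) (t1 + 1)
        (st f W (adv m (int (n - k)) h) (l @ w ?i))"
      using exec.Seq[OF t1(2) move] unfolding adv_adv i(2) .
    have "k \<le> n" using Suc.prems by simp
    from Suc.IH[OF this, of "l @ w ?i"] obtain t2 where t2: "t2 \<le> k * (\<tau> + 2) + 1"
      "exec (While (\<lambda>\<rho>. \<rho> r \<noteq> 0) (Seq p (Move m))) (st f W (adv m (int (n - k)) h) (l @ w ?i)) t2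
        (st f W (adv m (int n) h) ((l @ w ?i) @ concat (map w [n - k..<n])))"
      by (elim exE conjE)
    have "reads (st f W (adv m (int ?i) h) l) r \<noteq> 0"
      unfolding read_st using r(4)[of "int ?i"] rW Suc.prems by (simp add: rd_def counter)
    from exec.While_True[of "\<lambda>\<rho>. \<rho> r \<noteq> 0" "st f W (adv m (int ?i) h) l", OF this s t2(2)] show ?case
      using t1(1) t2(1) unfolding i(3) by (intro exI[of _ "Suc (t1 + 1 + t2)"]) simp
  qed
  from loop[OF order_refl, of l]
  obtain t where t: "t \<le> n * (\<tau> + 2) + 1" "exec (While (\<lambda>\<rho>. \<rho> r \<noteq> 0) (Seq p (Move m)))
      (st f W h l) t (st f W (adv m (int n) h) (l @ concat (map w [0..<n])))"
    unfolding diff_self_eq_0 of_nat_0 adv_0 by (elim exE conjE)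
  let ?l = "l @ concat (map w [0..<n])" and ?m = "\<lambda>i. opp (m i)"
  let ?F = "\<lambda>i. if i \<in> W then word ?l else f i"
  let ?H = "\<lambda>z. adv m z (\<lambda>i. if i \<in> W then int (length ?l) else h i)"
  have st: "st f W (adv m z h) ?l = cfg ?F (?H z)" for z
    by (rule adv_st[OF r(3), symmetric])
  have 1: "exec (Move ?m) (cfg ?F (?H (int n))) 1 (cfg ?F (?H (int n - 1)))"
    using exec_Move[of ?m ?F "?H (int n)"] by simp
  have H: "?H z r = z" for z using r(1,2) rW by (simp add: adv_def)
  have "exec (While (\<lambda>\<rho>. \<rho> r \<noteq> 0) (Move ?m)) (cfg ?F (?H (int n - 1))) (2 * n + 1)
      (cfg ?F (adv ?m (int n) (?H (int n - 1))))"
  proof (rule exec_scan)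
    fix i assume "i < n"
    then show "?F r (?H (int n - 1) r + int i * dirv (?m r)) \<noteq> 0"
      unfolding H using r(2,4) rW by simp
  next
    show "?F r (?H (int n - 1) r + int n * dirv (?m r)) = 0"
      unfolding H using r(2) r(4)[of "-1"] rW by simp
  qed
  then have 2: "exec (While (\<lambda>\<rho>. \<rho> r \<noteq> 0) (Move ?m)) (cfg ?F (?H (int n - 1))) (2 * n + 1)
      (cfg ?F (?H (-1)))" by simp
  have 3: "exec (Move m) (cfg ?F (?H (-1))) 1 (cfg ?F (?H 0))"
    using exec_Move[of m ?F "?H (-1)"] by simp
  have "exec (For r m p) (st f W h l) (t + (1 + (2 * n + 1 + 1))) (cfg ?F (?H 0))"
    unfolding For_def by (rule exec.Seq[OF t(2)[unfolded st] exec.Seq[OF 1 exec.Seq[OF 2 3]]])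
  then have "exec (For r m p) (st f W h l) (t + (1 + (2 * n + 1 + 1))) (st f W h ?l)"
    using st[of 0] by simp
  then show "\<exists>t\<le>for_time n \<tau>. exec (For r m p) (st f W h l) t (st f W h ?l)"
    using t(1) by (intro exI[of _ "t + (1 + (2 * n + 1 + 1))"]) (auto simp: for_time_def algebra_simps)
qed

definition only :: "nat set \<Rightarrow> direction \<Rightarrow> nat \<Rightarrow> direction" where
  "only W d i = (if i \<in> W then d else Stay)"

definition Rewind :: "nat \<Rightarrow> nat set \<Rightarrow> prog" where
  "Rewind r W = Seq (Move (only W Go_Left))
     (Seq (While (\<lambda>\<rho>. \<rho> r \<noteq> 0) (Move (only W Go_Left))) (Move (only W Go_Right)))"

text \<open>The return is a scan for the blank in front of the word, so the word itself must not
  contain 0.\<close>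

lemma exec_Rewind:
  assumes "r \<in> W" "0 \<notin> set l"
  shows "exec (Rewind r W) (st f W h l) (2 * length l + 3)
    (cfg (\<lambda>i. if i \<in> W then word l else f i) (\<lambda>i. if i \<in> W then 0 else h i))"
proof -
  let ?F = "\<lambda>i. if i \<in> W then word l else f i"
  let ?H = "\<lambda>z. adv (only W Go_Right) z (\<lambda>i. if i \<in> W then 0 else h i)"
  have m: "adv (only W Go_Left) z H = adv (only W Go_Right) (- z) H" for z H
    by (auto simp: adv_def only_def)
  have st: "st f W h l = cfg ?F (?H (int (length l)))"
    by (auto simp: cfg_def st_def adv_def only_def)
  have 1: "exec (Move (only W Go_Left)) (st f W h l) 1 (cfg ?F (?H (int (length l) - 1)))"
    using exec_Move[of "only W Go_Left" ?F "?H (int (length l))"] unfolding m st by simp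
  have H: "?H z r = z" for z using assms by (simp add: adv_def only_def)
  have "exec (While (\<lambda>\<rho>. \<rho> r \<noteq> 0) (Move (only W Go_Left))) (cfg ?F (?H (int (length l) - 1)))
      (2 * length l + 1) (cfg ?F (adv (only W Go_Left) (int (length l)) (?H (int (length l) - 1))))"
  proof (rule exec_scan)
    fix i assume i: "i < length l"
    then have "word l (int (length l) - 1 - int i) = l ! (length l - 1 - i)"
      by (auto simp: word_def nat_diff_distrib' intro!: arg_cong[where f = "(!) l"])
    moreover have "l ! (length l - 1 - i) \<in> set l" using i by (intro nth_mem) auto
    ultimately show "?F r (?H (int (length l) - 1) r + int i * dirv (only W Go_Left r)) \<noteq> 0"
      unfolding H using assms by (metis only_def dirv_simps(1) mult_minus1_right uminus_add_conv_diff add.commute)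
  qed (unfold H, use assms in \<open>auto simp: only_def word_def\<close>)
  then have 2: "exec (While (\<lambda>\<rho>. \<rho> r \<noteq> 0) (Move (only W Go_Left))) (cfg ?F (?H (int (length l) - 1)))
      (2 * length l + 1) (cfg ?F (?H (-1)))" unfolding m by simp
  have 3: "exec (Move (only W Go_Right)) (cfg ?F (?H (-1))) 1 (cfg ?F (?H 0))"
    using exec_Move[of "only W Go_Right" ?F "?H (-1)"] by simp
  have "exec (Rewind r W) (st f W h l) (1 + (2 * length l + 1 + 1)) (cfg ?F (?H 0))"
    unfolding Rewind_def by (rule exec.Seq[OF 1 exec.Seq[OF 2 3]])
  then show ?thesis by (simp add: eval_nat_numeral)
qed

lemma wf_Move [simp]: "wf_prog K S (Move m) \<longleftrightarrow> (\<forall>i\<ge>K. m i = Stay)"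
  by (auto simp: Move_def)

lemma wf_Emit:
  assumes "W \<subseteq> {..<K}" "\<And>\<rho>. (\<forall>j. \<rho> j < S) \<Longrightarrow> g \<rho> < S"
  shows "wf_prog K S (Emit W g)"
  using assms by (auto simp: Emit_def)

lemma wf_Skip [simp]: "wf_prog K S Skip"
  by (simp add: Skip_def)

lemma wf_Seqs [simp]: "wf_prog K S (Seqs ps) \<longleftrightarrow> (\<forall>p\<in>set ps. wf_prog K S p)"
  by (induction ps) auto

lemma opp_eq_Stay [simp]: "opp d = Stay \<longleftrightarrow> d = Stay"
  by (cases d) (auto simp: opp_def)

lemma wf_For [simp]: "wf_prog K S (For r m p) \<longleftrightarrow> wf_prog K S p \<and> (\<forall>i\<ge>K. m i = Stay)"
  by (auto simp: For_def)

lemma wf_Rewind [simp]: "W \<subseteq> {..<K} \<Longrightarrow> wf_prog K S (Rewind r W)"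
  by (auto simp: Rewind_def only_def)

declare split_paired_Ex [simp del] split_paired_All [simp del]

section \<open>Accepting computations as satisfying assignments\<close>

text \<open>
  \<open>Rule a\<close>: rule \<open>a\<close> is applied at time \<open>t\<close> (only position 0 is used); \<open>Head k\<close>: at time \<open>t\<close> the head
  of tape \<open>k\<close> is at position \<open>p\<close>; \<open>Cell k y\<close>: at time \<open>t\<close> cell \<open>p\<close> of tape \<open>k\<close> holds \<open>y\<close>.
  The variables \<open>Unused i\<close> occur in no clause; they make the matrix of literals and clauses square.
\<close>

type_synonym rule = "nat \<times> nat list \<times> nat \<times> action list"

datatype var = Rule rule | Head nat | Cell nat nat | Unused nat

text \<open>\<open>Move_To\<close> makes the head appear where a rule sends it,
  \<open>Move_From\<close> keeps it from appearing elsewhere. \<open>Read\<close>,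
  \<open>Next_State\<close> and \<open>Init_State\<close> exclude rules that do not fit;
  \<open>Write\<close>, \<open>Keep\<close> and \<open>Init_Cell\<close> assert cell contents. No
  clause forbids several rules at one time or several symbols in one cell: soundness does not depend
  on it.\<close>

datatype clause = Some_Rule | Next_State rule rule | Move_To rule nat | Move_From rule nat | Write rule nat | Keep nat nat
  | Init_State rule | Init_Head nat | Init_Cell nat | Read rule nat nat

fun rule_state where "rule_state (q, ss, q', as) = q"
fun rule_reads where "rule_reads (q, ss, q', as) = ss"
fun rule_next where "rule_next (q, ss, q', as) = q'"
fun rule_write where "rule_write (q, ss, q', as) k = fst (as ! k)"
fun rule_move where "rule_move (q, ss, q', as) k = snd (as ! k)"
fun rule_app :: "rule \<Rightarrow> config \<Rightarrow> config" where
  "rule_app (q, ss, q', as) c = (q', map2 act as (snd c))"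

text \<open>
  What a clause at time \<open>t\<close> and position \<open>p\<close> may depend on when it is asked whether it contains a
  literal at time \<open>t'\<close> and position \<open>p'\<close>.
\<close>

record flags =
  t_zero :: bool
  t_eq :: bool
  t_pred :: bool
  p_zero :: bool
  p_eq :: bool
  p_succ :: bool
  p_pred :: bool
  p_origin :: bool
  p_symbol :: nat

definition p_dir :: "flags \<Rightarrow> direction \<Rightarrow> bool" where
  "p_dir fl d = (case d of Go_Left \<Rightarrow> p_pred fl | Stay \<Rightarrow> p_eq fl | Go_Right \<Rightarrow> p_succ fl)"

text \<open>
  Clauses about consecutive times relate \<open>t - 1\<close> to \<open>t\<close>. For \<open>t = 0\<close> they are replaced by clause
  \<open>Some_Rule\<close>, and so are the clauses about the initial configuration for \<open>t > 0\<close>.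
\<close>

definition mem_Some_Rule :: "flags \<Rightarrow> var \<Rightarrow> bool \<Rightarrow> bool" where
  "mem_Some_Rule fl v s \<longleftrightarrow> (\<exists>a. v = Rule a) \<and> s \<and> t_eq fl \<and> p_zero fl"

text \<open>Every kind of clause exists for all times and positions, so a kind that is meaningless
  at some time needs a stand-in there. \<open>Some_Rule\<close> serves because it is required at
  every time anyway. \<open>s\<close> is the sign of the literal of variable
  \<open>v\<close>.\<close>

fun mem :: "flags \<Rightarrow> clause \<Rightarrow> var \<Rightarrow> bool \<Rightarrow> bool" where
  "mem fl Some_Rule v s = mem_Some_Rule fl v s"
| "mem fl (Read a k y) v s =
     (v = Rule a \<and> \<not> s \<and> t_eq fl \<and> p_zero fl \<or> (v = Head k \<or> v = Cell k y) \<and> \<not> s \<and> t_eq fl \<and> p_eq fl)"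
| "mem fl (Next_State a b) v s = (if t_zero fl then mem_Some_Rule fl v s else
     v = Rule a \<and> \<not> s \<and> t_pred fl \<and> p_zero fl \<or> v = Rule b \<and> \<not> s \<and> t_eq fl \<and> p_zero fl)"
| "mem fl (Move_To a k) v s = (if t_zero fl then mem_Some_Rule fl v s else
     v = Rule a \<and> \<not> s \<and> t_pred fl \<and> p_zero fl \<or> v = Head k \<and> \<not> s \<and> t_pred fl \<and> p_eq fl \<or>
     v = Head k \<and> s \<and> t_eq fl \<and> p_dir fl (rule_move a k))"
| "mem fl (Move_From a k) v s = (if t_zero fl then mem_Some_Rule fl v s else
     v = Rule a \<and> \<not> s \<and> t_pred fl \<and> p_zero fl \<or> v = Head k \<and> \<not> s \<and> t_eq fl \<and> p_eq fl \<or>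
     v = Head k \<and> s \<and> t_pred fl \<and> p_dir fl (opp (rule_move a k)))"
| "mem fl (Write a k) v s = (if t_zero fl then mem_Some_Rule fl v s else
     v = Rule a \<and> \<not> s \<and> t_pred fl \<and> p_zero fl \<or> v = Head k \<and> \<not> s \<and> t_pred fl \<and> p_eq fl \<or>
     v = Cell k (rule_write a k) \<and> s \<and> t_eq fl \<and> p_eq fl)"
| "mem fl (Keep k y) v s = (if t_zero fl then mem_Some_Rule fl v s else
     v = Head k \<and> s \<and> t_pred fl \<and> p_eq fl \<or> v = Cell k y \<and> \<not> s \<and> t_pred fl \<and> p_eq fl \<or>
     v = Cell k y \<and> s \<and> t_eq fl \<and> p_eq fl)"
| "mem fl (Init_State b) v s = (if t_zero fl then v = Rule b \<and> \<not> s \<and> t_eq fl \<and> p_zero fl else mem_Some_Rule fl v s)"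
| "mem fl (Init_Head k) v s = (if t_zero fl then v = Head k \<and> s = p_origin fl \<and> t_eq fl \<and> p_eq fl else mem_Some_Rule fl v s)"
| "mem fl (Init_Cell k) v s = (if t_zero fl then
     v = Cell k (if k = 0 then p_symbol fl else 0) \<and> s \<and> t_eq fl \<and> p_eq fl else mem_Some_Rule fl v s)"

text \<open>\<open>t'\<close> and \<open>p'\<close> belong to the literal, \<open>t\<close> and
  \<open>p\<close> to the clause. Positions are natural numbers, with cell 0 of a tape at position
  \<open>og\<close>.\<close>

definition flags_of :: "nat \<Rightarrow> (nat \<Rightarrow> nat) \<Rightarrow> nat \<Rightarrow> nat \<Rightarrow> nat \<Rightarrow> nat \<Rightarrow> flags" where
  "flags_of og sb t' p' t p = \<lparr>t_zero = (t = 0), t_eq = (t' = t), t_pred = (t' + 1 = t),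
     p_zero = (p' = 0), p_eq = (p' = p), p_succ = (p' = p + 1), p_pred = (p' + 1 = p),
     p_origin = (p = og), p_symbol = sb p\<rparr>"

text \<open>
  Besides the rules proper there are idle rules, applicable to accepting halting configurations
  only; so acceptance means that a rule can be applied at each time up to a bound that no proper
  computation reaches.
\<close>

definition rules :: "tm \<Rightarrow> rule set" where
  "rules M = {(q, ss, q', as). q < num_states M \<and> length ss = num_tapes M \<and>
     set ss \<subseteq> {..<num_symbols M} \<and>
     ((q', as) \<in> trans M q ss \<or>
      trans M q ss = {} \<and> q \<in> accept_states M \<and> q' = q \<and> as = map (\<lambda>s. (s, Stay)) ss)}"

definition vars :: "tm \<Rightarrow> var set" where
  "vars M = Rule ` rules M \<union> Head ` {..<num_tapes M} \<union>
     (\<lambda>(k, y). Cell k y) ` ({..<num_tapes M} \<times> {..<num_symbols M})"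

definition clauses :: "tm \<Rightarrow> clause set" where
  "clauses M = {Some_Rule} \<union>
     {Read a k y | a k y. a \<in> rules M \<and> k < num_tapes M \<and> y < num_symbols M \<and> y \<noteq> rule_reads a ! k} \<union>
     {Next_State a b | a b. a \<in> rules M \<and> b \<in> rules M \<and> rule_state b \<noteq> rule_next a} \<union>
     {Move_To a k | a k. a \<in> rules M \<and> k < num_tapes M} \<union>
     {Move_From a k | a k. a \<in> rules M \<and> k < num_tapes M} \<union>
     {Write a k | a k. a \<in> rules M \<and> k < num_tapes M} \<union>
     {Keep k y | k y. k < num_tapes M \<and> y < num_symbols M} \<union>
     {Init_State b | b. b \<in> rules M \<and> rule_state b \<noteq> start_state M} \<union>
     {Init_Head k | k. k < num_tapes M} \<union> {Init_Cell k | k. k < num_tapes M}"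

lemma in_clauses:
  "Some_Rule \<in> clauses M"
  "Read a k y \<in> clauses M \<longleftrightarrow> a \<in> rules M \<and> k < num_tapes M \<and> y < num_symbols M \<and> y \<noteq> rule_reads a ! k"
  "Next_State a b \<in> clauses M \<longleftrightarrow> a \<in> rules M \<and> b \<in> rules M \<and> rule_state b \<noteq> rule_next a"
  "Move_To a k \<in> clauses M \<longleftrightarrow> a \<in> rules M \<and> k < num_tapes M"
  "Move_From a k \<in> clauses M \<longleftrightarrow> a \<in> rules M \<and> k < num_tapes M"
  "Write a k \<in> clauses M \<longleftrightarrow> a \<in> rules M \<and> k < num_tapes M"
  "Keep k y \<in> clauses M \<longleftrightarrow> k < num_tapes M \<and> y < num_symbols M"
  "Init_State b \<in> clauses M \<longleftrightarrow> b \<in> rules M \<and> rule_state b \<noteq> start_state M"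
  "Init_Head k \<in> clauses M \<longleftrightarrow> k < num_tapes M"
  "Init_Cell k \<in> clauses M \<longleftrightarrow> k < num_tapes M"
  by (simp_all add: clauses_def del: split_paired_Ex)

lemma finite_direction: "finite (UNIV :: direction set)"
proof -
  have "UNIV = {Go_Left, Stay, Go_Right}" using direction.exhaust by auto
  then show ?thesis by (metis finite.emptyI finite.insertI)
qed

lemma rules_wf:
  assumes "wf_tm M" "(q, ss, q', as) \<in> rules M"
  shows "q < num_states M" "length ss = num_tapes M" "set ss \<subseteq> {..<num_symbols M}"
    "q' < num_states M" "length as = num_tapes M" "fst ` set as \<subseteq> {..<num_symbols M}"
proof -
  show 1: "q < num_states M" "length ss = num_tapes M" "set ss \<subseteq> {..<num_symbols M}"
    using assms(2) by (auto simp: rules_def)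
  consider "(q', as) \<in> trans M q ss" | "q' = q" "as = map (\<lambda>s. (s, Stay)) ss"
    using assms(2) by (auto simp: rules_def)
  then have "q' < num_states M \<and> length as = num_tapes M \<and> fst ` set as \<subseteq> {..<num_symbols M}"
  proof cases
    case 1
    have "\<forall>q<num_states M. \<forall>ss. length ss = num_tapes M \<and> set ss \<subseteq> {..<num_symbols M} \<longrightarrow>
        (\<forall>(q', as) \<in> trans M q ss.
           q' < num_states M \<and> length as = num_tapes M \<and> fst ` set as \<subseteq> {..<num_symbols M})"
      using assms(1) unfolding wf_tm_def by simp
    from this[rule_format, OF \<open>q < _\<close>] 1 \<open>length ss = _\<close> \<open>set ss \<subseteq> _\<close> show ?thesis by fast
  next
    case 2
    then show ?thesis using \<open>q < _\<close> \<open>length ss = _\<close> \<open>set ss \<subseteq> _\<close> by (auto simp: image_image)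
  qed
  then show "q' < num_states M" "length as = num_tapes M" "fst ` set as \<subseteq> {..<num_symbols M}"
    by simp_all
qed

lemma finite_rules:
  assumes "wf_tm M"
  shows "finite (rules M)"
proof -
  let ?as = "{as :: action list. set as \<subseteq> {..<num_symbols M} \<times> UNIV \<and> length as = num_tapes M}"
  let ?ss = "{ss. set ss \<subseteq> {..<num_symbols M} \<and> length ss = num_tapes M}"
  have "rules M \<subseteq> {..<num_states M} \<times> ?ss \<times> {..<num_states M} \<times> ?as"
  proof
    fix a assume "a \<in> rules M"
    moreover obtain q ss q' as where "a = (q, ss, q', as)" by (cases a)
    ultimately show "a \<in> {..<num_states M} \<times> ?ss \<times> {..<num_states M} \<times> ?as"
      using rules_wf[OF assms, of q ss q' as] by force
  qed
  moreover have "finite \<dots>"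
    by (intro finite_SigmaI finite_lists_length_eq finite_cartesian_product)
      (auto simp: finite_direction)
  ultimately show ?thesis by (rule finite_subset)
qed

lemma finite_vars: "wf_tm M \<Longrightarrow> finite (vars M)"
  by (auto simp: vars_def finite_rules)

lemma finite_clauses:
  assumes "wf_tm M"
  shows "finite (clauses M)"
proof -
  let ?R = "rules M" and ?K = "{..<num_tapes M}" and ?S = "{..<num_symbols M}"
  have 1: "finite {f a k | a k. a \<in> A \<and> k \<in> B}" if "finite A" "finite B"
    for f :: "'a \<Rightarrow> 'b \<Rightarrow> clause" and A B
    using finite_image_set2[of "\<lambda>a. a \<in> A" "\<lambda>k. k \<in> B" f] that by simp
  have 2: "finite {f a k y | a k y. a \<in> A \<and> k \<in> B \<and> y \<in> C}" if "finite A" "finite B" "finite C"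
    for f :: "'a \<Rightarrow> 'b \<Rightarrow> 'c \<Rightarrow> clause" and A B C
  proof -
    have "{f a k y | a k y. a \<in> A \<and> k \<in> B \<and> y \<in> C} \<subseteq> (\<lambda>(a, k, y). f a k y) ` (A \<times> B \<times> C)"
      by force
    then show ?thesis using that by (meson finite_SigmaI finite_imageI finite_subset)
  qed
  have R: "finite ?R" using finite_rules[OF assms] .
  have "finite {Read a k y | a k y. a \<in> ?R \<and> k < num_tapes M \<and> y < num_symbols M \<and> y \<noteq> rule_reads a ! k}"
    by (rule finite_subset[OF _ 2[OF R, of ?K ?S Read]]) auto
  moreover have "finite {Next_State a b | a b. a \<in> ?R \<and> b \<in> ?R \<and> rule_state b \<noteq> rule_next a}"
    by (rule finite_subset[OF _ 1[OF R R, of Next_State]]) auto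
  moreover have "finite {Init_State b | b. b \<in> ?R \<and> rule_state b \<noteq> start_state M}"
    by (rule finite_subset[OF _ finite_imageI[OF R, of Init_State]]) auto
  moreover have "finite {f a k | a k. a \<in> ?R \<and> k < num_tapes M}" for f :: "rule \<Rightarrow> nat \<Rightarrow> clause"
    using 1[OF R, of ?K f] by simp
  moreover have "finite {Keep k y | k y. k < num_tapes M \<and> y < num_symbols M}"
    using 1[of ?K ?S Keep] by simp
  moreover have "finite {f k | k. k < num_tapes M}" for f :: "nat \<Rightarrow> clause"
    using finite_imageI[of ?K f] by (simp add: setcompr_eq_image lessThan_def)
  ultimately show ?thesis unfolding clauses_def by simp
qed

section \<open>Configurations and applicable rules\<close>

abbreviation head :: "config \<Rightarrow> nat \<Rightarrow> int" where
  "head c k \<equiv> snd (snd c ! k)"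

abbreviation cell_at :: "config \<Rightarrow> nat \<Rightarrow> int \<Rightarrow> nat" where
  "cell_at c k \<equiv> fst (snd c ! k)"

definition wf_config :: "tm \<Rightarrow> config \<Rightarrow> bool" where
  "wf_config M c \<longleftrightarrow> fst c < num_states M \<and> length (snd c) = num_tapes M \<and>
     (\<forall>k<num_tapes M. \<forall>z. cell_at c k z < num_symbols M)"

definition applicable :: "tm \<Rightarrow> rule \<Rightarrow> config \<Rightarrow> bool" where
  "applicable M a c \<longleftrightarrow> a \<in> rules M \<and> rule_state a = fst c \<and> rule_reads a = map read (snd c)"

lemma read_split: "read tp = fst tp (snd tp)"
  by (cases tp) simp

lemma act_split: "act a tp = ((fst tp)(snd tp := fst a), snd tp + dirv (snd a))"
  by (cases a; cases tp) (simp add: shift_dirv)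

lemma rule_app_tapes:
  assumes "wf_tm M" "wf_config M c" "a \<in> rules M" "k < num_tapes M"
  shows "head (rule_app a c) k = head c k + dirv (rule_move a k)"
    "cell_at (rule_app a c) k = (cell_at c k)(head c k := rule_write a k)"
proof -
  obtain q ss q' as where a: "a = (q, ss, q', as)" by (cases a)
  then have "length as = num_tapes M" using rules_wf(5)[OF assms(1)] assms(3) by blast
  then show "head (rule_app a c) k = head c k + dirv (rule_move a k)"
    "cell_at (rule_app a c) k = (cell_at c k)(head c k := rule_write a k)"
    using assms a by (auto simp: wf_config_def act_split)
qed

lemma fst_rule_app: "fst (rule_app a c) = rule_next a"
  by (cases a) auto

lemma wf_rule_app:
  assumes "wf_tm M" "wf_config M c" "a \<in> rules M"
  shows "wf_config M (rule_app a c)"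
proof -
  obtain q ss q' as where a: "a = (q, ss, q', as)" by (cases a)
  note wf = rules_wf[OF assms(1) assms(3)[unfolded a]]
  have "rule_write a k < num_symbols M" if "k < num_tapes M" for k
  proof -
    have "as ! k \<in> set as" using that wf by simp
    then show ?thesis using wf a by auto
  qed
  moreover have "fst (rule_app a c) < num_states M" "length (snd (rule_app a c)) = num_tapes M"
    using wf a assms by (auto simp: wf_config_def)
  ultimately show ?thesis
    using assms unfolding wf_config_def by (auto simp: rule_app_tapes[OF assms])
qed

text \<open>An idle rule rewrites the symbols just read and moves no head, so it reproduces the
  configuration.\<close>

lemma applicable_cases:
  assumes "wf_config M c" "applicable M a c"
  shows "step M c (rule_app a c) \<or> halting M c \<and> fst c \<in> accept_states M \<and> rule_app a c = c"
proof -
  obtain q ss q' as where a: "a = (q, ss, q', as)" by (cases a)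
  have "map2 act (map (\<lambda>s. (s, Stay)) (map read ts)) ts = ts" for ts :: "tape list"
    by (induction ts) (auto simp: act_stay)
  then show ?thesis
    using assms a by (cases c) (auto simp: applicable_def rules_def step_def halting_def)
qed

lemma wf_config_reads: "wf_config M c \<Longrightarrow> set (map read (snd c)) \<subseteq> {..<num_symbols M}"
  by (auto simp del: split_paired_All simp: wf_config_def in_set_conv_nth read_split) (metis fst_conv)

lemma step_applicable:
  assumes "wf_config M c" "step M c c'"
  shows "\<exists>a. applicable M a c \<and> rule_app a c = c'"
proof -
  obtain q' as where t: "(q', as) \<in> trans M (fst c) (map read (snd c))"
    and c': "c' = (q', map2 act as (snd c))" using assms(2) unfolding step_def by auto
  have "set (map read (snd c)) \<subseteq> {..<num_symbols M}"
    using assms(1) by (rule wf_config_reads)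
  then have "applicable M (fst c, map read (snd c), q', as) c"
    using assms(1) t by (auto simp: applicable_def rules_def wf_config_def)
  then show ?thesis using c' by (intro exI[of _ "(fst c, map read (snd c), q', as)"]) auto
qed

lemma accepting_applicable:
  assumes "wf_config M c" "halting M c" "fst c \<in> accept_states M"
  shows "\<exists>a. applicable M a c \<and> rule_app a c = c"
proof -
  let ?a = "(fst c, map read (snd c), fst c, map (\<lambda>s. (s, Stay)) (map read (snd c)))"
  have "set (map read (snd c)) \<subseteq> {..<num_symbols M}"
    using assms(1) by (rule wf_config_reads)
  moreover have "trans M (fst c) (map read (snd c)) = {}"
    using assms(2) by (auto simp: halting_def step_def)
  ultimately have "applicable M ?a c"
    using assms(1,3) by (auto simp: applicable_def rules_def wf_config_def)
  moreover have "map2 act (map (\<lambda>s. (s, Stay)) (map read ts)) ts = ts" for ts :: "tape list"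
    by (induction ts) (auto simp: act_stay)
  ultimately show ?thesis by (intro exI[of _ ?a]) (cases c, auto)
qed

lemma init_tapes:
  assumes "wf_tm M" "k < num_tapes M"
  shows "head (init M x) k = 0" "cell_at (init M x) k = contents (if k = 0 then x else [])"
  using assms by (auto simp: init_def nth_Cons split: nat.splits)

lemma wf_init: "wf_tm M \<Longrightarrow> wf_config M (init M x)"
  unfolding wf_config_def by (auto simp: init_tapes)
    (auto simp: init_def wf_tm_def contents_def)

lemma reachable_wf:
  assumes "wf_tm M" "(step M ^^ t) (init M x) c"
  shows "wf_config M c \<and> (\<forall>k<num_tapes M. \<bar>head c k\<bar> \<le> int t)"
  using assms(2)
proof (induction t arbitrary: c)
  case 0
  then show ?case using wf_init init_tapes assms(1) by auto
next
  case (Suc t)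
  then obtain c1 where c1: "(step M ^^ t) (init M x) c1" "step M c1 c" by auto
  then obtain a where a: "applicable M a c1" "rule_app a c1 = c"
    using Suc.IH step_applicable by blast
  then have "a \<in> rules M" by (simp add: applicable_def)
  moreover have "\<bar>head c k\<bar> \<le> int (Suc t)" if "k < num_tapes M" for k
    using Suc.IH[OF c1(1)] rule_app_tapes(1)[OF assms(1) _ \<open>a \<in> rules M\<close> that, of c1] a that
    by (cases "rule_move a k") fastforce+
  ultimately show ?case using Suc.IH[OF c1(1)] wf_rule_app[OF assms(1)] a by blast
qed

text \<open>\<open>P\<close> bounds the length of every computation, and \<open>N\<close> bounds
  times and positions alike. \<open>room\<close> keeps all reachable head positions in range, with a
  spare position on either side, and makes time \<open>P + 1\<close> available.\<close>

locale tableau =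
  fixes M :: tm and x :: "bool list" and P og N :: nat
  assumes wf: "wf_tm M"
    and bound: "\<And>t c. (step M ^^ t) (init M x) c \<Longrightarrow> t \<le> P"
    and room: "P < og" "og + P + 1 < N"
begin

definition symbol :: "nat \<Rightarrow> nat" where
  "symbol p = contents x (int p - int og)"

text \<open>The truth value of the variable is passed as the sign, so \<open>mem\<close> asks
  whether the literal that is true under \<open>\<alpha>\<close> occurs in the clause.\<close>

definition sat :: "(nat \<Rightarrow> nat \<Rightarrow> var \<Rightarrow> bool) \<Rightarrow> clause \<Rightarrow> nat \<Rightarrow> nat \<Rightarrow> bool" where
  "sat \<alpha> c t p \<longleftrightarrow> (\<exists>t'<N. \<exists>p'<N. \<exists>v\<in>vars M. mem (flags_of og symbol t' p' t p) c v (\<alpha> t' p' v))"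

lemma N_pos: "0 < N"
  using room by simp

lemma in_vars [simp]:
  "Rule a \<in> vars M \<longleftrightarrow> a \<in> rules M"
  "Head k \<in> vars M \<longleftrightarrow> k < num_tapes M"
  "Cell k y \<in> vars M \<longleftrightarrow> k < num_tapes M \<and> y < num_symbols M"
  by (auto simp: vars_def)

lemma p_dir_flags_of: "p_dir (flags_of og sb t' p' t p) d \<longleftrightarrow> int p' = int p + dirv d"
  by (cases d) (auto simp: p_dir_def flags_of_def)

lemma sat_iff:
  "sat \<alpha> c t p \<longleftrightarrow> (\<exists>p' t' v. t' < N \<and> p' < N \<and> v \<in> vars M \<and> mem (flags_of og symbol t' p' t p) c v (\<alpha> t' p' v))"
  by (auto simp: sat_def)

lemma sat_Some_Rule:
  assumes "t < N"
  shows "sat \<alpha> Some_Rule t p \<longleftrightarrow> (\<exists>a\<in>rules M. \<alpha> t 0 (Rule a))"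
proof -
  have "mem (flags_of og symbol t 0 t p) Some_Rule (Rule a) s \<longleftrightarrow> s" for a s
    by (simp add: mem_Some_Rule_def flags_of_def del: split_paired_Ex)
  then have "sat \<alpha> Some_Rule t p" if "a \<in> rules M" "\<alpha> t 0 (Rule a)" for a
    unfolding sat_iff using that assms N_pos in_vars(1)[of a] by blast
  moreover have "\<exists>a\<in>rules M. \<alpha> t 0 (Rule a)" if "sat \<alpha> Some_Rule t p"
    using that unfolding sat_iff mem.simps mem_Some_Rule_def flags_of_def by auto
  ultimately show ?thesis by blast
qed

lemma sat_step_zero:
  "sat \<alpha> (Next_State a b) 0 p \<longleftrightarrow> sat \<alpha> Some_Rule 0 p" "sat \<alpha> (Move_To a k) 0 p \<longleftrightarrow> sat \<alpha> Some_Rule 0 p"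
  "sat \<alpha> (Move_From a k) 0 p \<longleftrightarrow> sat \<alpha> Some_Rule 0 p" "sat \<alpha> (Write a k) 0 p \<longleftrightarrow> sat \<alpha> Some_Rule 0 p"
  "sat \<alpha> (Keep k y) 0 p \<longleftrightarrow> sat \<alpha> Some_Rule 0 p"
  by (simp_all add: sat_def flags_of_def)

lemma sat_init_Suc:
  "sat \<alpha> (Init_State b) (Suc t) p \<longleftrightarrow> sat \<alpha> Some_Rule (Suc t) p" "sat \<alpha> (Init_Head k) (Suc t) p \<longleftrightarrow> sat \<alpha> Some_Rule (Suc t) p"
  "sat \<alpha> (Init_Cell k) (Suc t) p \<longleftrightarrow> sat \<alpha> Some_Rule (Suc t) p"
  by (simp_all add: sat_def flags_of_def)

lemma sat_Read:
  assumes "t < N" "p < N" "a \<in> rules M" "k < num_tapes M" "y < num_symbols M"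
  shows "sat \<alpha> (Read a k y) t p \<longleftrightarrow> \<not> \<alpha> t 0 (Rule a) \<or> \<not> \<alpha> t p (Head k) \<or> \<not> \<alpha> t p (Cell k y)"
  using assms N_pos
  by (auto simp: sat_iff flags_of_def conj_disj_distribL conj_disj_distribR ex_disj_distrib)

lemma sat_Next_State:
  assumes "Suc t < N" "a \<in> rules M" "b \<in> rules M"
  shows "sat \<alpha> (Next_State a b) (Suc t) p \<longleftrightarrow> \<not> \<alpha> t 0 (Rule a) \<or> \<not> \<alpha> (Suc t) 0 (Rule b)"
  using assms N_pos
  by (auto simp: sat_iff flags_of_def conj_disj_distribL conj_disj_distribR ex_disj_distrib)

lemma sat_Move_To:
  assumes "Suc t < N" "p < N" "a \<in> rules M" "k < num_tapes M"
  shows "sat \<alpha> (Move_To a k) (Suc t) p \<longleftrightarrow> \<not> \<alpha> t 0 (Rule a) \<or> \<not> \<alpha> t p (Head k) \<or>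
    (\<exists>p'<N. int p' = int p + dirv (rule_move a k) \<and> \<alpha> (Suc t) p' (Head k))"
  unfolding sat_iff mem.simps p_dir_flags_of using assms N_pos
  by (auto simp: flags_of_def conj_disj_distribL conj_disj_distribR ex_disj_distrib)

lemma sat_Move_From:
  assumes "Suc t < N" "p < N" "a \<in> rules M" "k < num_tapes M"
  shows "sat \<alpha> (Move_From a k) (Suc t) p \<longleftrightarrow> \<not> \<alpha> t 0 (Rule a) \<or> \<not> \<alpha> (Suc t) p (Head k) \<or>
    (\<exists>p'<N. int p' = int p - dirv (rule_move a k) \<and> \<alpha> t p' (Head k))"
  unfolding sat_iff mem.simps p_dir_flags_of using assms N_pos Suc_lessD[OF assms(1)]
  by (auto simp: flags_of_def conj_disj_distribL conj_disj_distribR ex_disj_distrib)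

lemma sat_Write:
  assumes "Suc t < N" "p < N" "a \<in> rules M" "k < num_tapes M" "rule_write a k < num_symbols M"
  shows "sat \<alpha> (Write a k) (Suc t) p \<longleftrightarrow> \<not> \<alpha> t 0 (Rule a) \<or> \<not> \<alpha> t p (Head k) \<or>
    \<alpha> (Suc t) p (Cell k (rule_write a k))"
  using assms N_pos
  by (auto simp: sat_iff flags_of_def conj_disj_distribL conj_disj_distribR ex_disj_distrib)

lemma sat_Keep:
  assumes "Suc t < N" "p < N" "k < num_tapes M" "y < num_symbols M"
  shows "sat \<alpha> (Keep k y) (Suc t) p \<longleftrightarrow> \<alpha> t p (Head k) \<or> \<not> \<alpha> t p (Cell k y) \<or> \<alpha> (Suc t) p (Cell k y)"
  using assms N_pos
  by (auto simp: sat_iff flags_of_def conj_disj_distribL conj_disj_distribR ex_disj_distrib)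

lemma sat_Init_State: "b \<in> rules M \<Longrightarrow> sat \<alpha> (Init_State b) 0 p \<longleftrightarrow> \<not> \<alpha> 0 0 (Rule b)"
  using N_pos by (auto simp: sat_iff flags_of_def)

lemma sat_Init_Head: "k < num_tapes M \<Longrightarrow> p < N \<Longrightarrow> sat \<alpha> (Init_Head k) 0 p \<longleftrightarrow> \<alpha> 0 p (Head k) = (p = og)"
  using N_pos by (auto simp: sat_iff flags_of_def)

lemma symbols_3: "3 \<le> num_symbols M"
  using wf unfolding wf_tm_def by blast

lemma symbol_less: "symbol p < num_symbols M"
  using symbols_3 by (simp add: symbol_def contents_def)

lemma sat_Init_Cell:
  "k < num_tapes M \<Longrightarrow> p < N \<Longrightarrow>
    sat \<alpha> (Init_Cell k) 0 p \<longleftrightarrow> \<alpha> 0 p (Cell k (if k = 0 then symbol p else 0))"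
  using N_pos symbol_less[of p] symbols_3 by (auto simp: sat_iff flags_of_def)

lemma rule_write_less:
  assumes "a \<in> rules M" "k < num_tapes M"
  shows "rule_write a k < num_symbols M"
proof -
  obtain q ss q' as where a: "a = (q, ss, q', as)" by (cases a)
  note wf_a = rules_wf[OF wf assms(1)[unfolded a]]
  have "as ! k \<in> set as" using assms(2) wf_a(5) by simp
  then show ?thesis using wf_a(6) a by auto
qed

end

section \<open>Soundness and completeness of the clauses\<close>

context tableau begin

text \<open>Only heads are described exactly. A cell must assert its true content but may assert
  other symbols too, and any number of rules may be asserted as long as their state fits.\<close>

definition represents :: "(nat \<Rightarrow> nat \<Rightarrow> var \<Rightarrow> bool) \<Rightarrow> nat \<Rightarrow> config \<Rightarrow> bool" where
  "represents \<alpha> t c \<longleftrightarrow>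
     (\<forall>k<num_tapes M. \<forall>p<N. \<alpha> t p (Head k) \<longleftrightarrow> int p = head c k + int og) \<and>
     (\<forall>k<num_tapes M. \<forall>p<N. \<alpha> t p (Cell k (cell_at c k (int p - int og)))) \<and>
     (\<forall>b\<in>rules M. \<alpha> t 0 (Rule b) \<longrightarrow> rule_state b = fst c)"

text \<open>The first disjunct absorbs the idle rules: as long as it fails, a rule asserted by
  \<open>\<alpha>\<close> can be followed as a proper step of the machine.\<close>

lemma sound:
  assumes sat: "\<And>c t p. c \<in> clauses M \<Longrightarrow> t < N \<Longrightarrow> p < N \<Longrightarrow> sat \<alpha> c t p"
  shows "t < N \<Longrightarrow> tm_accepts M x \<or> (\<exists>c. (step M ^^ t) (init M x) c \<and> represents \<alpha> t c)"
proof (induction t)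
  case 0
  have "\<alpha> 0 p (Head k) \<longleftrightarrow> p = og" if "k < num_tapes M" "p < N" for k p
    using sat[of "Init_Head k" 0 p] that N_pos by (auto simp: in_clauses sat_Init_Head)
  moreover have "\<alpha> 0 p (Cell k (cell_at (init M x) k (int p - int og)))"
    if k: "k < num_tapes M" and p: "p < N" for k p
  proof -
    have "cell_at (init M x) k (int p - int og) = (if k = 0 then symbol p else 0)"
      unfolding init_tapes(2)[OF wf k] by (simp add: symbol_def contents_def)
    moreover have "sat \<alpha> (Init_Cell k) 0 p" using k p N_pos by (intro sat) (simp_all add: in_clauses)
    ultimately show ?thesis using sat_Init_Cell[OF k p] by simp
  qed
  moreover have "rule_state b = fst (init M x)" if "b \<in> rules M" "\<alpha> 0 0 (Rule b)" for b
    using sat[of "Init_State b" 0 0] that N_pos by (auto simp: in_clauses sat_Init_State init_def)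
  moreover have "int p = head (init M x) k + int og \<longleftrightarrow> p = og" if "k < num_tapes M" for k p
    unfolding init_tapes(1)[OF wf that] by simp
  ultimately have "represents \<alpha> 0 (init M x)"
    unfolding represents_def by blast
  then show ?case by auto
next
  case (Suc t)
  show ?case
  proof (cases "tm_accepts M x")
    case False
    then obtain c where c: "(step M ^^ t) (init M x) c" "represents \<alpha> t c" using Suc by auto
    have wfc: "wf_config M c" using reachable_wf[OF wf c(1)] by blast
    have hd: "\<bar>head c k\<bar> \<le> int P" if "k < num_tapes M" for k
      using reachable_wf[OF wf c(1)] bound[OF c(1)] that by force
    obtain a where a: "a \<in> rules M" "\<alpha> t 0 (Rule a)"
      using sat[of Some_Rule t 0] Suc.prems by (auto simp: in_clauses sat_Some_Rule)
    have pos: "nat (head c k + int og) < N" "int (nat (head c k + int og)) = head c k + int og"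
      if "k < num_tapes M" for k using hd[OF that] room by auto
    have cell: "cell_at c k z < num_symbols M" if "k < num_tapes M" for k z
      using wfc that by (auto simp: wf_config_def)
    \<comment> \<open>If the rule expected another symbol, the \<open>Read\<close> clause for the
      symbol actually under the head would fail.\<close>
    have "rule_reads a ! k = cell_at c k (head c k)" if "k < num_tapes M" for k
    proof (rule ccontr)
      assume "rule_reads a ! k \<noteq> cell_at c k (head c k)"
      then have "sat \<alpha> (Read a k (cell_at c k (head c k))) t (nat (head c k + int og))"
        using Suc.prems a that pos cell by (intro sat) (auto simp: in_clauses)
      moreover have "\<alpha> t (nat (head c k + int og)) (Head k)"
        using c(2) that pos unfolding represents_def by blast
      moreover have "\<alpha> t (nat (head c k + int og)) (Cell k (cell_at c k (int (nat (head c k + int og)) - int og)))"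
        using c(2) that pos unfolding represents_def by blast
      ultimately show False
        using Suc.prems a that pos cell by (simp add: sat_Read)
    qed
    moreover have "length (rule_reads a) = num_tapes M" using rules_wf(2)[OF wf] a by (cases a) auto
    moreover have "rule_state a = fst c" using c(2) a by (auto simp: represents_def)
    ultimately have app: "applicable M a c"
      using a wfc by (auto simp: applicable_def wf_config_def read_split intro!: nth_equalityI)
    have "(step M)\<^sup>*\<^sup>* (init M x) c" using c(1) by (rule relpowp_imp_rtranclp)
    \<comment> \<open>An idle rule is applicable only in an accepting halting configuration, and
      reaching one is excluded in this case.\<close>
    then have "step M c (rule_app a c)"
      using applicable_cases[OF wfc app] False unfolding tm_accepts_def by blast
    then have "(step M ^^ Suc t) (init M x) (rule_app a c)" using c(1) by auto
    moreover have "represents \<alpha> (Suc t) (rule_app a c)"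
      unfolding represents_def fst_rule_app
    proof (intro conjI allI impI ballI)
      fix k p assume k: "k < num_tapes M" and p: "p < N"
      note tape = rule_app_tapes[OF wf wfc a(1) k]
      have H: "\<alpha> t p (Head k) \<longleftrightarrow> int p = head c k + int og" if "p < N" for p
        using c(2) k that by (auto simp: represents_def)
      \<comment> \<open>\<open>Move_To\<close> yields a head position \<open>p'\<close> at the next
        time, and \<open>Move_From\<close> shows that it is the only one.\<close>
      have "sat \<alpha> (Move_To a k) (Suc t) (nat (head c k + int og))"
        using Suc.prems k pos[OF k] a by (intro sat) (auto simp: in_clauses)
      then obtain p' where p': "p' < N" "int p' = head c k + int og + dirv (rule_move a k)" "\<alpha> (Suc t) p' (Head k)"
        using Suc.prems k pos[OF k] a H by (auto simp: sat_Move_To)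
      have "sat \<alpha> (Move_From a k) (Suc t) p"
        using Suc.prems k p a by (intro sat) (auto simp: in_clauses)
      then have "int p = head c k + int og + dirv (rule_move a k)" if "\<alpha> (Suc t) p (Head k)"
        using that Suc.prems k p a H by (auto simp: sat_Move_From)
      moreover have "p = p'" if "int p = head c k + int og + dirv (rule_move a k)"
        using that p'(2) by simp
      ultimately show "\<alpha> (Suc t) p (Head k) \<longleftrightarrow> int p = head (rule_app a c) k + int og"
        unfolding tape(1) using p'(3) by (auto simp: algebra_simps)
      show "\<alpha> (Suc t) p (Cell k (cell_at (rule_app a c) k (int p - int og)))"
      proof (cases "int p = head c k + int og")
        case True
        have "sat \<alpha> (Write a k) (Suc t) p"
          using Suc.prems k p a by (intro sat) (auto simp: in_clauses)
        then show ?thesis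
          using True Suc.prems k p a H[OF p] rule_write_less[OF a(1) k] by (simp add: sat_Write tape)
      next
        case False
        let ?y = "cell_at c k (int p - int og)"
        have "sat \<alpha> (Keep k ?y) (Suc t) p"
          using Suc.prems k p cell[OF k] by (intro sat) (auto simp: in_clauses)
        moreover have "\<alpha> t p (Cell k ?y)" using c(2) k p by (auto simp: represents_def)
        ultimately have "\<alpha> (Suc t) p (Cell k ?y)"
          using False Suc.prems k p H[OF p] cell[OF k] by (simp add: sat_Keep)
        then show ?thesis using False unfolding tape by (auto simp: algebra_simps)
      qed
    next
      fix b assume b: "b \<in> rules M" "\<alpha> (Suc t) 0 (Rule b)"
      show "rule_state b = rule_next a"
        using sat[of "Next_State a b" "Suc t" 0] Suc.prems a b by (auto simp: in_clauses sat_Next_State)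
    qed
    ultimately show ?thesis by blast
  qed simp
qed

lemma complete:
  assumes "tm_accepts M x"
  shows "\<exists>\<alpha>. \<forall>c\<in>clauses M. \<forall>t<N. \<forall>p<N. sat \<alpha> c t p"
proof -
  obtain c m where c: "(step M ^^ m) (init M x) c" "halting M c" "fst c \<in> accept_states M"
    using assms unfolding tm_accepts_def by (meson rtranclp_imp_relpowp)
  obtain f where f: "f 0 = init M x" "f m = c" "\<And>i. i < m \<Longrightarrow> step M (f i) (f (Suc i))"
    using c(1) unfolding relpowp_fun_conv by blast
  \<comment> \<open>The accepting configuration, reached after \<open>m\<close> steps, is repeated
    forever; idle rules justify the repetition.\<close>
  define conf where "conf t = f (min t m)" for t
  have reach: "(step M ^^ min t m) (init M x) (conf t)" for t
    unfolding conf_def relpowp_fun_conv using f by (intro exI[of _ f]) auto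
  have wfc: "wf_config M (conf t)" for t using reachable_wf[OF wf reach] by blast
  have hd: "\<bar>head (conf t) k\<bar> \<le> int P" if "k < num_tapes M" for t k
    using reachable_wf[OF wf reach[of t]] bound[OF reach[of t]] that by force
  have "\<exists>a. applicable M a (conf t) \<and> rule_app a (conf t) = conf (Suc t)" for t
  proof (cases "t < m")
    case True
    then have "step M (conf t) (conf (Suc t))" using f by (simp add: conf_def)
    then show ?thesis using step_applicable wfc by blast
  next
    case False
    then have "conf t = c" "conf (Suc t) = c" using f by (simp_all add: conf_def min_def)
    then show ?thesis using accepting_applicable c wfc[of t] by metis
  qed
  then obtain r where r: "\<And>t. applicable M (r t) (conf t)" "\<And>t. rule_app (r t) (conf t) = conf (Suc t)"
    by metis
  have rR: "r t \<in> rules M" for t using r(1)[of t] by (simp add: applicable_def)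
  define \<alpha> where "\<alpha> t p v = (case v of Rule a \<Rightarrow> a = r t | Head k \<Rightarrow> int p = head (conf t) k + int og
      | Cell k y \<Rightarrow> cell_at (conf t) k (int p - int og) = y | Unused _ \<Rightarrow> False)" for t p v
  have \<alpha>: "\<alpha> t p (Rule a) \<longleftrightarrow> a = r t" "\<alpha> t p (Head k) \<longleftrightarrow> int p = head (conf t) k + int og"
    "\<alpha> t p (Cell k y) \<longleftrightarrow> cell_at (conf t) k (int p - int og) = y" for t p a k y
    by (simp_all add: \<alpha>_def)
  have head_Suc: "head (conf (Suc t)) k = head (conf t) k + dirv (rule_move (r t) k)"
    and cell_Suc: "cell_at (conf (Suc t)) k = (cell_at (conf t) k)(head (conf t) k := rule_write (r t) k)"
    if "k < num_tapes M" for t k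
    using rule_app_tapes[OF wf wfc[of t] rR[of t] that] r(2) by simp_all
  have in_range: "\<exists>p'<N. int p' = head (conf t) k + int og" if "k < num_tapes M" for t k
    using hd[OF that, of t] room by (intro exI[of _ "nat (head (conf t) k + int og)"]) auto
  have sat_A: "sat \<alpha> Some_Rule t p" if "t < N" for t p
    using that rR by (auto simp: sat_Some_Rule \<alpha>)
  have "sat \<alpha> c t p" if "c \<in> clauses M" "t < N" "p < N" for c t p
  proof -
    show ?thesis
    proof (cases c)
      case Some_Rule then show ?thesis using sat_A that by simp
    next
      case (Read a k y)
      note c2 = that(1)[unfolded Read in_clauses] Read
      have "cell_at (conf t) k (head (conf t) k) = rule_reads (r t) ! k"
        using r(1)[of t] wfc[of t] c2 by (auto simp: applicable_def wf_config_def read_split)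
      then show ?thesis using c2 that by (auto simp: sat_Read \<alpha>)
    next
      case (Next_State a b)
      note c3 = that(1)[unfolded Next_State in_clauses] Next_State
      have "rule_state (r (Suc i)) = rule_next (r i)" for i
        using r(1)[of "Suc i"] r(2)[of i] fst_rule_app[of "r i"] by (metis applicable_def)
      then show ?thesis using c3 that sat_A by (cases t) (auto simp: sat_step_zero sat_Next_State \<alpha>)
    next
      case (Move_To a k)
      note c4 = that(1)[unfolded Move_To in_clauses] Move_To
      show ?thesis
      proof (cases t)
        case (Suc i)
        then show ?thesis using c4 that in_range[of k t] head_Suc[of k i] by (auto simp: sat_Move_To \<alpha>)
      qed (use c4 that sat_A in \<open>simp add: sat_step_zero\<close>)
    next
      case (Move_From a k)
      note c5 = that(1)[unfolded Move_From in_clauses] Move_From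
      show ?thesis
      proof (cases t)
        case (Suc i)
        then show ?thesis using c5 that in_range[of k i] head_Suc[of k i] by (auto simp: sat_Move_From \<alpha>)
      qed (use c5 that sat_A in \<open>simp add: sat_step_zero\<close>)
    next
      case (Write a k)
      note c6 = that(1)[unfolded Write in_clauses] Write
      show ?thesis using c6 that sat_A rule_write_less[of a k]
        by (cases t) (auto simp: sat_step_zero sat_Write \<alpha> cell_Suc)
    next
      case (Keep k y)
      note c7 = that(1)[unfolded Keep in_clauses] Keep
      show ?thesis using c7 that sat_A
        by (cases t) (auto simp: sat_step_zero sat_Keep \<alpha> cell_Suc)
    next
      case (Init_State b)
      note c8 = that(1)[unfolded Init_State in_clauses] Init_State
      have "rule_state (r 0) = start_state M"
        using r(1)[of 0] f(1) by (simp add: applicable_def conf_def init_def)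
      then show ?thesis using c8 that sat_A by (cases t) (auto simp: sat_init_Suc sat_Init_State \<alpha>)
    next
      case (Init_Head k)
      note c9 = that(1)[unfolded Init_Head in_clauses] Init_Head
      have "head (conf 0) k = 0" using f(1) init_tapes[OF wf c9(1)] by (simp add: conf_def)
      then show ?thesis using c9 that sat_A by (cases t) (auto simp: sat_init_Suc sat_Init_Head \<alpha>)
    next
      case (Init_Cell k)
      note c10 = that(1)[unfolded Init_Cell in_clauses] Init_Cell
      have "cell_at (conf 0) k = contents (if k = 0 then x else [])"
        using f(1) init_tapes[OF wf c10(1)] by (simp add: conf_def)
      then show ?thesis using c10 that sat_A
        by (cases t) (auto simp: sat_init_Suc sat_Init_Cell \<alpha> symbol_def contents_def)
    qed
  qed
  then show ?thesis by blast
qed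

theorem accepts_iff_sat: "tm_accepts M x \<longleftrightarrow> (\<exists>\<alpha>. \<forall>c\<in>clauses M. \<forall>t<N. \<forall>p<N. sat \<alpha> c t p)"
proof
  assume "\<exists>\<alpha>. \<forall>c\<in>clauses M. \<forall>t<N. \<forall>p<N. sat \<alpha> c t p"
  then obtain \<alpha> where "\<And>c t p. c \<in> clauses M \<Longrightarrow> t < N \<Longrightarrow> p < N \<Longrightarrow> sat \<alpha> c t p" by blast
  \<comment> \<open>No computation has \<open>P + 1\<close> steps, so at that time only the first
    disjunct of \<open>sound\<close> is left.\<close>
  from sound[OF this, of "Suc P"] room show "tm_accepts M x"
    using bound[of "Suc P"] by fastforce
qed (rule complete)

end

section \<open>The incidence matrix of the tableau\<close>

text \<open>Mixed radix with the time most significant and the kind least, so that counting upwards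
  is a nest of three loops. It serves literals and clauses with base \<open>width M\<close>, and
  variables with half of it.\<close>

definition code :: "nat \<Rightarrow> nat \<Rightarrow> nat \<Rightarrow> nat \<Rightarrow> nat \<Rightarrow> nat" where
  "code N B t p l = (t * N + p) * B + l"

lemma code_decode [simp]:
  assumes "p < N" "l < B"
  shows "code N B t p l mod B = l" "code N B t p l div B div N = t" "code N B t p l div B mod N = p"
  using assms by (simp_all add: code_def)

lemma mult_add_less: "i < m \<Longrightarrow> j < n \<Longrightarrow> i * n + j < m * (n :: nat)"
proof -
  assume "i < m" "j < n"
  then have "i * n + j < Suc i * n" by simp
  also have "\<dots> \<le> m * n" using \<open>i < m\<close> by (intro mult_le_mono1) simp
  finally show ?thesis .
qed

lemma code_less: "t < N \<Longrightarrow> p < N \<Longrightarrow> l < B \<Longrightarrow> code N B t p l < N * N * B"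
  unfolding code_def by (intro mult_add_less)

lemma code_cases:
  assumes "r < N * N * B"
  obtains t p l where "t < N" "p < N" "l < B" "r = code N B t p l"
proof (rule that[of "r div B div N" "r div B mod N" "r mod B"])
  have "0 < N" "0 < B" using assms by (auto intro: Nat.gr0I)
  then show "r div B mod N < N" "r mod B < B" by simp_all
  have "r div B < N * N" using assms by (simp add: less_mult_imp_div_less)
  then show "r div B div N < N" by (simp add: less_mult_imp_div_less)
  show "r = code N B (r div B div N) (r div B mod N) (r mod B)" by (simp add: code_def)
qed

lemma concat_map_upt_mult:
  "concat (map f [0..<m * n]) = concat (map (\<lambda>i. concat (map (\<lambda>j. f (i * n + j)) [0..<n])) [0..<m])"
proof (induction m)
  case 0
  show ?case by simp
next
  case (Suc m)
  have "[0..<Suc m * n] = [0..<m * n] @ [m * n..<m * n + n]"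
    using upt_add_eq_append[of 0 "m * n" n] by (simp add: add.commute)
  also have "[m * n..<m * n + n] = map (\<lambda>j. m * n + j) [0..<n]"
    using map_add_upt[of "m * n" n] by (simp add: add.commute)
  finally have e: "[0..<Suc m * n] = [0..<m * n] @ map (\<lambda>j. m * n + j) [0..<n]" .
  have "concat (map f [0..<Suc m * n]) = concat (map f [0..<m * n]) @ concat (map (\<lambda>j. f (m * n + j)) [0..<n])"
    unfolding e by (simp add: comp_def)
  with Suc.IH show ?case by simp
qed

lemma concat_map_code:
  "concat (map f [0..<N * N * B]) =
     concat (map (\<lambda>t. concat (map (\<lambda>p. concat (map (\<lambda>l. f (code N B t p l)) [0..<B])) [0..<N])) [0..<N])"
  by (subst concat_map_upt_mult, subst concat_map_upt_mult) (simp only: code_def)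

text \<open>An arbitrary enumeration suffices: it depends on \<open>M\<close> only and is built into
  the program.\<close>

definition var_list :: "tm \<Rightarrow> var list" where
  "var_list M = (SOME l. set l = vars M \<and> distinct l)"

definition clause_list :: "tm \<Rightarrow> clause list" where
  "clause_list M = (SOME l. set l = clauses M \<and> distinct l)"

definition padded_vars :: "tm \<Rightarrow> var list" where
  "padded_vars M = var_list M @ map Unused [0..<length (clause_list M)]"

text \<open>With \<open>v\<close> variables and \<open>c\<close> clauses before padding there are
  \<open>2 * (v + c)\<close> literals and \<open>c + (2 * v + c)\<close> clauses afterwards. The
  padding repeats a clause that is present already.\<close>

definition padded_clauses :: "tm \<Rightarrow> clause list" where
  "padded_clauses M = clause_list M @ replicate (2 * length (var_list M) + length (clause_list M)) Some_Rule"

definition width :: "tm \<Rightarrow> nat" where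
  "width M = 2 * length (padded_vars M)"

lemma var_list: "wf_tm M \<Longrightarrow> set (var_list M) = vars M \<and> distinct (var_list M)"
  unfolding var_list_def by (rule someI_ex, rule finite_distinct_list, rule finite_vars)

lemma clause_list: "wf_tm M \<Longrightarrow> set (clause_list M) = clauses M \<and> distinct (clause_list M)"
  unfolding clause_list_def by (rule someI_ex, rule finite_distinct_list, rule finite_clauses)

lemma length_padded_clauses: "length (padded_clauses M) = width M"
  by (simp add: padded_clauses_def width_def padded_vars_def)

lemma set_padded_clauses:
  assumes "wf_tm M"
  shows "set (padded_clauses M) = clauses M"
  using clause_list[OF assms] in_clauses(1)[of M]
  by (simp add: padded_clauses_def set_replicate_conv_if insert_absorb)

lemma distinct_padded_vars:
  assumes "wf_tm M"
  shows "distinct (padded_vars M)"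
proof -
  have "Unused i \<notin> vars M" for i by (auto simp: vars_def)
  then show ?thesis
    using var_list[OF assms] by (auto simp: padded_vars_def distinct_map inj_on_def)
qed

lemma width_pos:
  assumes "wf_tm M"
  shows "0 < width M"
proof -
  have "Some_Rule \<in> set (clause_list M)" using clause_list[OF assms] in_clauses(1) by simp
  then have "clause_list M \<noteq> []" by force
  then show ?thesis by (simp add: width_def padded_vars_def)
qed

lemma mem_Unused: "\<not> mem fl c (Unused i) s"
  by (cases c) (auto simp: mem_Some_Rule_def)

lemma mem_padded_vars:
  assumes "wf_tm M" "v \<in> set (padded_vars M)" "mem fl c v s"
  shows "v \<in> vars M"
  using assms(2,3) var_list[OF assms(1)] mem_Unused by (auto simp: padded_vars_def)

lemma vars_padded_vars: "wf_tm M \<Longrightarrow> v \<in> vars M \<Longrightarrow> v \<in> set (padded_vars M)"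
  by (simp add: padded_vars_def var_list)

context tableau
begin

definition matrix :: "nat \<Rightarrow> nat \<Rightarrow> bool" where
  "matrix r c = (let B = width M in
     mem (flags_of og symbol (r div B div N) (r div B mod N) (c div B div N) (c div B mod N))
       (padded_clauses M ! (c mod B)) (padded_vars M ! (r mod B div 2)) (even r))"

lemma even_code: "even (code N (width M) t p l) \<longleftrightarrow> even l"
  by (simp add: code_def width_def)

lemma matrix_code:
  assumes "p' < N" "p < N" "l' < width M" "l < width M"
  shows "matrix (code N (width M) t' p' l') (code N (width M) t p l) \<longleftrightarrow>
    mem (flags_of og symbol t' p' t p) (padded_clauses M ! l) (padded_vars M ! (l' div 2)) (even l')"
  using assms by (simp add: matrix_def Let_def even_code)

text \<open>\<open>lit\<close> finds the variable by halving the literal index. The base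
  \<open>width M\<close> is even, so halving acts on the kind alone and leaves time and position
  intact.\<close>

lemma code_div_2: "code N (width M) t p l div 2 = code N (length (padded_vars M)) t p (l div 2)"
proof -
  have "code N (width M) t p l = 2 * ((t * N + p) * length (padded_vars M)) + l"
    by (simp add: code_def width_def algebra_simps)
  then have "code N (width M) t p l div 2 = (2 * ((t * N + p) * length (padded_vars M)) + l) div 2"
    by (simp only:)
  then show ?thesis by (simp add: code_def)
qed

lemma matrix_iff_sat:
  "(\<exists>\<beta>. \<forall>c<N * N * width M. \<exists>r<N * N * width M. matrix r c \<and> lit \<beta> r) \<longleftrightarrow>
   (\<exists>\<alpha>. \<forall>c\<in>clauses M. \<forall>t<N. \<forall>p<N. sat \<alpha> c t p)"
proof
  let ?B = "width M" and ?V = "length (padded_vars M)"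
  assume "\<exists>\<beta>. \<forall>c<N * N * ?B. \<exists>r<N * N * ?B. matrix r c \<and> lit \<beta> r"
  then obtain \<beta> where \<beta>: "\<And>c. c < N * N * ?B \<Longrightarrow> \<exists>r<N * N * ?B. matrix r c \<and> lit \<beta> r" by blast
  \<comment> \<open>The variables are distinct, so \<open>idx\<close> inverts the
    enumeration.\<close>
  define idx where "idx v = (SOME i. i < ?V \<and> padded_vars M ! i = v)" for v
  have idx: "idx (padded_vars M ! i) = i" if "i < ?V" for i
    unfolding idx_def
  proof (rule some_equality)
    fix j assume "j < ?V \<and> padded_vars M ! j = padded_vars M ! i"
    then show "j = i" using nth_eq_iff_index_eq[OF distinct_padded_vars[OF wf]] that by blast
  qed (use that in simp)
  define \<alpha> where "\<alpha> t p v = \<beta> (code N ?V t p (idx v))" for t p v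
  have "sat \<alpha> c t p" if c: "c \<in> clauses M" "t < N" "p < N" for c t p
  proof -
    obtain l where l: "l < ?B" "padded_clauses M ! l = c"
      using c set_padded_clauses[OF wf] length_padded_clauses[of M] by (metis in_set_conv_nth)
    obtain r where r: "r < N * N * ?B" "matrix r (code N ?B t p l)" "lit \<beta> r"
      using \<beta>[OF code_less[OF c(2,3) l(1)]] by blast
    obtain t' p' l' where r': "t' < N" "p' < N" "l' < ?B" "r = code N ?B t' p' l'"
      using code_cases[OF r(1)] by blast
    have l'2: "l' div 2 < ?V" using r' by (simp add: width_def less_mult_imp_div_less)
    have m: "mem (flags_of og symbol t' p' t p) c (padded_vars M ! (l' div 2)) (even l')"
      using r(2) l r' c by (simp add: matrix_code)
    moreover have "padded_vars M ! (l' div 2) \<in> vars M" using mem_padded_vars[OF wf _ m] l'2 by simp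
    moreover have "\<alpha> t' p' (padded_vars M ! (l' div 2)) = even l'"
      using r(3) r' l'2 by (simp add: \<alpha>_def lit_def idx code_div_2 even_code)
    ultimately have "mem (flags_of og symbol t' p' t p) c (padded_vars M ! (l' div 2)) (\<alpha> t' p' (padded_vars M ! (l' div 2)))"
      "padded_vars M ! (l' div 2) \<in> vars M" by simp_all
    then show ?thesis unfolding sat_iff using r'(1,2) by blast
  qed
  then show "\<exists>\<alpha>. \<forall>c\<in>clauses M. \<forall>t<N. \<forall>p<N. sat \<alpha> c t p" by blast
next
  let ?B = "width M" and ?V = "length (padded_vars M)"
  assume "\<exists>\<alpha>. \<forall>c\<in>clauses M. \<forall>t<N. \<forall>p<N. sat \<alpha> c t p"
  then obtain \<alpha> where \<alpha>: "\<And>c t p. c \<in> clauses M \<Longrightarrow> t < N \<Longrightarrow> p < N \<Longrightarrow> sat \<alpha> c t p" by blast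
  define \<beta> where "\<beta> i = \<alpha> (i div ?V div N) (i div ?V mod N) (padded_vars M ! (i mod ?V))" for i
  have "\<exists>r<N * N * ?B. matrix r c \<and> lit \<beta> r" if c: "c < N * N * ?B" for c
  proof -
    obtain t p l where c': "t < N" "p < N" "l < ?B" "c = code N ?B t p l"
      using code_cases[OF c] by blast
    have "padded_clauses M ! l \<in> clauses M" using c'(3) set_padded_clauses[OF wf] nth_mem[of l "padded_clauses M"] by (simp add: length_padded_clauses)
    then obtain t' p' v where v: "t' < N" "p' < N" "v \<in> vars M"
      "mem (flags_of og symbol t' p' t p) (padded_clauses M ! l) v (\<alpha> t' p' v)"
      using \<alpha>[of "padded_clauses M ! l" t p] c' unfolding sat_def by blast
    obtain i where i: "i < ?V" "padded_vars M ! i = v"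
      using vars_padded_vars[OF wf v(3)] by (metis in_set_conv_nth)
    \<comment> \<open>The index of the literal of \<open>v\<close> that is true under
      \<open>\<alpha>\<close>: even for the variable, odd for its negation.\<close>
    let ?l = "if \<alpha> t' p' v then 2 * i else 2 * i + 1"
    have l: "?l < ?B" "?l div 2 = i" "even ?l \<longleftrightarrow> \<alpha> t' p' v" using i by (auto simp: width_def)
    have "matrix (code N ?B t' p' ?l) c" using v c' l i matrix_code[of p' p ?l l t' t] by simp
    moreover have "lit \<beta> (code N ?B t' p' ?l)"
      unfolding lit_def code_div_2 even_code l using v i by (simp add: \<beta>_def)
    ultimately show ?thesis using code_less[OF v(1,2) l(1)] by blast
  qed
  then show "\<exists>\<beta>. \<forall>c<N * N * ?B. \<exists>r<N * N * ?B. matrix r c \<and> lit \<beta> r" by blast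
qed

definition instance_circuit :: circuit where
  "instance_circuit = mat_circuit (N * N * width M) matrix"

definition instance_code :: "bool list" where
  "instance_code = (let n = 2 * (N * N * width M) + 1 in encode instance_circuit (n, n))"

theorem instance_correct:
  assumes "value_convention val"
  shows "instance_code \<in> grid_circuit_sat val \<longleftrightarrow> tm_accepts M x"
proof -
  have "even (N * N * width M)" "0 < N * N * width M"
    using N_pos width_pos[OF wf] by (auto simp: width_def)
  from satisfiable_mat_circuit[OF assms this] show ?thesis
    unfolding instance_code_def instance_circuit_def Let_def accepts_iff_sat matrix_iff_sat[symmetric]
    by (subst encode_in_grid_circuit_sat) (auto intro: grid_mat_circuit)
qed

end

section \<open>Generating the circuit\<close>

definition bit_symbol :: "bool \<Rightarrow> nat" where
  "bit_symbol b = (if b then 2 else 1)"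

lemma contents_word: "contents x = word (map bit_symbol x)"
  by (auto simp: contents_def word_def bit_symbol_def nat_less_iff)

definition bits_of :: "block list \<Rightarrow> nat list" where
  "bits_of bs = map bit_symbol (concat (map block_code bs))"

lemma bits_of_Nil [simp]: "bits_of [] = []"
  by (simp add: bits_of_def)

lemma bits_of_append: "bits_of (bs @ cs) = bits_of bs @ bits_of cs"
  by (simp add: bits_of_def)

lemma bits_of_concat: "bits_of (concat (map F xs)) = concat (map (\<lambda>x. bits_of (F x)) xs)"
  by (induction xs) (auto simp: bits_of_append)

lemma concat_map_replicate: "concat (map (\<lambda>i. replicate a x) [0..<n]) = replicate (n * a) x"
  by (induction n) (auto simp: replicate_add[symmetric] add.commute)

definition EmitBits :: "nat set \<Rightarrow> bool list \<Rightarrow> prog" where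
  "EmitBits W bs = Seqs (map (\<lambda>b. Emit W (\<lambda>_. bit_symbol b)) bs)"

lemma gen_EmitBits: "gen f W (EmitBits W bs) h (map bit_symbol bs) (Suc (length bs))"
proof -
  have "gen f W (Emit W (\<lambda>_. bit_symbol b)) h [bit_symbol b] 1" for b
    using gen_Emit[of f W "\<lambda>_. bit_symbol b" h] by simp
  then show ?thesis
    using gen_Seqs[of bs f W "\<lambda>b. Emit W (\<lambda>_. bit_symbol b)" h "\<lambda>b. [bit_symbol b]" 1] by (simp add: EmitBits_def)
qed

text \<open>The three bits take three steps, each of which recomputes the block; the heads that it
  is read from stay in place meanwhile.\<close>

definition EmitBlock :: "nat set \<Rightarrow> ((nat \<Rightarrow> nat) \<Rightarrow> block) \<Rightarrow> prog" where
  "EmitBlock W g = Seqs (map (\<lambda>i. Emit W (\<lambda>\<rho>. bit_symbol (block_code (g \<rho>) ! i))) [0..<3])"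

lemma gen_EmitBlock: "gen f W (EmitBlock W g) h (bits_of [g (rd f W h)]) 4"
proof -
  let ?c = "block_code (g (rd f W h))"
  have "gen f W (Emit W (\<lambda>\<rho>. bit_symbol (block_code (g \<rho>) ! i))) h [bit_symbol (?c ! i)] 1" for i
    using gen_Emit[of f W "\<lambda>\<rho>. bit_symbol (block_code (g \<rho>) ! i)" h] by simp
  then have "gen f W (EmitBlock W g) h (map (\<lambda>i. bit_symbol (?c ! i)) [0..<3]) (Suc (length [0..<3::nat] * 1))"
    using gen_Seqs[of "[0..<3]" f W "\<lambda>i. Emit W (\<lambda>\<rho>. bit_symbol (block_code (g \<rho>) ! i))" h
        "\<lambda>i. [bit_symbol (?c ! i)]" 1] by (simp only: EmitBlock_def concat_map_singleton)
  moreover have "map (\<lambda>i. bit_symbol (?c ! i)) [0..<3] = map bit_symbol (map ((!) ?c) [0..<length ?c])"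
    by (simp add: comp_def)
  then have "map (\<lambda>i. bit_symbol (?c ! i)) [0..<3] = bits_of [g (rd f W h)]"
    unfolding map_nth by (simp add: bits_of_def)
  ultimately show ?thesis by simp
qed

definition EmitBlocks :: "nat set \<Rightarrow> ((nat \<Rightarrow> nat) \<Rightarrow> block) list \<Rightarrow> prog" where
  "EmitBlocks W gs = Seqs (map (EmitBlock W) gs)"

lemma gen_EmitBlocks:
  "gen f W (EmitBlocks W gs) h (bits_of (map (\<lambda>g. g (rd f W h)) gs)) (Suc (length gs * 4))"
proof -
  have "concat (map (\<lambda>g. bits_of [g (rd f W h)]) gs) = bits_of (map (\<lambda>g. g (rd f W h)) gs)"
    using bits_of_concat[of "\<lambda>g. [g (rd f W h)]" gs] by simp
  then show ?thesis
    using gen_Seqs[of gs f W "EmitBlock W" h "\<lambda>g. bits_of [g (rd f W h)]" 4] gen_EmitBlock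
    by (simp add: EmitBlocks_def)
qed

lemma word_nonzero: "0 \<notin> set w \<Longrightarrow> word w z \<noteq> 0 \<longleftrightarrow> 0 \<le> z \<and> z < int (length w)"
  using nth_mem[of "nat z" w] by (auto simp: word_def nat_less_iff simp del: nth_mem) (metis gr0I)

text \<open>
  Tapes 1 to 4 hold the counters \<open>t'\<close>, \<open>p'\<close>, \<open>t\<close>, \<open>p\<close> as head positions on a common word of length
  \<open>N\<close>. The head of tape 5 is one cell to the left of that of tape 4, and the heads of tapes 6 and 7
  are at \<open>t' - t\<close> and \<open>p' - p\<close>, up to a constant. All comparisons between counters are thus read
  off the symbols under the heads.
\<close>

definition mT' :: "nat \<Rightarrow> direction" where "mT' = only {1, 6} Go_Right"
definition mP' :: "nat \<Rightarrow> direction" where "mP' = only {2, 7} Go_Right"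
definition mT :: "nat \<Rightarrow> direction" where "mT = (only {3} Go_Right)(6 := Go_Left)"
definition mP :: "nat \<Rightarrow> direction" where "mP = (only {4, 5} Go_Right)(7 := Go_Left)"

text \<open>The marks 3, 4 and 5 all stand for positions that are blank on the simulated
  tape.\<close>

definition read_symbol :: "nat \<Rightarrow> nat" where
  "read_symbol a = (if a \<in> {1, 2} then a else 0)"

text \<open>On the word 1, 2, 3 the reading 2 means equal counters, 1 that the counter of the
  literal is one less, 3 that it is one more, and a blank that they are further apart. The mark 5
  stands before the origin because the origin itself may carry an input symbol; hence the lagging
  head of tape 5.\<close>

definition read_flags :: "(nat \<Rightarrow> nat) \<Rightarrow> flags" where
  "read_flags \<rho> = \<lparr>t_zero = (\<rho> 3 = 4), t_eq = (\<rho> 6 = 2), t_pred = (\<rho> 6 = 1), p_zero = (\<rho> 2 = 4),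
     p_eq = (\<rho> 7 = 2), p_succ = (\<rho> 7 = 3), p_pred = (\<rho> 7 = 1),
     p_origin = (\<rho> 5 = 5), p_symbol = read_symbol (\<rho> 4)\<rparr>"

definition ForTP :: "prog \<Rightarrow> prog" where
  "ForTP q = For 3 mT (For 4 mP q)"

definition ForTP' :: "prog \<Rightarrow> prog" where
  "ForTP' q = For 1 mT' (For 2 mP' q)"

text \<open>The kinds of literals and clauses are constants of the program text; only times and
  positions are counted at run time.\<close>

definition emit_pairs where
  "emit_pairs W M F l = Seqs (map (\<lambda>i. EmitBlocks W
     (map (\<lambda>j \<rho>. F (mem (read_flags \<rho>) (padded_clauses M ! i) (padded_vars M ! (l div 2)) (even l)) ! j) [0, 1])) [0..<width M])"

definition emit_row where
  "emit_row W M l =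
     Seq (EmitBlocks W [\<lambda>_. Fixed, \<lambda>_. if even l then Selector else Multiplier_N])
    (Seq (ForTP (emit_pairs W M upper_pair l))
    (Seq (EmitBlocks W [\<lambda>_. Fixed, \<lambda>_. Crossing])
         (ForTP (emit_pairs W M lower_pair l))))"

text \<open>The bits after the three runs of ones complete \<open>2 * m + 2\<close> and twice
  \<open>2 * m + 1\<close> in unary, for \<open>m = N * N * width M\<close>; the target is the last
  cell of the grid.\<close>

definition emit_instance where
  "emit_instance W M = (let ones = ForTP (EmitBits W (replicate (2 * width M) True)) in
     Seq ones (Seq (EmitBits W [True, True, False])
    (Seq ones (Seq (EmitBits W [True, False])
    (Seq ones (Seq (EmitBits W [True, False])
    (Seq (ForTP (EmitBlocks W (replicate (2 * width M) (\<lambda>_. Fixed))))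
    (Seq (EmitBlocks W [\<lambda>_. Fixed, \<lambda>_. Fixed])
    (Seq (ForTP' (Seqs (map (emit_row W M) [0..<width M])))
    (Seq (EmitBlocks W [\<lambda>_. Fixed, \<lambda>_. Selector])
         (ForTP (Seqs (map (\<lambda>_. EmitBlocks W [\<lambda>_. Crossing, \<lambda>_. Conjunction]) [0..<width M])))))))))))))"

definition row_time :: "nat \<Rightarrow> nat \<Rightarrow> nat" where
  "row_time N B = 9 + (for_time N (for_time N (Suc (B * 9))) + (9 + for_time N (for_time N (Suc (B * 9)))))"

definition instance_time :: "nat \<Rightarrow> nat \<Rightarrow> nat" where
  "instance_time N B = (let u = for_time N (for_time N (Suc (2 * B))) in
     u + (4 + (u + (3 + (u + (3 + (for_time N (for_time N (Suc (2 * B * 4))) + (9 +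
     (for_time N (for_time N (Suc (B * row_time N B))) + (9 + for_time N (for_time N (Suc (B * 9)))))))))))))"

text \<open>What the preparatory stages have to establish on the tapes, kept abstract so that
  emission is verified on its own.\<close>

locale generator = tableau +
  fixes f :: "nat \<Rightarrow> int \<Rightarrow> nat" and W :: "nat set" and h :: "nat \<Rightarrow> int" and w :: "nat list"
  assumes f: "\<And>i. i \<in> {1..5} \<Longrightarrow> f i = word w" "f 6 = word [1, 2, 3]" "f 7 = word [1, 2, 3]"
    and W: "\<And>i. i \<le> 7 \<Longrightarrow> i \<notin> W"
    and h: "h 1 = 0" "h 2 = 0" "h 3 = 0" "h 4 = 0" "h 5 = -1" "h 6 = 1" "h 7 = 1"
    and w: "length w = N" "0 \<notin> set w" "\<And>p. p < N \<Longrightarrow> w ! p = 4 \<longleftrightarrow> p = 0"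
      "\<And>p. p < N \<Longrightarrow> w ! p = 5 \<longleftrightarrow> Suc p = og" "\<And>p. p < N \<Longrightarrow> read_symbol (w ! p) = symbol p"
begin

lemma ranges: "i \<in> {1..5} \<Longrightarrow> f i z \<noteq> 0 \<longleftrightarrow> 0 \<le> z \<and> z < int N"
  using f(1) word_nonzero[OF w(2)] w(1) by simp

lemma stays: "\<forall>i\<in>W. mT' i = Stay" "\<forall>i\<in>W. mP' i = Stay" "\<forall>i\<in>W. mT i = Stay" "\<forall>i\<in>W. mP i = Stay"
  using W by (auto simp: mT'_def mP'_def mT_def mP_def only_def)

lemma gen_ForTP:
  assumes H: "H 3 = 0" "H 4 = 0"
    and q: "\<And>t p. t < N \<Longrightarrow> p < N \<Longrightarrow> gen f W q (adv mP (int p) (adv mT (int t) H)) (v t p) \<tau>"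
  shows "gen f W (ForTP q) H (concat (map (\<lambda>t. concat (map (v t) [0..<N])) [0..<N])) (for_time N (for_time N \<tau>))"
  unfolding ForTP_def
proof (rule gen_For)
  fix t assume t: "t < N"
  show "gen f W (For 4 mP q) (adv mT (int t) H) (concat (map (v t) [0..<N])) (for_time N \<tau>)"
  proof (rule gen_For)
    show "adv mT (int t) H 4 = 0" using H by (simp add: adv_def mT_def only_def)
    show "mP 4 = Go_Right" by (simp add: mP_def only_def)
    show "f 4 z \<noteq> 0 \<longleftrightarrow> 0 \<le> z \<and> z < int N" for z by (rule ranges) simp
  qed (use q t stays in auto)
next
  show "mT 3 = Go_Right" by (simp add: mT_def only_def)
  show "f 3 z \<noteq> 0 \<longleftrightarrow> 0 \<le> z \<and> z < int N" for z by (rule ranges) simp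
qed (use H stays in auto)

lemma gen_ForTP':
  assumes q: "\<And>t p. t < N \<Longrightarrow> p < N \<Longrightarrow> gen f W q (adv mP' (int p) (adv mT' (int t) h)) (v t p) \<tau>"
  shows "gen f W (ForTP' q) h (concat (map (\<lambda>t. concat (map (v t) [0..<N])) [0..<N])) (for_time N (for_time N \<tau>))"
  unfolding ForTP'_def
proof (rule gen_For)
  fix t assume t: "t < N"
  show "gen f W (For 2 mP' q) (adv mT' (int t) h) (concat (map (v t) [0..<N])) (for_time N \<tau>)"
  proof (rule gen_For)
    show "adv mT' (int t) h 2 = 0" using h by (simp add: adv_def mT'_def only_def)
    show "mP' 2 = Go_Right" by (simp add: mP'_def only_def)
    show "f 2 z \<noteq> 0 \<longleftrightarrow> 0 \<le> z \<and> z < int N" for z by (rule ranges) simp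
  qed (use q t stays in auto)
next
  show "h 1 = 0" by (rule h)
  show "mT' 1 = Go_Right" by (simp add: mT'_def only_def)
  show "f 1 z \<noteq> 0 \<longleftrightarrow> 0 \<le> z \<and> z < int N" for z by (rule ranges) simp
qed (use stays in auto)

abbreviation "outer t' p' \<equiv> adv mP' (int p') (adv mT' (int t') h)"
abbreviation "inner t' p' t p \<equiv> adv mP (int p) (adv mT (int t) (outer t' p'))"

lemma outer_34: "outer t' p' 3 = 0" "outer t' p' 4 = 0"
  using h by (simp_all add: adv_def mP'_def mT'_def only_def)

lemma word_123:
  "word [1, 2, 3] (1 + z) = 1 \<longleftrightarrow> z = -1" "word [1, 2, 3] (1 + z) = 2 \<longleftrightarrow> z = 0"
  "word [1, 2, 3] (1 + z) = 3 \<longleftrightarrow> z = 1"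
proof -
  consider "z = -1" | "z = 0" | "z = 1" | "z < -1" | "z > 1" by linarith
  then have "word [1, 2, 3] (1 + z) = (if z = -1 then 1 else if z = 0 then 2 else if z = 1 then 3 else 0)"
    by cases (auto simp: word_def)
  then show "word [1, 2, 3] (1 + z) = 1 \<longleftrightarrow> z = -1" "word [1, 2, 3] (1 + z) = 2 \<longleftrightarrow> z = 0"
    "word [1, 2, 3] (1 + z) = 3 \<longleftrightarrow> z = 1" by auto
qed

lemma word_w: "p < N \<Longrightarrow> word w (int p) = w ! p"
  using w(1) by (simp add: word_def)

text \<open>Tapes 6 and 7 are advanced by the primed counters and moved back by the others, so their
  heads stay at 1 plus the differences and the symbols read there decide the comparisons.\<close>

lemma read_inner:
  assumes "t' < N" "p' < N" "t < N" "p < N"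
  shows "read_flags (rd f W (inner t' p' t p)) = flags_of og symbol t' p' t p"
proof -
  let ?r = "rd f W (inner t' p' t p)"
  have pos: "inner t' p' t p 2 = int p'" "inner t' p' t p 3 = int t" "inner t' p' t p 4 = int p"
    "inner t' p' t p 5 = int p - 1" "inner t' p' t p 6 = 1 + (int t' - int t)"
    "inner t' p' t p 7 = 1 + (int p' - int p)"
    using h by (simp_all add: adv_def mP'_def mT'_def mP_def mT_def only_def)
  have r: "?r 2 = w ! p'" "?r 3 = w ! t" "?r 4 = w ! p" "?r 5 = word w (int p - 1)"
    "?r 6 = word [1, 2, 3] (1 + (int t' - int t))" "?r 7 = word [1, 2, 3] (1 + (int p' - int p))"
    unfolding rd_def pos using assms W f by (simp_all add: word_w)
  \<comment> \<open>For \<open>p = 0\<close> the head of tape 5 is left of its word and reads a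
    blank, as it should, since \<open>og\<close> is positive.\<close>
  have "word w (int p - 1) = 5 \<longleftrightarrow> p = og"
  proof (cases p)
    case 0
    then show ?thesis using room by (simp add: word_def)
  next
    case (Suc q)
    then show ?thesis using word_w[of q] w(4)[of q] assms by simp
  qed
  then show ?thesis
    unfolding read_flags_def flags_of_def r word_123 using assms w(3,5) by auto
qed

lemma gen_pairs:
  assumes "t' < N" "p' < N" "t < N" "p < N" "l < width M" and F: "\<And>b. length (F b) = 2"
  shows "gen f W (emit_pairs W M F l) (inner t' p' t p)
    (concat (map (\<lambda>i. bits_of (F (matrix (code N (width M) t' p' l) (code N (width M) t p i)))) [0..<width M]))
    (Suc (width M * 9))"
proof -
  let ?g = "\<lambda>i j \<rho>. F (mem (read_flags \<rho>) (padded_clauses M ! i) (padded_vars M ! (l div 2)) (even l)) ! j"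
  have "gen f W (EmitBlocks W (map (?g i) [0, 1])) (inner t' p' t p)
    (bits_of (F (matrix (code N (width M) t' p' l) (code N (width M) t p i)))) 9" if i: "i \<in> set [0..<width M]" for i
  proof -
    have m: "mem (read_flags (rd f W (inner t' p' t p))) (padded_clauses M ! i) (padded_vars M ! (l div 2)) (even l) =
      matrix (code N (width M) t' p' l) (code N (width M) t p i)"
      using assms i by (simp add: read_inner matrix_code)
    have F2: "[F b ! 0, F b ! 1] = F b" for b
      using F[of b] by (cases "F b"; cases "tl (F b)") auto
    show ?thesis
      using gen_EmitBlocks[of f W "map (?g i) [0, 1]" "inner t' p' t p"] by (simp add: m F2[simplified])
  qed
  from gen_Seqs[of "[0..<width M]", OF this] show ?thesis by (simp add: emit_pairs_def)
qed

abbreviation "cd \<equiv> code N (width M)"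

definition row_bits where
  "row_bits r =
     bits_of [Fixed, if even r then Selector else Multiplier_N] @
       (concat (map (\<lambda>c. bits_of (upper_pair (matrix r c))) [0..<N * N * width M]) @
     (bits_of [Fixed, Crossing] @
       concat (map (\<lambda>c. bits_of (lower_pair (matrix r c))) [0..<N * N * width M])))"

lemma gen_row:
  assumes "t' < N" "p' < N" "l < width M"
  shows "gen f W (emit_row W M l) (outer t' p') (row_bits (cd t' p' l)) (row_time N (width M))"
proof -
  have 1: "gen f W (ForTP (emit_pairs W M F l)) (outer t' p')
      (concat (map (\<lambda>c. bits_of (F (matrix (cd t' p' l) c))) [0..<N * N * width M]))
      (for_time N (for_time N (Suc (width M * 9))))" if "\<And>b. length (F b) = 2" for F
    unfolding concat_map_code using assms that by (intro gen_ForTP outer_34 gen_pairs)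
  have 2: "gen f W (EmitBlocks W [\<lambda>_. Fixed, \<lambda>_. b]) H (bits_of [Fixed, b]) 9" for b H
    using gen_EmitBlocks[of f W "[\<lambda>_. Fixed, \<lambda>_. b]" H] by simp
  have "length (upper_pair b) = 2" "length (lower_pair b) = 2" for b by simp_all
  note F = this
  have e: "even (cd t' p' l) \<longleftrightarrow> even l" by (rule even_code)
  show ?thesis
    unfolding emit_row_def row_time_def row_bits_def e by (intro gen_Seq 1 2 F)
qed

lemma map_bit_symbol_unary: "map bit_symbol (unary n) = replicate n 2 @ [1]"
  by (simp add: unary_def bit_symbol_def)

text \<open>The brackets mirror the nesting of \<open>Seq\<close> in \<open>emit_instance\<close>,
  so that \<open>gen_Seq\<close> applies piece by piece.\<close>

lemma instance_bits:
  "map bit_symbol instance_code = (let ones = replicate (N * N * (2 * width M)) 2 in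
     ones @ ([2, 2, 1] @ (ones @ ([2, 1] @ (ones @ ([2, 1] @
     (bits_of (replicate (N * N * (2 * width M)) Fixed) @ (bits_of [Fixed, Fixed] @
     (concat (map row_bits [0..<N * N * width M]) @ (bits_of [Fixed, Selector] @
     concat (map (\<lambda>c. bits_of [Crossing, Conjunction]) [0..<N * N * width M])))))))))))"
proof -
  let ?m = "N * N * width M"
  have split: "Fixed # b # xs @ Fixed # Crossing # ys = [Fixed, b] @ xs @ [Fixed, Crossing] @ ys" for b xs ys
    by simp
  have r: "bits_of (Fixed # (if even r then Selector else Multiplier_N) #
         concat (map (\<lambda>c. upper_pair (matrix r c)) [0..<?m]) @
       Fixed # Crossing # concat (map (\<lambda>c. lower_pair (matrix r c)) [0..<?m])) = row_bits r" for r
    by (simp only: split row_bits_def bits_of_append bits_of_concat)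
  have rep: "replicate (n + 2) b = replicate n b @ [b, b]" "replicate (n + 1) b = replicate n b @ [b]" for n and b :: 'a
    using replicate_add[of n 2 b] replicate_add[of n 1 b] by (simp_all only: numeral_2_eq_2 replicate.simps One_nat_def)
  have "Fixed # Selector # concat xs = [Fixed, Selector] @ concat xs" for xs by simp
  then have "bits_of (concat instance_circuit) =
    bits_of (replicate (2 * ?m) Fixed) @ bits_of [Fixed, Fixed] @ concat (map row_bits [0..<?m]) @
    bits_of [Fixed, Selector] @ concat (map (\<lambda>c. bits_of [Crossing, Conjunction]) [0..<?m])"
    unfolding instance_circuit_def concat_mat_circuit rep
    by (simp only: bits_of_append bits_of_concat r append.assoc)
  then have "map bit_symbol instance_code = (replicate (2 * ?m) 2 @ [2, 2]) @ [1] @ (replicate (2 * ?m) 2 @ [2]) @ [1] @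
     (replicate (2 * ?m) 2 @ [2]) @ [1] @
     bits_of (replicate (2 * ?m) Fixed) @ bits_of [Fixed, Fixed] @ concat (map row_bits [0..<?m]) @
    bits_of [Fixed, Selector] @ concat (map (\<lambda>c. bits_of [Crossing, Conjunction]) [0..<?m])"
    unfolding instance_code_def Let_def encode.simps map_append map_bit_symbol_unary bits_of_def[symmetric]
    by (simp only: length_mat_circuit instance_circuit_def rep append.assoc)
  moreover have "N * N * (2 * width M) = 2 * ?m" by simp
  ultimately show ?thesis by (simp only: Let_def append.assoc append_Cons append_Nil)
qed

lemma gen_ForTP_const:
  assumes "\<And>H. gen f W q H (replicate a s) \<tau>"
  shows "gen f W (ForTP q) h (replicate (N * N * a) s) (for_time N (for_time N \<tau>))"
proof -
  have "concat (map (\<lambda>t. concat (map (\<lambda>p. replicate a s) [0..<N])) [0..<N]) = replicate (N * N * a) s"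
    unfolding concat_map_replicate by (simp add: mult.assoc)
  then show ?thesis using gen_ForTP[OF h(3,4), of q "\<lambda>_ _. replicate a s"] assms by simp
qed

theorem gen_instance:
  "gen f W (emit_instance W M) h (map bit_symbol instance_code) (instance_time N (width M))"
proof -
  let ?B = "width M"
  have ones: "gen f W (ForTP (EmitBits W (replicate (2 * ?B) True))) h (replicate (N * N * (2 * ?B)) 2)
      (for_time N (for_time N (Suc (2 * ?B))))"
  proof (rule gen_ForTP_const)
    show "gen f W (EmitBits W (replicate (2 * ?B) True)) H (replicate (2 * ?B) 2) (Suc (2 * ?B))" for H
      using gen_EmitBits[of f W "replicate (2 * ?B) True" H] by (simp add: bit_symbol_def)
  qed
  have 1: "gen f W (EmitBits W [True, True, False]) h [2, 2, 1] 4" "gen f W (EmitBits W [True, False]) h [2, 1] 3"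
    using gen_EmitBits[of f W "[True, True, False]" h] gen_EmitBits[of f W "[True, False]" h]
    by (simp_all add: bit_symbol_def numeral_eq_Suc)
  have 2: "gen f W (EmitBlocks W [\<lambda>_. a, \<lambda>_. b]) H (bits_of [a, b]) 9" for a b H
    using gen_EmitBlocks[of f W "[\<lambda>_. a, \<lambda>_. b]" H] by simp
  have fixed: "gen f W (ForTP (EmitBlocks W (replicate (2 * ?B) (\<lambda>_. Fixed)))) h
      (bits_of (replicate (N * N * (2 * ?B)) Fixed)) (for_time N (for_time N (Suc (2 * ?B * 4))))"
  proof -
    have "concat (map (\<lambda>t. concat (map (\<lambda>p. bits_of (replicate a b)) [0..<N])) [0..<N]) =
        bits_of (replicate (N * N * a) b)" for a b
      unfolding bits_of_concat[symmetric] concat_map_replicate by (simp add: mult.assoc)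
    moreover have "gen f W (EmitBlocks W (replicate (2 * ?B) (\<lambda>_. Fixed))) H
        (bits_of (replicate (2 * ?B) Fixed)) (Suc (2 * ?B * 4))" for H
      using gen_EmitBlocks[of f W "replicate (2 * ?B) (\<lambda>_. Fixed)" H] by simp
    ultimately show ?thesis
      using gen_ForTP[OF h(3,4), of "EmitBlocks W (replicate (2 * ?B) (\<lambda>_. Fixed))"
          "\<lambda>_ _. bits_of (replicate (2 * ?B) Fixed)" "Suc (2 * ?B * 4)"] by (simp only:)
  qed
  have rows: "gen f W (ForTP' (Seqs (map (emit_row W M) [0..<?B]))) h
      (concat (map row_bits [0..<N * N * ?B])) (for_time N (for_time N (Suc (?B * row_time N ?B))))"
    unfolding concat_map_code
  proof (intro gen_ForTP')
    fix t' p' assume "t' < N" "p' < N"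
    then show "gen f W (Seqs (map (emit_row W M) [0..<?B])) (outer t' p')
      (concat (map (\<lambda>l. row_bits (cd t' p' l)) [0..<?B])) (Suc (?B * row_time N ?B))"
      using gen_Seqs[of "[0..<?B]" f W "emit_row W M" "outer t' p'" "\<lambda>l. row_bits (cd t' p' l)"]
        gen_row by simp
  qed
  have last: "gen f W (ForTP (Seqs (map (\<lambda>_. EmitBlocks W [\<lambda>_. Crossing, \<lambda>_. Conjunction]) [0..<?B]))) h
      (concat (map (\<lambda>c. bits_of [Crossing, Conjunction]) [0..<N * N * ?B])) (for_time N (for_time N (Suc (?B * 9))))"
    unfolding concat_map_code
  proof (intro gen_ForTP h)
    fix t p
    show "gen f W (Seqs (map (\<lambda>_. EmitBlocks W [\<lambda>_. Crossing, \<lambda>_. Conjunction]) [0..<?B]))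
      (adv mP (int p) (adv mT (int t) h)) (concat (map (\<lambda>l. bits_of [Crossing, Conjunction]) [0..<?B])) (Suc (?B * 9))"
      using gen_Seqs[of "[0..<?B]" f W "\<lambda>_. EmitBlocks W [\<lambda>_. Crossing, \<lambda>_. Conjunction]"
          "adv mP (int p) (adv mT (int t) h)" "\<lambda>_. bits_of [Crossing, Conjunction]" 9] 2 by simp
  qed
  show ?thesis
    unfolding emit_instance_def instance_time_def instance_bits Let_def
    by (intro gen_Seq ones 1 2 fixed rows last)
qed

end

section \<open>Polynomial bounds\<close>

definition poly_bounded :: "(nat \<Rightarrow> nat) \<Rightarrow> bool" where
  "poly_bounded g \<longleftrightarrow> (\<exists>p :: nat poly. \<forall>n. g n \<le> poly p n)"

lemma poly_bounded_const: "poly_bounded (\<lambda>_. c)"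
  unfolding poly_bounded_def by (intro exI[of _ "[:c:]"]) simp

lemma poly_bounded_id: "poly_bounded (\<lambda>n. n)"
  unfolding poly_bounded_def by (intro exI[of _ "[:0, 1:]"]) simp

lemma poly_bounded_add:
  assumes "poly_bounded g" "poly_bounded h"
  shows "poly_bounded (\<lambda>n. g n + h n)"
proof -
  obtain p q where "\<And>n. g n \<le> poly p n" "\<And>n. h n \<le> poly q n"
    using assms unfolding poly_bounded_def by blast
  then have "g n + h n \<le> poly (p + q) n" for n by (simp add: add_mono)
  then show ?thesis unfolding poly_bounded_def by blast
qed

lemma poly_bounded_mult:
  assumes "poly_bounded g" "poly_bounded h"
  shows "poly_bounded (\<lambda>n. g n * h n)"
proof -
  obtain p q where "\<And>n. g n \<le> poly p n" "\<And>n. h n \<le> poly q n"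
    using assms unfolding poly_bounded_def by blast
  then have "g n * h n \<le> poly (p * q) n" for n by (simp add: mult_le_mono)
  then show ?thesis unfolding poly_bounded_def by blast
qed

lemma poly_bounded_Suc: "poly_bounded g \<Longrightarrow> poly_bounded (\<lambda>n. Suc (g n))"
  using poly_bounded_add[OF poly_bounded_const[of 1], of g] by simp

lemma poly_bounded_power: "poly_bounded g \<Longrightarrow> poly_bounded (\<lambda>n. g n ^ k)"
  by (induction k) (auto intro: poly_bounded_const poly_bounded_mult)

lemma poly_bounded_for_time:
  "poly_bounded g \<Longrightarrow> poly_bounded h \<Longrightarrow> poly_bounded (\<lambda>n. for_time (g n) (h n))"
  unfolding for_time_def
  by (intro poly_bounded_add poly_bounded_mult poly_bounded_const)

lemmas poly_bounded_intros = poly_bounded_const poly_bounded_id poly_bounded_add poly_bounded_mult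
  poly_bounded_Suc poly_bounded_power poly_bounded_for_time

text \<open>As the base is at least 2, a coefficient \<open>a\<close> is absorbed by raising the
  exponent by \<open>a\<close>. The summand 2 is the margin needed for \<open>room\<close>, and
  \<open>k > 0\<close> guarantees a base tape for \<open>Rewind\<close>.\<close>

lemma poly_le_power: "\<exists>k>0. \<forall>n. poly (p :: nat poly) n + 2 \<le> (n + 2) ^ k"
proof -
  have "\<exists>k. \<forall>n. poly p n \<le> (n + 2) ^ k"
  proof (induction p)
    case 0
    show ?case by simp
  next
    case (pCons a p)
    then obtain k where k: "\<And>n. poly p n \<le> (n + 2) ^ k" by blast
    have "poly (pCons a p) n \<le> (n + 2) ^ (a + k + 2)" for n
    proof -
      have "a \<le> 2 ^ a" by (simp add: less_imp_le)
      also have "\<dots> \<le> (n + 2) ^ a" by (intro power_mono) auto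
      also have "\<dots> \<le> (n + 2) ^ (a + k + 1)" by (intro power_increasing) auto
      finally have "a \<le> (n + 2) ^ (a + k + 1)" .
      moreover have "n * poly p n \<le> (n + 2) * (n + 2) ^ k" by (intro mult_le_mono k) simp
      moreover have "(n + 2) * (n + 2) ^ k = (n + 2) ^ (k + 1)" by simp
      moreover have "(n + 2) ^ (k + 1) \<le> (n + 2) ^ (a + k + 1)" by (intro power_increasing) auto
      ultimately have "poly (pCons a p) n \<le> 2 * (n + 2) ^ (a + k + 1)" by simp
      also have "\<dots> \<le> (n + 2) * (n + 2) ^ (a + k + 1)" by (intro mult_le_mono1) simp
      finally show ?thesis by simp
    qed
    then show ?case by blast
  qed
  then obtain k where k: "\<And>n. poly p n \<le> (n + 2) ^ k" by blast
  have "poly p n + 2 \<le> (n + 2) ^ (k + 2)" for n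
  proof -
    have "1 \<le> (n + 2) ^ k" by simp
    then have "(n + 2) ^ k + 2 \<le> 2 * 2 * (n + 2) ^ k" by linarith
    also have "\<dots> \<le> (n + 2) * (n + 2) * (n + 2) ^ k" by (intro mult_le_mono) auto
    finally show ?thesis using k[of n] by (simp add: algebra_simps)
  qed
  then show ?thesis by (intro exI[of _ "k + 2"]) simp
qed

section \<open>The reduction\<close>

text \<open>
  With \<open>n + 2\<close> marks on each of the tapes from 8 on, \<open>k\<close> nested loops write \<open>(n + 2) ^ k\<close> symbols,
  which exceeds the running time of the machine to be simulated.
\<close>

primrec nest :: "nat \<Rightarrow> prog \<Rightarrow> prog" where
  "nest 0 q = q"
| "nest (Suc k) q = For (8 + k) (only {8 + k} Go_Right) (nest k q)"

primrec nest_time :: "nat \<Rightarrow> nat \<Rightarrow> nat" where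
  "nest_time n 0 = 1"
| "nest_time n (Suc k) = for_time n (nest_time n k)"

lemma gen_nest:
  assumes "\<And>H. gen f W q H [s] 1" "\<And>j. j < k \<Longrightarrow> f (8 + j) = word (replicate n 3)"
    "\<And>i. i \<in> W \<Longrightarrow> i < 8" "\<And>j. j < k \<Longrightarrow> H (8 + j) = 0"
  shows "gen f W (nest k q) H (replicate (n ^ k) s) (nest_time n k)"
  using assms(2,4)
proof (induction k arbitrary: H)
  case 0
  then show ?case using assms(1) by simp
next
  case (Suc k)
  let ?m = "only {8 + k} Go_Right"
  have "gen f W (For (8 + k) ?m (nest k q)) H (concat (map (\<lambda>i. replicate (n ^ k) s) [0..<n]))
    (for_time n (nest_time n k))"
  proof (rule gen_For)
    fix i assume "i < n"
    show "gen f W (nest k q) (adv ?m (int i) H) (replicate (n ^ k) s) (nest_time n k)"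
      using Suc.prems by (intro Suc.IH) (simp_all add: adv_def only_def)
  next
    show "H (8 + k) = 0" "?m (8 + k) = Go_Right" "\<forall>i\<in>W. ?m i = Stay"
      using Suc.prems assms(3) by (auto simp: only_def)
    show "f (8 + k) z \<noteq> 0 \<longleftrightarrow> 0 \<le> z \<and> z < int n" for z
      using Suc.prems(1)[of k] word_nonzero[of "replicate n 3" z] by simp
  qed
  then show ?case by (simp add: concat_map_replicate)
qed

abbreviation "step0 \<equiv> only {0} Go_Right"

definition base_tapes :: "nat \<Rightarrow> nat set" where
  "base_tapes k = {8..<8 + k}"

definition stage_base where
  "stage_base k = Seq (For 0 step0 (Emit (base_tapes k) (\<lambda>_. 3)))
     (Seq (Emit (base_tapes k) (\<lambda>_. 3)) (Emit (base_tapes k) (\<lambda>_. 3)))"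

definition stage_marks where
  "stage_marks = Seq (Emit {6, 7} (\<lambda>_. 1)) (Seq (Emit {6, 7} (\<lambda>_. 2)) (Emit {6, 7} (\<lambda>_. 3)))"

definition stage_range where
  "stage_range k = (let W = {1..5} in
     Seq (Emit W (\<lambda>_. 4)) (Seq (nest k (Emit W (\<lambda>_. 3))) (Seq (Emit W (\<lambda>_. 5))
       (Seq (For 0 step0 (Emit W (\<lambda>\<rho>. \<rho> 0))) (nest k (Emit W (\<lambda>_. 3)))))))"

text \<open>After writing 1, 2, 3 the heads of tapes 6 and 7 are at position 3; two moves put them
  on the symbol 2, which means equality. The move of tape 5 creates its lag. The output tape
  \<open>8 + k\<close> is the last of \<open>9 + k\<close> tapes.\<close>

definition reduction where
  "reduction k M =
     Seq (stage_base k) (Seq (Rewind 8 (base_tapes k))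
    (Seq stage_marks (Seq (Move (only {6, 7} Go_Left)) (Seq (Move (only {6, 7} Go_Left))
    (Seq (stage_range k) (Seq (Rewind 1 {1..5}) (Seq (Move (only {5} Go_Left))
       (emit_instance {8 + k} M))))))))"

text \<open>The number of blanks kept on either side of the input, chosen to exceed the running
  time.\<close>

definition half :: "nat \<Rightarrow> nat \<Rightarrow> nat" where
  "half k n = (n + 2) ^ k"

text \<open>
  Common contents of tapes 1 to 5: 4 marks position 0, 5 the position before the origin, and 3
  stands for a blank, as the word must not contain 0.
\<close>

definition range_word :: "nat \<Rightarrow> bool list \<Rightarrow> nat list" where
  "range_word k x = (let r = replicate (half k (length x)) 3 in [4] @ (r @ ([5] @ (map bit_symbol x @ r))))"

definition range_length :: "nat \<Rightarrow> nat \<Rightarrow> nat" where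
  "range_length k n = 2 * half k n + n + 2"

definition reduction_time :: "nat \<Rightarrow> nat \<Rightarrow> nat \<Rightarrow> nat" where
  "reduction_time k B n = (let N = range_length k n; a = nest_time (n + 2) k in
     (for_time n 1 + (1 + 1)) + ((2 * (n + 2) + 3) + ((1 + (1 + 1)) + (1 + (1 +
     ((1 + (a + (1 + (for_time n 1 + a)))) + ((2 * N + 3) + (1 + instance_time N B))))))))"

lemma length_range_word: "length (range_word k x) = range_length k (length x)"
  by (simp add: range_word_def range_length_def Let_def)

lemma range_word_nonzero: "0 \<notin> set (range_word k x)"
  by (auto simp: range_word_def Let_def bit_symbol_def)

lemma range_word_nth:
  assumes "p < range_length k (length x)"
  shows "range_word k x ! p = (if p = 0 then 4 else if p = half k (length x) + 1 then 5
    else if half k (length x) + 2 \<le> p \<and> p < half k (length x) + 2 + length x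
      then bit_symbol (x ! (p - (half k (length x) + 2))) else 3)"
  using assms
  by (auto simp: range_word_def Let_def range_length_def nth_append nth_Cons split: nat.splits
      intro!: arg_cong[where f = bit_symbol] arg_cong[where f = "(!) x"])

section \<open>Composition of the stages of the reduction\<close>

definition runs where
  "runs p \<sigma> \<sigma>' \<tau> \<longleftrightarrow> (\<exists>t\<le>\<tau>. exec p \<sigma> t \<sigma>')"

lemma runs_Seq:
  assumes "runs p \<sigma> \<sigma>' \<tau>" "runs q \<sigma>' \<sigma>'' \<tau>'"
  shows "runs (Seq p q) \<sigma> \<sigma>'' (\<tau> + \<tau>')"
proof -
  obtain t t' where "t \<le> \<tau>" "exec p \<sigma> t \<sigma>'" "t' \<le> \<tau>'" "exec q \<sigma>' t' \<sigma>''"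
    using assms unfolding runs_def by blast
  then show ?thesis unfolding runs_def by (intro exI[of _ "t + t'"]) (auto intro: exec.Seq)
qed

lemma runs_exec: "exec p \<sigma> t \<sigma>' \<Longrightarrow> runs p \<sigma> \<sigma>' t"
  unfolding runs_def by blast

lemma runs_gen: "gen f W p h w \<tau> \<Longrightarrow> runs p (st f W h []) (st f W h w) \<tau>"
  unfolding runs_def gen_def by (metis append_Nil)

lemma st_Nil: "(\<And>i. i \<in> W \<Longrightarrow> f i = (\<lambda>_. 0) \<and> h i = 0) \<Longrightarrow> st f W h [] = cfg f h"
  by (auto simp: st_def cfg_def)

lemma gen_copy:
  assumes "f 0 = contents x" "0 \<notin> W" "h 0 = 0"
  shows "gen f W (For 0 step0 (Emit W (\<lambda>\<rho>. \<rho> 0))) h (map bit_symbol x) (for_time (length x) 1)"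
proof -
  have "gen f W (For 0 step0 (Emit W (\<lambda>\<rho>. \<rho> 0))) h
      (concat (map (\<lambda>i. [bit_symbol (x ! i)]) [0..<length x])) (for_time (length x) 1)"
  proof (rule gen_For)
    fix i assume "i < length x"
    then have "rd f W (adv step0 (int i) h) 0 = bit_symbol (x ! i)"
      using assms by (simp add: rd_def adv_def only_def contents_def bit_symbol_def)
    then show "gen f W (Emit W (\<lambda>\<rho>. \<rho> 0)) (adv step0 (int i) h) [bit_symbol (x ! i)] 1"
      using gen_Emit[of f W "\<lambda>\<rho>. \<rho> 0" "adv step0 (int i) h"] by simp
  next
    show "f 0 z \<noteq> 0 \<longleftrightarrow> 0 \<le> z \<and> z < int (length x)" for z
      using assms by (auto simp: contents_def)
    show "\<forall>i\<in>W. step0 i = Stay" using assms(2) by (metis only_def singletonD)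
  qed (use assms in \<open>auto simp: only_def\<close>)
  moreover have "concat (map (\<lambda>i. [bit_symbol (x ! i)]) [0..<length x]) = map bit_symbol (map ((!) x) [0..<length x])"
    by (simp add: comp_def)
  ultimately show ?thesis by (simp only: map_nth)
qed

lemma gen_count:
  assumes "f 0 = contents x" "0 \<notin> W" "h 0 = 0"
  shows "gen f W (For 0 step0 (Emit W (\<lambda>_. s))) h (replicate (length x) s) (for_time (length x) 1)"
proof -
  have "gen f W (For 0 step0 (Emit W (\<lambda>_. s))) h
      (concat (map (\<lambda>i. [s]) [0..<length x])) (for_time (length x) 1)"
  proof (rule gen_For)
    show "f 0 z \<noteq> 0 \<longleftrightarrow> 0 \<le> z \<and> z < int (length x)" for z
      using assms by (auto simp: contents_def)
    show "gen f W (Emit W (\<lambda>_. s)) (adv step0 (int i) h) [s] 1" for i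
      using gen_Emit[of f W "\<lambda>_. s"] by simp
    show "\<forall>i\<in>W. step0 i = Stay" using assms(2) by (metis only_def singletonD)
  qed (use assms in \<open>auto simp: only_def\<close>)
  then show ?thesis using concat_map_replicate[of 1 s "length x"] by simp
qed

lemma reduction_runs:
  assumes "0 < k" and tab: "tableau M x P (half k (length x) + 2) (range_length k (length x))"
  shows "\<exists>t \<sigma>. t \<le> reduction_time k (width M) (length x) \<and> exec (reduction k M) (init_store x) t \<sigma> \<and>
    fst (\<sigma> (8 + k)) =
      contents (tableau.instance_code M x (half k (length x) + 2) (range_length k (length x)))"
proof -
  let ?n = "length x" and ?A = "base_tapes k" and ?D = "{6, 7} :: nat set" and ?R = "{1..5} :: nat set"
  let ?og = "half k ?n + 2" and ?N = "range_length k ?n" and ?w = "range_word k x"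
  let ?b = "replicate (?n + 2) 3 :: nat list"
  \<comment> \<open>\<open>f0\<close> to \<open>f3\<close> and \<open>h0\<close> to
    \<open>h3\<close> describe the tapes between the stages. Each stage writes to tapes that are
    still blank, as \<open>st_Nil\<close> requires.\<close>
  define f0 :: "nat \<Rightarrow> int \<Rightarrow> nat" where "f0 i = (if i = 0 then contents x else (\<lambda>_. 0))" for i
  define h0 :: "nat \<Rightarrow> int" where "h0 i = 0" for i
  define f1 where "f1 i = (if i \<in> ?A then word ?b else f0 i)" for i
  define f2 where "f2 i = (if i \<in> ?D then word [1, 2, 3] else f1 i)" for i
  define h2 :: "nat \<Rightarrow> int" where "h2 i = (if i \<in> ?D then 1 else 0)" for i
  define f3 where "f3 i = (if i \<in> ?R then word ?w else f2 i)" for i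
  define h3 :: "nat \<Rightarrow> int" where "h3 i = (if i = 5 then -1 else h2 i)" for i
  have A8: "i \<in> ?A \<longleftrightarrow> 8 \<le> i \<and> i < 8 + k" for i by (auto simp: base_tapes_def)
  have r0: "replicate ?n 3 @ ([3] @ [3]) = ?b"
    by (simp add: replicate_add[symmetric] replicate_app_Cons_same)
  have one: "gen f W (Emit W (\<lambda>_. s)) H [s] 1" for f W s H
    using gen_Emit[of f W "\<lambda>_. s" H] by simp
  have "gen f0 ?A (stage_base k) h0 (replicate ?n 3 @ ([3] @ [3])) (for_time ?n 1 + (1 + 1))"
    unfolding stage_base_def by (intro gen_Seq one gen_count) (auto simp: f0_def h0_def A8)
  moreover have "init_store x = st f0 ?A h0 []"
    by (auto simp: init_store_def st_def f0_def h0_def A8)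
  ultimately have 1: "runs (stage_base k) (init_store x) (st f0 ?A h0 ?b) (for_time ?n 1 + (1 + 1))"
    using runs_gen r0 by metis
  have "(\<lambda>i. if i \<in> ?A then 0 else h0 i) = h0" by (simp add: h0_def fun_eq_iff)
  then have 2: "runs (Rewind 8 ?A) (st f0 ?A h0 ?b) (cfg f1 h0) (2 * (?n + 2) + 3)"
    using runs_exec[OF exec_Rewind[of 8 ?A ?b f0 h0]] assms(1)
    by (simp add: A8 f1_def[abs_def])
  have "gen f1 ?D stage_marks h0 ([1] @ ([2] @ [3])) (1 + (1 + 1))"
    unfolding stage_marks_def by (intro gen_Seq one)
  moreover have "st f1 ?D h0 [] = cfg f1 h0"
    by (rule st_Nil) (auto simp: f1_def f0_def h0_def A8)
  ultimately have 3: "runs stage_marks (cfg f1 h0) (st f1 ?D h0 [1, 2, 3]) (1 + (1 + 1))"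
    using runs_gen by fastforce
  have st3: "st f1 ?D h0 [1, 2, 3] = cfg f2 (\<lambda>i. if i \<in> ?D then 3 else 0)"
    by (auto simp: st_def cfg_def f2_def h0_def fun_eq_iff)
  have 4: "runs (Move (only ?D Go_Left)) (st f1 ?D h0 [1, 2, 3]) (cfg f2 (\<lambda>i. if i \<in> ?D then 2 else 0)) 1"
  proof -
    have "adv (only ?D Go_Left) 1 (\<lambda>i. if i \<in> ?D then 3 else 0) = (\<lambda>i. if i \<in> ?D then 2 else 0)"
      by (auto simp: adv_def only_def fun_eq_iff)
    then show ?thesis unfolding st3 using runs_exec[OF exec_Move] by metis
  qed
  have 5: "runs (Move (only ?D Go_Left)) (cfg f2 (\<lambda>i. if i \<in> ?D then 2 else 0)) (cfg f2 h2) 1"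
  proof -
    have "adv (only ?D Go_Left) 1 (\<lambda>i. if i \<in> ?D then 2 else 0) = h2"
      by (auto simp: adv_def only_def fun_eq_iff h2_def)
    then show ?thesis using runs_exec[OF exec_Move] by metis
  qed
  have f2_base: "f2 (8 + j) = word ?b" if "j < k" for j
    using that by (simp add: f2_def f1_def A8)
  have f2_0: "f2 0 = contents x" by (simp add: f2_def f1_def f0_def A8)
  have "gen f2 ?R (stage_range k) h2 ?w
    (1 + (nest_time (?n + 2) k + (1 + (for_time ?n 1 + nest_time (?n + 2) k))))"
    unfolding stage_range_def range_word_def Let_def half_def
    by (intro gen_Seq one gen_nest gen_copy f2_base f2_0) (auto simp: h2_def)
  moreover have "st f2 ?R h2 [] = cfg f2 h2"
    by (rule st_Nil) (auto simp: f2_def f1_def f0_def h2_def A8)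
  ultimately have 6: "runs (stage_range k) (cfg f2 h2) (st f2 ?R h2 ?w)
    (1 + (nest_time (?n + 2) k + (1 + (for_time ?n 1 + nest_time (?n + 2) k))))"
    using runs_gen by metis
  have "(\<lambda>i. if i \<in> ?R then 0 else h2 i) = h2" by (auto simp: h2_def fun_eq_iff)
  then have 7: "runs (Rewind 1 ?R) (st f2 ?R h2 ?w) (cfg f3 h2) (2 * ?N + 3)"
    using runs_exec[OF exec_Rewind[of 1 ?R ?w f2 h2]] range_word_nonzero
    by (simp add: length_range_word f3_def[abs_def])
  have 8: "runs (Move (only {5} Go_Left)) (cfg f3 h2) (cfg f3 h3) 1"
  proof -
    have "adv (only {5} Go_Left) 1 h2 = h3"
      by (auto simp: adv_def only_def fun_eq_iff h2_def h3_def)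
    then show ?thesis using runs_exec[OF exec_Move] by metis
  qed
  interpret tableau M x P ?og ?N by (rule tab)
  interpret generator M x P ?og ?N f3 "{8 + k}" h3 ?w
  proof unfold_locales
    show "f3 i = word ?w" if "i \<in> {1..5}" for i using that by (simp add: f3_def)
    show "f3 6 = word [1, 2, 3]" "f3 7 = word [1, 2, 3]" by (simp_all add: f3_def f2_def)
    show "i \<notin> {8 + k}" if "i \<le> 7" for i using that by simp
    show "h3 1 = 0" "h3 2 = 0" "h3 3 = 0" "h3 4 = 0" "h3 5 = -1" "h3 6 = 1" "h3 7 = 1"
      by (simp_all add: h3_def h2_def)
    show "length ?w = ?N" "0 \<notin> set ?w" by (rule length_range_word, rule range_word_nonzero)
    fix p assume p: "p < ?N"
    show "?w ! p = 4 \<longleftrightarrow> p = 0" "?w ! p = 5 \<longleftrightarrow> Suc p = ?og"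
      unfolding range_word_nth[OF p] by (auto simp: bit_symbol_def)
    show "read_symbol (?w ! p) = symbol p"
      unfolding range_word_nth[OF p] symbol_def contents_def read_symbol_def
      by (auto simp: bit_symbol_def nat_diff_distrib' nat_add_distrib)
  qed
  have "st f3 {8 + k} h3 [] = cfg f3 h3"
    by (rule st_Nil) (auto simp: f3_def f2_def f1_def f0_def h3_def h2_def A8)
  then have 9: "runs (emit_instance {8 + k} M) (cfg f3 h3) (st f3 {8 + k} h3 (map bit_symbol instance_code))
      (instance_time ?N (width M))"
    using runs_gen[OF gen_instance] by metis
  have "runs (reduction k M) (init_store x) (st f3 {8 + k} h3 (map bit_symbol instance_code))
      (reduction_time k (width M) ?n)"
    unfolding reduction_def reduction_time_def Let_def
    by (rule runs_Seq[OF 1 runs_Seq[OF 2 runs_Seq[OF 3 runs_Seq[OF 4 runs_Seq[OF 5 runs_Seq[OF 6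
          runs_Seq[OF 7 runs_Seq[OF 8 9]]]]]]]])
  moreover have "fst (st f3 {8 + k} h3 (map bit_symbol instance_code) (8 + k)) = contents instance_code"
    by (simp add: st_def contents_word)
  ultimately show ?thesis unfolding runs_def by blast
qed

lemma wf_EmitBits: "W \<subseteq> {..<K} \<Longrightarrow> wf_prog K 6 (EmitBits W bs)"
  by (auto simp: EmitBits_def bit_symbol_def intro!: wf_Emit)

lemma wf_EmitBlocks: "W \<subseteq> {..<K} \<Longrightarrow> wf_prog K 6 (EmitBlocks W gs)"
  by (auto simp: EmitBlocks_def EmitBlock_def bit_symbol_def intro!: wf_Emit)

lemma wf_ForTP: "9 \<le> K \<Longrightarrow> wf_prog K S (ForTP q) \<longleftrightarrow> wf_prog K S q"
  by (auto simp: ForTP_def mT_def mP_def only_def)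

lemma wf_ForTP': "9 \<le> K \<Longrightarrow> wf_prog K S (ForTP' q) \<longleftrightarrow> wf_prog K S q"
  by (auto simp: ForTP'_def mT'_def mP'_def only_def)

lemma wf_emit_instance:
  assumes "W \<subseteq> {..<K}" "9 \<le> K"
  shows "wf_prog K 6 (emit_instance W M)"
  using assms
  by (auto simp: emit_instance_def emit_row_def emit_pairs_def Let_def wf_ForTP wf_ForTP'
      wf_EmitBits wf_EmitBlocks simp del: upt_Suc)

lemma wf_nest: "k \<le> j \<Longrightarrow> wf_prog (9 + j) S q \<Longrightarrow> wf_prog (9 + j) S (nest k q)"
  by (induction k) (auto simp: only_def)

lemma wf_reduction: "wf_prog (9 + k) 6 (reduction k M)"
proof -
  have e: "wf_prog (9 + k) 6 (Emit W (\<lambda>_. s))" if "W \<subseteq> {..<9 + k}" "s < 6" for W s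
    using that by (intro wf_Emit) auto
  have A: "base_tapes k \<subseteq> {..<9 + k}" by (auto simp: base_tapes_def)
  have R: "{1..5} \<subseteq> {..<9 + k}" "{6, 7} \<subseteq> {..<9 + k}" by auto
  have "wf_prog (9 + k) 6 (Emit {1..5} (\<lambda>\<rho>. \<rho> 0))" using R by (intro wf_Emit) auto
  then have "wf_prog (9 + k) 6 (stage_range k)"
    unfolding stage_range_def Let_def using R by (auto simp: only_def intro!: e wf_nest)
  moreover have "wf_prog (9 + k) 6 (stage_base k)" "wf_prog (9 + k) 6 stage_marks"
    unfolding stage_base_def stage_marks_def using A R by (auto simp: only_def intro!: e)
  ultimately show ?thesis
    unfolding reduction_def using A R by (auto simp: only_def intro!: wf_emit_instance)
qed

lemma poly_bounded_reduction_time: "poly_bounded (reduction_time k B)"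
proof -
  have nest: "poly_bounded (\<lambda>n. nest_time (n + 2) j)" for j
    by (induction j) (simp_all add: poly_bounded_intros del: add_2_eq_Suc')
  show ?thesis
    unfolding reduction_time_def[abs_def] Let_def instance_time_def row_time_def range_length_def half_def
    by (intro poly_bounded_intros nest)
qed

theorem grid_circuit_sat_NP_hard:
  assumes "value_convention val"
  shows "NP_hard (grid_circuit_sat val)"
  unfolding NP_hard_def
proof
  fix L assume "L \<in> NP"
  then obtain M and p :: "nat poly" where M: "wf_tm M"
    and time: "\<And>x t c. (step M ^^ t) (init M x) c \<Longrightarrow> t \<le> poly p (length x)"
    and L: "\<And>x. x \<in> L \<longleftrightarrow> tm_accepts M x"
    unfolding NP_def by blast
  \<comment> \<open>The margin yields both inequalities of \<open>room\<close>. The origin is at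
    \<open>half k n + 2\<close>, behind the mark 4, the blanks and the mark 5.\<close>
  obtain k where k: "0 < k" "\<And>n. poly p n + 2 \<le> half k n"
    using poly_le_power[of p] unfolding half_def by blast
  let ?f = "\<lambda>x. tableau.instance_code M x (half k (length x) + 2) (range_length k (length x))"
  have tab: "tableau M x (poly p (length x)) (half k (length x) + 2) (range_length k (length x))" for x
  proof
    show "wf_tm M" by (rule M)
    show "poly p (length x) < half k (length x) + 2"
      "half k (length x) + 2 + poly p (length x) + 1 < range_length k (length x)"
      using k(2)[of "length x"] by (auto simp: range_length_def)
  qed (rule time)
  obtain B where B: "\<And>n. reduction_time k (width M) n \<le> poly B n"
    using poly_bounded_reduction_time unfolding poly_bounded_def by blast
  have "polytime_computable ?f"
  proof (rule polytime_computableI[where p = "reduction k M" and K = "9 + k" and S = 6 and B = B])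
    show "wf_prog (9 + k) 6 (reduction k M)" by (rule wf_reduction)
    fix x
    show "\<exists>t \<sigma>. t \<le> poly B (length x) \<and> exec (reduction k M) (init_store x) t \<sigma> \<and>
        fst (\<sigma> (9 + k - 1)) = contents (?f x)"
      using reduction_runs[OF k(1) tab[of x]] B[of "length x"] by (auto intro: order_trans)
  qed auto
  moreover have "x \<in> L \<longleftrightarrow> ?f x \<in> grid_circuit_sat val" for x
    using tableau.instance_correct[OF tab assms] L by simp
  ultimately show "poly_reducible L (grid_circuit_sat val)"
    unfolding poly_reducible_def by blast
qed

section \<open>A nondeterministic machine evaluating grid circuits\<close>

text \<open>
  Tape 0 holds the input, which is read once from left to right. Tape 1 has one cell per column of
  the grid: cell \<open>c\<close> holds \<open>1 + b\<close>, where \<open>b\<close> is the latest south output in column \<open>c\<close>, plus 2 in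
  the target column. Tape 2 has one cell per row, holding 2 in the target row and 1 elsewhere.
  The arguments of \<open>Code0\<close>, \<open>Code1\<close>, \<open>Code2\<close> are, in this order: is this the first row, is this the
  first column, the latest east output, and the bits of the current block code read so far.
\<close>

datatype vstate = Read_Size | Rewind_Size | Read_Row | Rewind_Row | Read_Col | Rewind_Col | Done
  | Code0 bool bool bool | Code1 bool bool bool bool | Code2 bool bool bool bool bool
  | Cell_Done bool bool | Rewind_Grid bool | Row_Start bool

context
  fixes val :: "bool \<times> bool \<Rightarrow> bool"
begin

text \<open>The three bits determine the block, and the guess is \<open>e\<close>. The old column
  symbol \<open>b\<close> supplies the north input: 2 and 4 mean true, 3 and 4 mark the target
  column. At the target cell a path survives only if its value is true.\<close>

definition block_actions where
  "block_actions fr fc w b1 b2 a b c = {(Cell_Done fr E, (a, Go_Right), (1 + of_bool S + (if 3 \<le> b then 2 else 0), Go_Right), (c, Stay)) | blk e E S.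
     block_code blk = [b1, b2, a = 2] \<and> (fr \<or> fc \<longrightarrow> blk = Fixed) \<and>
     (E, S) = block_out blk e (b = 2 \<or> b = 4) w \<and> (3 \<le> b \<and> c = 2 \<longrightarrow> val (E, S))}"

text \<open>Where the input violates the format no transition applies, so a malformed input blocks
  every path before \<open>Done\<close>; the blank test in \<open>Row_Start\<close> excludes
  trailing symbols.\<close>

fun vtr :: "vstate \<Rightarrow> nat \<Rightarrow> nat \<Rightarrow> nat \<Rightarrow> (vstate \<times> action \<times> action \<times> action) set" where
  "vtr Read_Size a b c = (if a = 2 then {(Read_Size, (a, Go_Right), (1, Go_Right), (1, Go_Right))}
     else if a = 1 then {(Rewind_Size, (a, Go_Right), (b, Go_Left), (c, Go_Left))} else {})"
| "vtr Rewind_Size a b c = (if b \<noteq> 0 then {(Rewind_Size, (a, Stay), (b, Go_Left), (c, Go_Left))}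
     else {(Read_Row, (a, Stay), (b, Go_Right), (c, Go_Right))})"
| "vtr Read_Row a b c = (if a = 2 then {(Read_Row, (a, Go_Right), (b, Stay), (c, Go_Right))}
     else if a = 1 \<and> c \<noteq> 0 then {(Rewind_Row, (a, Go_Right), (b, Stay), (2, Go_Left))} else {})"
| "vtr Rewind_Row a b c = (if c \<noteq> 0 then {(Rewind_Row, (a, Stay), (b, Stay), (c, Go_Left))}
     else {(Read_Col, (a, Stay), (b, Stay), (c, Go_Right))})"
| "vtr Read_Col a b c = (if a = 2 then {(Read_Col, (a, Go_Right), (b, Go_Right), (c, Stay))}
     else if a = 1 \<and> b \<noteq> 0 then {(Rewind_Col, (a, Go_Right), (3, Go_Left), (c, Stay))} else {})"
| "vtr Rewind_Col a b c = (if b \<noteq> 0 then {(Rewind_Col, (a, Stay), (b, Go_Left), (c, Stay))}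
     else {(Code0 True True False, (a, Stay), (b, Go_Right), (c, Stay))})"
| "vtr (Code0 fr fc w) a b c = (if a \<noteq> 0 then {(Code1 fr fc w (a = 2), (a, Go_Right), (b, Stay), (c, Stay))} else {})"
| "vtr (Code1 fr fc w b1) a b c = (if a \<noteq> 0 then {(Code2 fr fc w b1 (a = 2), (a, Go_Right), (b, Stay), (c, Stay))} else {})"
| "vtr (Code2 fr fc w b1 b2) a b c = (if a \<noteq> 0 \<and> b \<noteq> 0 then block_actions fr fc w b1 b2 a b c else {})"
| "vtr (Cell_Done fr w) a b c = (if b \<noteq> 0 then {(Code0 fr False w, (a, Stay), (b, Stay), (c, Stay))}
     else {(Rewind_Grid w, (a, Stay), (b, Go_Left), (c, Stay))})"
| "vtr (Rewind_Grid w) a b c = (if b \<noteq> 0 then {(Rewind_Grid w, (a, Stay), (b, Go_Left), (c, Stay))}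
     else {(Row_Start w, (a, Stay), (b, Go_Right), (c, Go_Right))})"
| "vtr (Row_Start w) a b c = (if c \<noteq> 0 then {(Code0 False True w, (a, Stay), (b, Stay), (c, Stay))}
     else if a = 0 then {(Done, (a, Stay), (b, Stay), (c, Stay))} else {})"
| "vtr Done a b c = {}"

type_synonym vconf = "vstate \<times> tape \<times> tape \<times> tape"

definition vstep :: "vconf \<Rightarrow> vconf \<Rightarrow> bool" where
  "vstep c c' \<longleftrightarrow> (case c of (s, t0, t1, t2) \<Rightarrow>
     \<exists>(s', x, y, z) \<in> vtr s (read t0) (read t1) (read t2). c' = (s', act x t0, act y t1, act z t2))"

section \<open>Acceptance as a recursion over configurations\<close>

definition vacc :: "vconf \<Rightarrow> bool" where
  "vacc c \<longleftrightarrow> (\<exists>ts. vstep\<^sup>*\<^sup>* c (Done, ts))"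

lemma vacc_Done: "vacc (Done, ts)"
  unfolding vacc_def by blast

text \<open>Acceptance is unfolded from a configuration to its successors. The lemmas below can thus
  be equivalences, which settle soundness and completeness of the verifier together.\<close>

lemma vacc_step:
  assumes "s \<noteq> Done"
  shows "vacc (s, t0, t1, t2) \<longleftrightarrow> (\<exists>(s', x, y, z) \<in> vtr s (read t0) (read t1) (read t2).
    vacc (s', act x t0, act y t1, act z t2))"
proof -
  have "\<exists>c'. vstep (s, t0, t1, t2) c' \<and> vacc c'" if "vacc (s, t0, t1, t2)"
  proof -
    obtain ts where "vstep\<^sup>*\<^sup>* (s, t0, t1, t2) (Done, ts)" using \<open>vacc _\<close> unfolding vacc_def by blast
    then show ?thesis by (rule converse_rtranclpE) (use assms in \<open>auto simp: vacc_def\<close>)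
  qed
  moreover have "vacc (s, t0, t1, t2)" if "vstep (s, t0, t1, t2) c'" "vacc c'" for c'
    using that unfolding vacc_def by (blast intro: converse_rtranclp_into_rtranclp)
  ultimately have "vacc (s, t0, t1, t2) \<longleftrightarrow> (\<exists>c'. vstep (s, t0, t1, t2) c' \<and> vacc c')" by blast
  then show ?thesis unfolding vstep_def case_prod_beta prod.sel by blast
qed

lemma vacc_det:
  assumes "vtr s (read t0) (read t1) (read t2) = {(s', x, y, z)}"
  shows "vacc (s, t0, t1, t2) \<longleftrightarrow> vacc (s', act x t0, act y t1, act z t2)"
proof -
  have "s \<noteq> Done" using assms by auto
  then show ?thesis using assms by (simp add: vacc_step)
qed

lemma vacc_none:
  assumes "vtr s (read t0) (read t1) (read t2) = {}" "s \<noteq> Done"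
  shows "\<not> vacc (s, t0, t1, t2)"
  using assms by (simp add: vacc_step)

lemma act_same: "read tp = a \<Longrightarrow> act (a, d) tp = (fst tp, shift d (snd tp))"
  by (cases tp) auto

text \<open>The value -1 for \<open>z\<close> covers a head that is already on the blank to the
  left.\<close>

definition rewindable :: "(int \<Rightarrow> nat) \<Rightarrow> int \<Rightarrow> bool" where
  "rewindable f z \<longleftrightarrow> f (-1) = 0 \<and> -1 \<le> z \<and> (\<forall>y. 0 \<le> y \<and> y \<le> z \<longrightarrow> f y \<noteq> 0)"

lemma rewind_induct:
  assumes "rewindable f z" "\<And>y. f y \<noteq> 0 \<Longrightarrow> Q y \<longleftrightarrow> Q (y - 1)"
  shows "Q z \<longleftrightarrow> Q (-1)"
  using assms(1)
proof (induction "nat (z + 1)" arbitrary: z rule: less_induct)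
  case less
  show ?case
  proof (cases "z = -1")
    case False
    then have "f z \<noteq> 0" "rewindable f (z - 1)" "nat (z - 1 + 1) < nat (z + 1)"
      using less.prems by (auto simp: rewindable_def)
    then show ?thesis using less.hyps[of "z - 1"] assms(2)[of z] by blast
  qed simp
qed

lemma vacc_Rewind_Size:
  assumes "rewindable f z"
  shows "vacc (Rewind_Size, t0, (f, z), (f, z)) \<longleftrightarrow> vacc (Read_Row, t0, (f, 0), (f, 0))"
proof -
  have "f (-1) = 0" "f(-1 := 0) = f" using assms by (auto simp: rewindable_def fun_upd_idem)
  then have "vacc (Rewind_Size, t0, (f, -1), (f, -1)) \<longleftrightarrow> vacc (Read_Row, t0, (f, 0), (f, 0))"
    by (subst vacc_det) auto
  moreover have "vacc (Rewind_Size, t0, (f, y), (f, y)) \<longleftrightarrow> vacc (Rewind_Size, t0, (f, y - 1), (f, y - 1))" if "f y \<noteq> 0" for y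
    using that by (subst vacc_det) (auto simp: act_same)
  ultimately show ?thesis using rewind_induct[OF assms, of "\<lambda>z. vacc (Rewind_Size, t0, (f, z), (f, z))"] by blast
qed

lemma vacc_Rewind_Row:
  assumes "rewindable f z"
  shows "vacc (Rewind_Row, t0, t1, (f, z)) \<longleftrightarrow> vacc (Read_Col, t0, t1, (f, 0))"
proof -
  have "f (-1) = 0" "f(-1 := 0) = f" using assms by (auto simp: rewindable_def fun_upd_idem)
  then have "vacc (Rewind_Row, t0, t1, (f, -1)) \<longleftrightarrow> vacc (Read_Col, t0, t1, (f, 0))"
    by (subst vacc_det) auto
  moreover have "vacc (Rewind_Row, t0, t1, (f, y)) \<longleftrightarrow> vacc (Rewind_Row, t0, t1, (f, y - 1))" if "f y \<noteq> 0" for y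
    using that by (subst vacc_det) (auto simp: act_same)
  ultimately show ?thesis using rewind_induct[OF assms, of "\<lambda>z. vacc (Rewind_Row, t0, t1, (f, z))"] by blast
qed

lemma vacc_Rewind_Col:
  assumes "rewindable f z"
  shows "vacc (Rewind_Col, t0, (f, z), t2) \<longleftrightarrow> vacc (Code0 True True False, t0, (f, 0), t2)"
proof -
  have "f (-1) = 0" "f(-1 := 0) = f" using assms by (auto simp: rewindable_def fun_upd_idem)
  then have "vacc (Rewind_Col, t0, (f, -1), t2) \<longleftrightarrow> vacc (Code0 True True False, t0, (f, 0), t2)"
    by (subst vacc_det) auto
  moreover have "vacc (Rewind_Col, t0, (f, y), t2) \<longleftrightarrow> vacc (Rewind_Col, t0, (f, y - 1), t2)" if "f y \<noteq> 0" for y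
    using that by (subst vacc_det) (auto simp: act_same)
  ultimately show ?thesis using rewind_induct[OF assms, of "\<lambda>z. vacc (Rewind_Col, t0, (f, z), t2)"] by blast
qed

lemma vacc_Rewind_Grid:
  assumes "rewindable f z"
  shows "vacc (Rewind_Grid w, t0, (f, z), (g, i)) \<longleftrightarrow> vacc (Row_Start w, t0, (f, 0), (g, i + 1))"
proof -
  have "f (-1) = 0" "f(-1 := 0) = f" using assms by (auto simp: rewindable_def fun_upd_idem)
  then have "vacc (Rewind_Grid w, t0, (f, -1), (g, i)) \<longleftrightarrow> vacc (Row_Start w, t0, (f, 0), (g, i + 1))"
    by (subst vacc_det) auto
  moreover have "vacc (Rewind_Grid w, t0, (f, y), (g, i)) \<longleftrightarrow> vacc (Rewind_Grid w, t0, (f, y - 1), (g, i))" if "f y \<noteq> 0" for y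
    using that by (subst vacc_det) (auto simp: act_same)
  ultimately show ?thesis using rewind_induct[OF assms, of "\<lambda>z. vacc (Rewind_Grid w, t0, (f, z), (g, i))"] by blast
qed

context
  fixes x :: "bool list"
begin

section \<open>Reading the three unary numbers\<close>

definition T :: "nat \<Rightarrow> tape" where
  "T h = (contents x, int h)"

lemma read_T: "read (T h) = (case drop h x of [] \<Rightarrow> 0 | b # _ \<Rightarrow> bit_symbol b)"
proof (cases "h < length x")
  case True
  then show ?thesis by (simp add: T_def contents_def bit_symbol_def Cons_nth_drop_Suc[symmetric])
qed (simp add: T_def contents_def)

lemma act_T: "read (T h) = a \<Longrightarrow> act (a, Go_Right) (T h) = T (Suc h)" "read (T h) = a \<Longrightarrow> act (a, Stay) (T h) = T h"
  by (auto simp: T_def)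

lemma drop_Suc': "drop h x = b # y \<Longrightarrow> drop (Suc h) x = y"
  by (metis drop_Suc list.sel(3) tl_drop)

definition marks :: "nat \<Rightarrow> int \<Rightarrow> nat" where
  "marks n z = (if 0 \<le> z \<and> z < int n then 1 else 0)"

lemma marks_Suc: "(marks n)(int n := Suc 0) = marks (Suc n)"
  by (auto simp: marks_def fun_eq_iff)

lemma ex_unary_Cons:
  "(\<exists>k y'. True # y = unary k @ y' \<and> Q k) \<longleftrightarrow> (\<exists>k y'. y = unary k @ y' \<and> Q (Suc k))"
  "(\<exists>k y'. False # y = unary k @ y' \<and> Q k) \<longleftrightarrow> Q 0"
proof -
  have *: "b # y = unary k @ y' \<longleftrightarrow> (if b then \<exists>k'. k = Suc k' \<and> y = unary k' @ y' else k = 0 \<and> y = y')" for b k y'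
    by (cases k) (auto simp: unary_def)
  show "(\<exists>k y'. True # y = unary k @ y' \<and> Q k) \<longleftrightarrow> (\<exists>k y'. y = unary k @ y' \<and> Q (Suc k))"
    "(\<exists>k y'. False # y = unary k @ y' \<and> Q k) \<longleftrightarrow> Q 0"
    unfolding * by auto
qed

lemma unary_not_Nil: "unary k @ y' \<noteq> []"
  by (simp add: unary_def)

text \<open>Stated for \<open>n\<close> marks already written, which makes the induction over the
  remaining input go through.\<close>

lemma vacc_Read_Size:
  "drop h x = y \<Longrightarrow> vacc (Read_Size, T h, (marks n, int n), (marks n, int n)) \<longleftrightarrow>
    (\<exists>k y'. y = unary k @ y' \<and> vacc (Read_Row, T (h + k + 1), (marks (n + k), 0), (marks (n + k), 0)))"
proof (induction y arbitrary: h n)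
  case Nil
  then have "\<not> vacc (Read_Size, T h, (marks n, int n), (marks n, int n))"
    by (intro vacc_none) (simp_all add: read_T)
  then show ?case using unary_not_Nil by metis
next
  case (Cons b y)
  note d = drop_Suc'[OF Cons.prems]
  have marks_end: "marks n (int n) = 0" by (simp add: marks_def)
  have r: "read (T h) = bit_symbol b" using Cons.prems by (simp add: read_T)
  show ?case
  proof (cases b)
    case True
    then have "vacc (Read_Size, T h, (marks n, int n), (marks n, int n)) \<longleftrightarrow>
        vacc (Read_Size, T (Suc h), (marks (Suc n), int (Suc n)), (marks (Suc n), int (Suc n)))"
      using r by (subst vacc_det) (auto simp: bit_symbol_def act_T marks_Suc add.commute)
    then show ?thesis using True unfolding Cons.IH[OF d]
      by (simp only: ex_unary_Cons add_Suc add_Suc_right)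
  next
    case False
    then have "vacc (Read_Size, T h, (marks n, int n), (marks n, int n)) \<longleftrightarrow>
        vacc (Rewind_Size, T (Suc h), (marks n, int n - 1), (marks n, int n - 1))"
      using r marks_end by (subst vacc_det) (auto simp: bit_symbol_def act_T fun_upd_idem)
    also have "\<dots> \<longleftrightarrow> vacc (Read_Row, T (Suc h), (marks n, 0), (marks n, 0))"
      by (rule vacc_Rewind_Size) (auto simp: rewindable_def marks_def)
    finally show ?thesis using False by (simp only: ex_unary_Cons) simp
  qed
qed

text \<open>The bound \<open>j + k < n\<close> comes from the test that the head is on a mark when
  the unary number ends.\<close>

lemma vacc_Read_Row:
  "drop h x = y \<Longrightarrow> vacc (Read_Row, T h, t1, (marks n, int j)) \<longleftrightarrow>
    (\<exists>k y'. y = unary k @ y' \<and> j + k < n \<and> vacc (Read_Col, T (h + k + 1), t1, ((marks n)(int (j + k) := 2), 0)))"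
proof (induction y arbitrary: h j)
  case Nil
  then have "\<not> vacc (Read_Row, T h, t1, (marks n, int j))"
    by (intro vacc_none) (simp_all add: read_T)
  then show ?case using unary_not_Nil by metis
next
  case (Cons b y)
  note d = drop_Suc'[OF Cons.prems]
  have r: "read (T h) = bit_symbol b" using Cons.prems by (simp add: read_T)
  show ?case
  proof (cases b)
    case True
    then have "vacc (Read_Row, T h, t1, (marks n, int j)) \<longleftrightarrow> vacc (Read_Row, T (Suc h), t1, (marks n, int (Suc j)))"
      using r by (subst vacc_det) (auto simp: bit_symbol_def act_T add.commute)
    then show ?thesis using True unfolding Cons.IH[OF d]
      by (simp only: ex_unary_Cons add_Suc add_Suc_right)
  next
    case False
    have "vacc (Read_Row, T h, t1, (marks n, int j)) \<longleftrightarrow>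
        j < n \<and> vacc (Rewind_Row, T (Suc h), t1, ((marks n)(int j := 2), int j - 1))"
    proof (cases "j < n")
      case True
      then show ?thesis using r False by (subst vacc_det) (auto simp: bit_symbol_def act_T marks_def)
    next
      case j: False
      then have "\<not> vacc (Read_Row, T h, t1, (marks n, int j))"
        using r False by (intro vacc_none) (auto simp: bit_symbol_def marks_def)
      then show ?thesis using j by simp
    qed
    also have "\<dots> \<longleftrightarrow> j < n \<and> vacc (Read_Col, T (Suc h), t1, ((marks n)(int j := 2), 0))"
      using vacc_Rewind_Row[of "(marks n)(int j := 2)" "int j - 1" "T (Suc h)" t1] by (auto simp: rewindable_def marks_def)
    finally show ?thesis using False by (simp only: ex_unary_Cons) simp
  qed
qed

lemma vacc_Read_Col:
  "drop h x = y \<Longrightarrow> vacc (Read_Col, T h, (marks n, int j), t2) \<longleftrightarrow>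
    (\<exists>k y'. y = unary k @ y' \<and> j + k < n \<and>
      vacc (Code0 True True False, T (h + k + 1), ((marks n)(int (j + k) := 3), 0), t2))"
proof (induction y arbitrary: h j)
  case Nil
  then have "\<not> vacc (Read_Col, T h, (marks n, int j), t2)"
    by (intro vacc_none) (simp_all add: read_T)
  then show ?case using unary_not_Nil by metis
next
  case (Cons b y)
  note d = drop_Suc'[OF Cons.prems]
  have r: "read (T h) = bit_symbol b" using Cons.prems by (simp add: read_T)
  show ?case
  proof (cases b)
    case True
    then have "vacc (Read_Col, T h, (marks n, int j), t2) \<longleftrightarrow> vacc (Read_Col, T (Suc h), (marks n, int (Suc j)), t2)"
      using r by (subst vacc_det) (auto simp: bit_symbol_def act_T add.commute)
    then show ?thesis using True unfolding Cons.IH[OF d]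
      by (simp only: ex_unary_Cons add_Suc add_Suc_right)
  next
    case False
    have "vacc (Read_Col, T h, (marks n, int j), t2) \<longleftrightarrow>
        j < n \<and> vacc (Rewind_Col, T (Suc h), ((marks n)(int j := 3), int j - 1), t2)"
    proof (cases "j < n")
      case True
      then show ?thesis using r False by (subst vacc_det) (auto simp: bit_symbol_def act_T marks_def)
    next
      case j: False
      then have "\<not> vacc (Read_Col, T h, (marks n, int j), t2)"
        using r False by (intro vacc_none) (auto simp: bit_symbol_def marks_def)
      then show ?thesis using j by simp
    qed
    also have "\<dots> \<longleftrightarrow> j < n \<and> vacc (Code0 True True False, T (Suc h), ((marks n)(int j := 3), 0), t2)"
      using vacc_Rewind_Col[of "(marks n)(int j := 3)" "int j - 1" "T (Suc h)" t2] by (auto simp: rewindable_def marks_def)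
    finally show ?thesis using False by (simp only: ex_unary_Cons) simp
  qed
qed

section \<open>The sweep over the grid, cell by cell\<close>

context
  fixes n i j :: nat
begin

definition columns :: "(nat \<Rightarrow> bool) \<Rightarrow> int \<Rightarrow> nat" where
  "columns \<sigma> z = (if 0 \<le> z \<and> z < int n then 1 + of_bool (\<sigma> (nat z)) + (if z = int j then 2 else 0) else 0)"

definition rows :: "int \<Rightarrow> nat" where
  "rows = (marks n)(int i := 2)"

text \<open>A run in row-major order, with \<open>\<sigma>\<close> the latest south output of each
  column and \<open>w\<close> the latest east output. At the start of a row \<open>w\<close> is left
  over from the previous row, which is harmless because column 0 carries fixed-value blocks.\<close>

primrec good :: "nat \<Rightarrow> (nat \<Rightarrow> bool) \<Rightarrow> bool \<Rightarrow> block list \<Rightarrow> bool" where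
  "good m \<sigma> w [] \<longleftrightarrow> m = n * n"
| "good m \<sigma> w (b # bs) \<longleftrightarrow> m < n * n \<and> (m < n \<or> m mod n = 0 \<longrightarrow> b = Fixed) \<and>
     (\<exists>e E S. (E, S) = block_out b e (\<sigma> (m mod n)) w \<and> (m = i * n + j \<longrightarrow> val (E, S)) \<and>
       good (Suc m) (\<sigma>(m mod n := S)) E bs)"

definition cell_conf :: "nat \<Rightarrow> (nat \<Rightarrow> bool) \<Rightarrow> bool \<Rightarrow> nat \<Rightarrow> vconf" where
  "cell_conf m \<sigma> w h = (Code0 (m < n) (m mod n = 0) w, T h, (columns \<sigma>, int (m mod n)), (rows, int (m div n)))"

lemma vacc_bits:
  "vacc (Code0 fr fc w, T h, t1, t2) \<longleftrightarrow> (\<exists>b1 b2 b3 y. drop h x = b1 # b2 # b3 # y \<and> vacc (Code2 fr fc w b1 b2, T (h + 2), t1, t2))"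
proof -
  have Code0: "vacc (Code0 fr fc w, T h, t1, t2) \<longleftrightarrow> (\<exists>b1 y. drop h x = b1 # y \<and> vacc (Code1 fr fc w b1, T (Suc h), t1, t2))"
  proof (cases "drop h x")
    case Nil
    then have "\<not> vacc (Code0 fr fc w, T h, t1, t2)" by (intro vacc_none) (simp_all add: read_T)
    then show ?thesis using Nil by simp
  next
    case (Cons b y)
    then have r: "read (T h) = bit_symbol b" by (simp add: read_T)
    then have "vtr (Code0 fr fc w) (read (T h)) (read t1) (read t2) =
        {(Code1 fr fc w b, (bit_symbol b, Go_Right), (read t1, Stay), (read t2, Stay))}" by (simp add: bit_symbol_def)
    from vacc_det[OF this] have "vacc (Code0 fr fc w, T h, t1, t2) \<longleftrightarrow> vacc (Code1 fr fc w b, T (Suc h), t1, t2)"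
      using act_T(1)[OF r] by simp
    then show ?thesis using Cons by simp
  qed
  have Code1: "vacc (Code1 fr fc w b1, T h, t1, t2) \<longleftrightarrow> (\<exists>b2 y. drop h x = b2 # y \<and> vacc (Code2 fr fc w b1 b2, T (Suc h), t1, t2))"
    for b1 h
  proof (cases "drop h x")
    case Nil
    then have "\<not> vacc (Code1 fr fc w b1, T h, t1, t2)" by (intro vacc_none) (simp_all add: read_T)
    then show ?thesis using Nil by simp
  next
    case (Cons b y)
    then have r: "read (T h) = bit_symbol b" by (simp add: read_T)
    then have "vtr (Code1 fr fc w b1) (read (T h)) (read t1) (read t2) =
        {(Code2 fr fc w b1 b, (bit_symbol b, Go_Right), (read t1, Stay), (read t2, Stay))}" by (simp add: bit_symbol_def)
    from vacc_det[OF this] have "vacc (Code1 fr fc w b1, T h, t1, t2) \<longleftrightarrow> vacc (Code2 fr fc w b1 b, T (Suc h), t1, t2)"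
      using act_T(1)[OF r] by simp
    then show ?thesis using Cons by simp
  qed
  have Code2: "drop h x \<noteq> []" if "vacc (Code2 fr fc w b1 b2, T h, t1, t2)" for b1 b2 h
  proof
    assume "drop h x = []"
    then have "\<not> vacc (Code2 fr fc w b1 b2, T h, t1, t2)" by (intro vacc_none) (simp_all add: read_T)
    then show False using that by simp
  qed
  show ?thesis
  proof
    assume "vacc (Code0 fr fc w, T h, t1, t2)"
    then obtain b1 y1 where 1: "drop h x = b1 # y1" "vacc (Code1 fr fc w b1, T (Suc h), t1, t2)"
      using Code0 by blast
    then obtain b2 y2 where 2: "drop (Suc h) x = b2 # y2" "vacc (Code2 fr fc w b1 b2, T (Suc (Suc h)), t1, t2)"
      using Code1 by blast
    obtain b3 y3 where 3: "drop (Suc (Suc h)) x = b3 # y3"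
      using Code2[OF 2(2)] by (cases "drop (Suc (Suc h)) x") auto
    have "drop h x = b1 # b2 # b3 # y3"
      using drop_Suc'[OF 1(1)] drop_Suc'[OF 2(1)] 1 2 3 by simp
    then show "\<exists>b1 b2 b3 y. drop h x = b1 # b2 # b3 # y \<and> vacc (Code2 fr fc w b1 b2, T (h + 2), t1, t2)"
      using 2(2) by auto
  next
    assume "\<exists>b1 b2 b3 y. drop h x = b1 # b2 # b3 # y \<and> vacc (Code2 fr fc w b1 b2, T (h + 2), t1, t2)"
    then obtain b1 b2 b3 y where d: "drop h x = b1 # b2 # b3 # y" "vacc (Code2 fr fc w b1 b2, T (h + 2), t1, t2)"
      by blast
    then have "vacc (Code1 fr fc w b1, T (Suc h), t1, t2)"
      unfolding Code1 using drop_Suc'[OF d(1)] by auto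
    then show "vacc (Code0 fr fc w, T h, t1, t2)" unfolding Code0 using d(1) by blast
  qed
qed

context
  assumes ij: "i < n" "j < n"
begin

lemma columns_init: "(marks n)(int j := 3) = columns (\<lambda>_. False)"
  using ij by (auto simp: columns_def marks_def fun_eq_iff)

lemma pos_eq:
  assumes "m < n * n"
  shows "m = i * n + j \<longleftrightarrow> m div n = i \<and> m mod n = j"
  using ij by auto

lemma vacc_block:
  assumes m: "m < n * n" and d: "drop h x = b3 # y"
  shows "vacc (Code2 fr fc w b1 b2, T h, (columns \<sigma>, int (m mod n)), (rows, int (m div n))) \<longleftrightarrow>
    (\<exists>b e E S. block_code b = [b1, b2, b3] \<and> (fr \<or> fc \<longrightarrow> b = Fixed) \<and>
      (E, S) = block_out b e (\<sigma> (m mod n)) w \<and> (m = i * n + j \<longrightarrow> val (E, S)) \<and>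
      vacc (Cell_Done fr E, T (Suc h), (columns (\<sigma>(m mod n := S)), int (m mod n) + 1), (rows, int (m div n))))"
proof -
  let ?c = "m mod n" and ?r = "m div n"
  have c: "?c < n" using ij by simp
  have r: "?r < n" using m by (simp add: less_mult_imp_div_less)
  have rT: "read (T h) = bit_symbol b3" using d by (simp add: read_T)
  let ?b = "1 + of_bool (\<sigma> ?c) + (if ?c = j then 2 else 0) :: nat"
  have rc: "read (columns \<sigma>, int ?c) = ?b" using c by (simp add: columns_def)
  have rr: "read (rows, int ?r) = (if ?r = i then 2 else 1)" using r by (simp add: rows_def marks_def)
  have b: "(?b = 2 \<or> ?b = 4) = \<sigma> ?c" "3 \<le> ?b \<longleftrightarrow> ?c = j" "?b \<noteq> 0" by auto
  have col: "act (1 + of_bool S + (if ?c = j then 2 else 0), Go_Right) (columns \<sigma>, int ?c) =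
      (columns (\<sigma>(?c := S)), int ?c + 1)" for S
    using c by (auto simp: columns_def fun_eq_iff)
  have row: "act (read (rows, int ?r), Stay) (rows, int ?r) = (rows, int ?r)" by (rule act_stay)
  have "bit_symbol b3 \<noteq> 0" "bit_symbol b3 = 2 \<longleftrightarrow> b3" by (auto simp: bit_symbol_def)
  then have v: "vtr (Code2 fr fc w b1 b2) (read (T h)) (read (columns \<sigma>, int ?c)) (read (rows, int ?r)) =
    {(Cell_Done fr E, (bit_symbol b3, Go_Right), (1 + of_bool S + (if ?c = j then 2 else 0), Go_Right), (read (rows, int ?r), Stay)) | blk e E S.
     block_code blk = [b1, b2, b3] \<and> (fr \<or> fc \<longrightarrow> blk = Fixed) \<and>
     (E, S) = block_out blk e (\<sigma> ?c) w \<and> (?c = j \<and> ?r = i \<longrightarrow> val (E, S))}"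
    unfolding vtr.simps block_actions_def rT rc b using rr by auto
  have T: "act (bit_symbol b3, Go_Right) (T h) = T (Suc h)" using rT by (rule act_T)
  have t: "m = i * n + j \<longleftrightarrow> ?c = j \<and> ?r = i" using pos_eq[OF m] by blast
  have ex: "Bex {G E S | blk e E S. Q blk e E S} R \<longleftrightarrow> (\<exists>blk e E S. Q blk e E S \<and> R (G E S))"
    for G :: "bool \<Rightarrow> bool \<Rightarrow> vstate \<times> action \<times> action \<times> action" and Q :: "block \<Rightarrow> bool \<Rightarrow> bool \<Rightarrow> bool \<Rightarrow> bool" and R
    by blast
  show ?thesis
    unfolding t by (subst vacc_step, simp, unfold v ex) (simp only: T col row prod.case conj_assoc)
qed

text \<open>The head of tape 1 leaving the marks signals the end of a row, that of tape 2 the end of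
  the grid, where the input must be exhausted.\<close>

lemma vacc_cell_done:
  assumes m: "m < n * n"
  shows "vacc (Cell_Done (m < n) E, T h, (columns \<sigma>, int (m mod n) + 1), (rows, int (m div n))) \<longleftrightarrow>
    (if Suc m = n * n then drop h x = [] else vacc (cell_conf (Suc m) \<sigma> E h))"
proof (cases "Suc (m mod n) < n")
  case True
  then have s: "Suc m mod n = Suc (m mod n)" "Suc m div n = m div n"
    by (simp_all add: mod_Suc div_Suc)
  have "Suc m \<noteq> n" "Suc m \<noteq> n * n" using s(1) by (metis Zero_not_Suc mod_self, metis Zero_not_Suc mod_mult_self1_is_0)
  moreover have "columns \<sigma> (int (m mod n) + 1) \<noteq> 0" using True by (simp add: columns_def)
  then have "vacc (Cell_Done (m < n) E, T h, (columns \<sigma>, int (m mod n) + 1), (rows, int (m div n))) \<longleftrightarrow>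
      vacc (Code0 (m < n) False E, T h, (columns \<sigma>, int (m mod n) + 1), (rows, int (m div n)))"
    by (subst vacc_det) (auto simp: act_T)
  moreover have "(m < n) = (Suc m < n)" using \<open>Suc m \<noteq> n\<close> by auto
  ultimately show ?thesis unfolding cell_conf_def s by (simp add: add.commute)
next
  case False
  moreover have "m mod n < n" using ij by simp
  ultimately have l: "Suc (m mod n) = n" by linarith
  then have s: "Suc m mod n = 0" "Suc m div n = Suc (m div n)"
    by (simp_all add: mod_Suc div_Suc)
  have r: "m div n < n" using m by (simp add: less_mult_imp_div_less)
  have c: "int (m mod n) + 1 = int n" using l by simp
  have "columns \<sigma> (int n) = 0" by (simp add: columns_def)
  then have "vacc (Cell_Done (m < n) E, T h, (columns \<sigma>, int (m mod n) + 1), (rows, int (m div n))) \<longleftrightarrow>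
      vacc (Rewind_Grid E, T h, (columns \<sigma>, int n - 1), (rows, int (m div n)))"
    unfolding c by (subst vacc_det) (auto simp: act_T fun_upd_idem)
  also have "\<dots> \<longleftrightarrow> vacc (Row_Start E, T h, (columns \<sigma>, 0), (rows, int (m div n) + 1))"
    using ij by (intro vacc_Rewind_Grid) (auto simp: rewindable_def columns_def)
  also have "\<dots> \<longleftrightarrow> (if Suc m = n * n then drop h x = [] else vacc (cell_conf (Suc m) \<sigma> E h))"
  proof (cases "Suc (m div n) < n")
    case True
    have "Suc m = Suc (m div n) * n"
      using s by (metis div_mult_mod_eq add_0_right)
    moreover have "Suc (m div n) * n < n * n" using True ij by (intro mult_strict_right_mono) auto
    ultimately have "n \<le> Suc m" "Suc m \<noteq> n * n" by auto
    moreover have "rows (int (m div n) + 1) \<noteq> 0" using True by (simp add: rows_def marks_def)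
    then have "vacc (Row_Start E, T h, (columns \<sigma>, 0), (rows, int (m div n) + 1)) \<longleftrightarrow>
      vacc (Code0 False True E, T h, (columns \<sigma>, 0), (rows, int (m div n) + 1))"
      by (subst vacc_det) (auto simp: act_T)
    ultimately show ?thesis unfolding cell_conf_def s by (simp add: add.commute)
  next
    case False
    then have n: "Suc (m div n) = n" using r by simp
    then have mn: "Suc m = n * n"
      using s by (metis div_mult_mod_eq add_0_right)
    have "int (m div n) + 1 = int n" using n by simp
    then have z: "rows (int (m div n) + 1) = 0" using ij by (simp add: rows_def marks_def)
    have "vacc (Row_Start E, T h, (columns \<sigma>, 0), (rows, int (m div n) + 1)) \<longleftrightarrow> drop h x = []"
    proof (cases "drop h x")
      case Nil
      then have "read (T h) = 0" by (simp add: read_T)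
      then show ?thesis using z Nil by (subst vacc_det) (auto intro: vacc_Done)
    next
      case (Cons b y)
      then have "read (T h) \<noteq> 0" by (simp add: read_T bit_symbol_def)
      then have "\<not> vacc (Row_Start E, T h, (columns \<sigma>, 0), (rows, int (m div n) + 1))"
        using z by (intro vacc_none) auto
      then show ?thesis using Cons by simp
    qed
    then show ?thesis using mn by simp
  qed
  finally show ?thesis .
qed

lemma vacc_grid:
  "m < n * n \<Longrightarrow> vacc (cell_conf m \<sigma> w h) \<longleftrightarrow> (\<exists>bs. drop h x = concat (map block_code bs) \<and> good m \<sigma> w bs)"
proof (induction "n * n - m" arbitrary: m \<sigma> w h rule: less_induct)
  case less
  note m = less.prems
  define ok where "ok b e E S \<longleftrightarrow> (m < n \<or> m mod n = 0 \<longrightarrow> b = Fixed) \<and>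
      (E, S) = block_out b e (\<sigma> (m mod n)) w \<and> (m = i * n + j \<longrightarrow> val (E, S))" for b e E S
  \<comment> \<open>The end of the grid and the induction hypothesis are merged into one
    equivalence, for arbitrary outputs of the current cell.\<close>
  have nxt: "vacc (Cell_Done (m < n) E, T h', (columns \<sigma>', int (m mod n) + 1), (rows, int (m div n))) \<longleftrightarrow>
      (\<exists>bs. drop h' x = concat (map block_code bs) \<and> good (Suc m) \<sigma>' E bs)" for E h' \<sigma>'
  proof (cases "Suc m = n * n")
    case True
    have "good (n * n) \<sigma>' E bs \<longleftrightarrow> bs = []" for bs by (cases bs) auto
    then show ?thesis unfolding vacc_cell_done[OF m] True by auto
  next
    case False
    then show ?thesis unfolding vacc_cell_done[OF m] using m less.hyps[of "Suc m"] by simp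
  qed
  have h3: "Suc (h + 2) = h + 3" by simp
  have "vacc (cell_conf m \<sigma> w h) \<longleftrightarrow>
    (\<exists>b y e E S. drop h x = block_code b @ y \<and> ok b e E S \<and>
      vacc (Cell_Done (m < n) E, T (h + 3), (columns (\<sigma>(m mod n := S)), int (m mod n) + 1), (rows, int (m div n))))"
    (is "_ \<longleftrightarrow> ?R")
  proof
    assume "vacc (cell_conf m \<sigma> w h)"
    then obtain b1 b2 b3 y where d: "drop h x = b1 # b2 # b3 # y"
      and v: "vacc (Code2 (m < n) (m mod n = 0) w b1 b2, T (h + 2), (columns \<sigma>, int (m mod n)), (rows, int (m div n)))"
      unfolding cell_conf_def vacc_bits by blast
    have d2: "drop (h + 2) x = b3 # y" using drop_Suc'[OF drop_Suc'[OF d]] by simp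
    have "\<exists>b e E S. block_code b = [b1, b2, b3] \<and> ok b e E S \<and>
        vacc (Cell_Done (m < n) E, T (h + 3), (columns (\<sigma>(m mod n := S)), int (m mod n) + 1), (rows, int (m div n)))"
      using v unfolding vacc_block[OF m d2] h3 ok_def by (simp only: conj_assoc)
    then obtain b e E S where b: "block_code b = [b1, b2, b3]" "ok b e E S"
      "vacc (Cell_Done (m < n) E, T (h + 3), (columns (\<sigma>(m mod n := S)), int (m mod n) + 1), (rows, int (m div n)))"
      by blast
    have "drop h x = block_code b @ y" using d b(1) by simp
    then show ?R using b(2,3) by blast
  next
    assume ?R
    then obtain b y e E S where R: "drop h x = block_code b @ y" "ok b e E S"
      "vacc (Cell_Done (m < n) E, T (h + 3), (columns (\<sigma>(m mod n := S)), int (m mod n) + 1), (rows, int (m div n)))"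
      by blast
    obtain b1 b2 b3 where b: "block_code b = [b1, b2, b3]" by (cases b) auto
    then have d: "drop h x = b1 # b2 # b3 # y" using R(1) by simp
    have d2: "drop (h + 2) x = b3 # y" using drop_Suc'[OF drop_Suc'[OF d]] by simp
    have "vacc (Code2 (m < n) (m mod n = 0) w b1 b2, T (h + 2), (columns \<sigma>, int (m mod n)), (rows, int (m div n)))"
    proof -
      have "\<exists>b e E S. block_code b = [b1, b2, b3] \<and> ok b e E S \<and>
          vacc (Cell_Done (m < n) E, T (h + 3), (columns (\<sigma>(m mod n := S)), int (m mod n) + 1), (rows, int (m div n)))"
        using R b by blast
      then show ?thesis unfolding vacc_block[OF m d2] h3 ok_def by (simp only: conj_assoc)
    qed
    then show "vacc (cell_conf m \<sigma> w h)" unfolding cell_conf_def vacc_bits using d by blast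
  qed
  also have "\<dots> \<longleftrightarrow> (\<exists>b y e E S. drop h x = block_code b @ y \<and> ok b e E S \<and>
      (\<exists>bs. y = concat (map block_code bs) \<and> good (Suc m) (\<sigma>(m mod n := S)) E bs))"
  proof -
    have "drop (h + 3) x = y" if "drop h x = block_code b @ y" for b y
    proof -
      have "drop (h + 3) x = drop 3 (drop h x)" by (simp add: add.commute)
      then show ?thesis using that by simp
    qed
    then show ?thesis unfolding nxt by blast
  qed
  also have "\<dots> \<longleftrightarrow> (\<exists>bs. drop h x = concat (map block_code bs) \<and> good m \<sigma> w bs)" (is "?L \<longleftrightarrow> ?R")
  proof
    assume ?L
    then obtain b e E S bs where "drop h x = block_code b @ concat (map block_code bs)" "ok b e E S"
      "good (Suc m) (\<sigma>(m mod n := S)) E bs" by blast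
    then show ?R using m by (intro exI[of _ "b # bs"]) (auto simp: ok_def)
  next
    assume ?R
    then obtain bs' where bs': "drop h x = concat (map block_code bs')" "good m \<sigma> w bs'" by blast
    then obtain b bs where "bs' = b # bs" using m by (cases bs') auto
    then show ?L using bs' unfolding ok_def by auto
  qed
  finally show ?case .
qed

end

end

lemma vacc_init:
  "vacc (Read_Size, (contents x, 0), (\<lambda>_. 0, 0), (\<lambda>_. 0, 0)) \<longleftrightarrow>
    (\<exists>n i j bs. x = unary n @ unary i @ unary j @ concat (map block_code bs) \<and> i < n \<and> j < n \<and>
      good n i j 0 (\<lambda>_. False) False bs)"
proof -
  have m0: "marks 0 = (\<lambda>_. 0)" by (auto simp: marks_def)
  have d: "drop (length u) x = y" if "x = u @ y" for u y using that by simp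
  have lu: "length (unary k) = k + 1" for k by (simp add: unary_def)
  have "vacc (Read_Size, (contents x, 0), (\<lambda>_. 0, 0), (\<lambda>_. 0, 0)) \<longleftrightarrow>
      (\<exists>n y. x = unary n @ y \<and> vacc (Read_Row, T (n + 1), (marks n, 0), (marks n, 0)))"
    using vacc_Read_Size[of 0 x 0] by (simp add: m0 T_def)
  also have "\<dots> \<longleftrightarrow> (\<exists>n i y. x = unary n @ unary i @ y \<and> i < n \<and>
      vacc (Read_Col, T (n + 1 + i + 1), (marks n, 0), (rows n i, 0)))"
  proof -
    have "vacc (Read_Row, T (n + 1), (marks n, 0), (marks n, 0)) \<longleftrightarrow>
      (\<exists>i y'. y = unary i @ y' \<and> i < n \<and> vacc (Read_Col, T (n + 1 + i + 1), (marks n, 0), (rows n i, 0)))"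
      if "x = unary n @ y" for n y
      using vacc_Read_Row[of "n + 1" y "(marks n, 0)" n 0] d[OF that] by (simp add: lu rows_def)
    then show ?thesis by blast
  qed
  also have "\<dots> \<longleftrightarrow> (\<exists>n i j y. x = unary n @ unary i @ unary j @ y \<and> i < n \<and> j < n \<and>
      vacc (Code0 True True False, T (n + 1 + i + 1 + j + 1), ((marks n)(int j := 3), 0), (rows n i, 0)))"
  proof -
    have "vacc (Read_Col, T (n + 1 + i + 1), (marks n, 0), (rows n i, 0)) \<longleftrightarrow>
      (\<exists>j y'. y = unary j @ y' \<and> j < n \<and>
        vacc (Code0 True True False, T (n + 1 + i + 1 + j + 1), ((marks n)(int j := 3), 0), (rows n i, 0)))"
      if "x = unary n @ unary i @ y" for n i y
      using vacc_Read_Col[of "n + 1 + i + 1" y n 0 "(rows n i, 0)"] d[of "unary n @ unary i" y] that by (simp add: lu)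
    then show ?thesis by blast
  qed
  also have "\<dots> \<longleftrightarrow> (\<exists>n i j bs. x = unary n @ unary i @ unary j @ concat (map block_code bs) \<and> i < n \<and> j < n \<and>
      good n i j 0 (\<lambda>_. False) False bs)"
  proof -
    have "vacc (Code0 True True False, T (n + 1 + i + 1 + j + 1), ((marks n)(int j := 3), 0), (rows n i, 0)) \<longleftrightarrow>
      (\<exists>bs. y = concat (map block_code bs) \<and> good n i j 0 (\<lambda>_. False) False bs)"
      if x: "x = unary n @ unary i @ unary j @ y" and ij: "i < n" "j < n" for n i j y
    proof -
      have "drop (n + 1 + i + 1 + j + 1) x = y"
        using d[of "unary n @ unary i @ unary j" y] x by (simp add: lu add.assoc)
      moreover have "0 < n" using ij by simp
      ultimately show ?thesis
        using vacc_grid[OF ij, of 0 "\<lambda>_. False" False "n + 1 + i + 1 + j + 1"]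
        by (simp add: cell_conf_def columns_init[OF ij])
    qed
    then show ?thesis by blast
  qed
  finally show ?thesis .
qed

end

end

section \<open>From local guesses to truth-assignments\<close>

lemma good_border:
  "good val n i j m \<sigma> w bs \<Longrightarrow> m + length bs = n * n \<and>
    (\<forall>k<length bs. m + k < n \<or> (m + k) mod n = 0 \<longrightarrow> bs ! k = Fixed)"
proof (induction bs arbitrary: m \<sigma> w)
  case Nil
  then show ?case by simp
next
  case (Cons b bs)
  then obtain \<sigma>' E where b: "m < n \<or> m mod n = 0 \<longrightarrow> b = Fixed" and "good val n i j (Suc m) \<sigma>' E bs"
    by auto
  note IH = Cons.IH[OF this(2)]
  have "(b # bs) ! k = Fixed" if "k < Suc (length bs)" "m + k < n \<or> (m + k) mod n = 0" for k
    using that b IH by (cases k) auto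
  then show ?case using IH by auto
qed

text \<open>The nested existential guesses of \<open>good\<close> are replaced by one function
  \<open>U\<close> of the cell number, fixed beforehand.\<close>

primrec good_for where
  "good_for val n i j U m \<sigma> w [] \<longleftrightarrow> m = n * n"
| "good_for val n i j U m \<sigma> w (b # bs) \<longleftrightarrow> m < n * n \<and> (m < n \<or> m mod n = 0 \<longrightarrow> b = Fixed) \<and>
     (let out = block_out b (U m) (\<sigma> (m mod n)) w in (m = i * n + j \<longrightarrow> val out) \<and>
       good_for val n i j U (Suc m) (\<sigma>(m mod n := snd out)) (fst out) bs)"

lemma good_for_cong:
  "(\<And>k. m \<le> k \<Longrightarrow> U k = U' k) \<Longrightarrow> good_for val n i j U m \<sigma> w bs = good_for val n i j U' m \<sigma> w bs"
proof (induction bs arbitrary: m \<sigma> w)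
  case Nil
  then show ?case by simp
next
  case (Cons b bs)
  have "good_for val n i j U (Suc m) \<sigma>' w' bs = good_for val n i j U' (Suc m) \<sigma>' w' bs" for \<sigma>' w'
    using Cons.prems by (intro Cons.IH) simp
  moreover have "U m = U' m" using Cons.prems by simp
  ultimately show ?case by (simp only: good_for.simps)
qed

lemma good_iff_good_for: "good val n i j m \<sigma> w bs \<longleftrightarrow> (\<exists>U. good_for val n i j U m \<sigma> w bs)"
proof (induction bs arbitrary: m \<sigma> w)
  case Nil
  then show ?case by simp
next
  case (Cons b bs)
  have 1: "(\<exists>E S. (E, S) = q \<and> Q E S) \<longleftrightarrow> Q (fst q) (snd q)" for q :: "bool \<times> bool" and Q
    by (metis prod.collapse fst_conv snd_conv)
  let ?out = "\<lambda>e. block_out b e (\<sigma> (m mod n)) w"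
  define A where "A \<longleftrightarrow> m < n * n \<and> (m < n \<or> m mod n = 0 \<longrightarrow> b = Fixed)"
  have "good val n i j m \<sigma> w (b # bs) \<longleftrightarrow> A \<and> (\<exists>e. (m = i * n + j \<longrightarrow> val (?out e)) \<and>
      good val n i j (Suc m) (\<sigma>(m mod n := snd (?out e))) (fst (?out e)) bs)"
    unfolding good.simps 1 prod.collapse A_def by (simp only: conj_assoc)
  also have "\<dots> \<longleftrightarrow> A \<and> (\<exists>e U. (m = i * n + j \<longrightarrow> val (?out e)) \<and>
      good_for val n i j U (Suc m) (\<sigma>(m mod n := snd (?out e))) (fst (?out e)) bs)"
    unfolding Cons.IH by (simp only: ex_simps)
  also have "\<dots> \<longleftrightarrow> (\<exists>U. good_for val n i j U m \<sigma> w (b # bs))" (is "?L \<longleftrightarrow> ?R")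
  proof
    assume ?L
    then obtain e U where U: "A" "m = i * n + j \<longrightarrow> val (?out e)"
      "good_for val n i j U (Suc m) (\<sigma>(m mod n := snd (?out e))) (fst (?out e)) bs" by blast
    \<comment> \<open>Later cells consult \<open>U\<close> only from \<open>Suc m\<close> on, so the
      guess for the current cell can be stored at \<open>m\<close>.\<close>
    have "good_for val n i j (U(m := e)) (Suc m) (\<sigma>(m mod n := snd (?out e))) (fst (?out e)) bs"
      using U(3) by (subst good_for_cong[of _ _ U]) simp_all
    then have "good_for val n i j (U(m := e)) m \<sigma> w (b # bs)"
      using U(1,2) by (simp add: Let_def A_def)
    then show ?R by blast
  next
    assume ?R
    then obtain U where "good_for val n i j U m \<sigma> w (b # bs)" by blast
    then have A "m = i * n + j \<longrightarrow> val (?out (U m))"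
      "good_for val n i j U (Suc m) (\<sigma>(m mod n := snd (?out (U m)))) (fst (?out (U m))) bs"
      by (simp_all add: A_def Let_def)
    then show ?L by blast
  qed
  finally show ?case .
qed

lemma concat_square:
  assumes "length C = n" "\<forall>row\<in>set C. length row = n"
  shows "concat C = map (\<lambda>m. C ! (m div n) ! (m mod n)) [0..<n * n]"
proof -
  let ?g = "\<lambda>m. C ! (m div n) ! (m mod n)"
  have "map ?g [0..<n * n] = concat (map (\<lambda>m. [?g m]) [0..<n * n])" by simp
  also have "\<dots> = concat (map (\<lambda>i. concat (map (\<lambda>j. [?g (i * n + j)]) [0..<n])) [0..<n])"
    by (rule concat_map_upt_mult)
  also have "\<dots> = concat (map ((!) C) [0..<n])"
  proof -
    have "map (\<lambda>j. ?g (i * n + j)) [0..<n] = C ! i" if "i < n" for i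
    proof (rule nth_equalityI)
      have "C ! i \<in> set C" using that assms(1) by simp
      then show l: "length (map (\<lambda>j. ?g (i * n + j)) [0..<n]) = length (C ! i)" using assms(2) by simp
      fix j assume "j < length (map (\<lambda>j. ?g (i * n + j)) [0..<n])"
      then show "map (\<lambda>j. ?g (i * n + j)) [0..<n] ! j = C ! i ! j" by simp
    qed
    then have "map (\<lambda>i. concat (map (\<lambda>j. [?g (i * n + j)]) [0..<n])) [0..<n] = map ((!) C) [0..<n]"
      by (intro map_cong) simp_all
    then show ?thesis by (simp only:)
  qed
  also have "map ((!) C) [0..<n] = C" using map_nth[of C] assms(1) by simp
  finally show ?thesis by simp
qed

text \<open>The north neighbour of cell \<open>m\<close> is cell \<open>m - n\<close> and the west
  neighbour is \<open>m - 1\<close>, so the invariant concerns the south outputs of the last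
  \<open>n\<close> cells only, one per column.\<close>

lemma good_for_outputs:
  assumes C: "grid_circuit C" "length C = n" and ij: "i < n" "j < n"
    and "bs = drop m (concat C)" "m \<le> n * n"
    and "\<And>k. k < m \<Longrightarrow> m \<le> k + n \<Longrightarrow> \<sigma> (k mod n) = snd (outputs C u (k div n, k mod n))"
    and "0 < m \<Longrightarrow> w = fst (outputs C u ((m - 1) div n, (m - 1) mod n))"
  shows "good_for val n i j (\<lambda>m. u (m div n, m mod n)) m \<sigma> w bs \<longleftrightarrow>
    (m \<le> i * n + j \<longrightarrow> val (outputs C u (i, j)))"
  using assms(5-)
proof (induction bs arbitrary: m \<sigma> w)
  case Nil
  have rows: "\<forall>row\<in>set C. length row = n" using C by (simp add: grid_circuit_def)
  have "length (concat C) = n * n" unfolding concat_square[OF C(2) rows] by simp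
  then have "m = n * n" using Nil(1,2) by simp
  moreover have "i * n + j < n * n" using ij by (rule mult_add_less)
  ultimately show ?case by simp
next
  case (Cons b bs)
  let ?o = "\<lambda>m. outputs C u (m div n, m mod n)"
  have n: "0 < n" using ij by simp
  have rows: "\<forall>row\<in>set C. length row = n" using C by (simp add: grid_circuit_def)
  note cs = concat_square[OF C(2) rows]
  have lc: "length (concat C) = n * n" unfolding cs by simp
  have m: "m < n * n" using Cons.prems(1) lc by (metis drop_eq_Nil list.distinct(1) not_le)
  have "b # bs = concat C ! m # drop (Suc m) (concat C)"
    using Cons.prems(1) m lc by (simp add: Cons_nth_drop_Suc)
  then have bs: "b = C ! (m div n) ! (m mod n)" "bs = drop (Suc m) (concat C)"
    using m unfolding cs by simp_all
  have r: "m div n < n" "m mod n < n" using m n by (simp_all add: less_mult_imp_div_less)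
  have div0: "m div n = 0 \<longleftrightarrow> m < n" using n by (simp add: div_eq_0_iff)
  have border: "m < n \<or> m mod n = 0 \<Longrightarrow> b = Fixed"
  proof -
    assume "m < n \<or> m mod n = 0"
    then have "m div n = 0 \<or> m mod n = 0" using div0 by simp
    then show ?thesis unfolding bs(1) using C r unfolding grid_circuit_def by metis
  qed
  have out: "block_out b (u (m div n, m mod n)) (\<sigma> (m mod n)) w = ?o m"
  proof (cases "m < n \<or> m mod n = 0")
    case True
    then show ?thesis using border outputs_border[OF C(1), of "m div n" "m mod n"] r C(2) div0 by auto
  next
    case False
    then have "0 < m div n" "0 < m mod n" "n \<le> m" "0 < m" using div0 n by auto
    note o = outputs_rec[of "m div n" C "m mod n", OF _ _ this(1,2), of u]
    have k: "(m - n) mod n = m mod n" "(m - n) div n = m div n - 1"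
      using \<open>n \<le> m\<close> n by (simp_all add: le_mod_geq le_div_geq)
    have "\<sigma> ((m - n) mod n) = snd (?o (m - n))"
      using Cons.prems(3)[of "m - n"] \<open>n \<le> m\<close> n by simp
    then have "\<sigma> (m mod n) = snd (outputs C u (m div n - 1, m mod n))" unfolding k .
    moreover have "(m - 1) div n = m div n" "(m - 1) mod n = m mod n - 1"
    proof -
      have "m = m div n * n + m mod n" by simp
      then have e: "m - 1 = (m mod n - 1) + m div n * n" using \<open>0 < m mod n\<close> by linarith
      have l: "m mod n - 1 < n" using r(2) by (rule less_imp_diff_less)
      show "(m - 1) div n = m div n" unfolding e using l n by simp
      show "(m - 1) mod n = m mod n - 1" unfolding e using l n by simp
    qed
    then have "w = fst (outputs C u (m div n, m mod n - 1))" using Cons.prems(4) \<open>0 < m\<close> by simp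
    ultimately show ?thesis using o r C(2) bs(1) by simp
  qed
  have "good_for val n i j (\<lambda>m. u (m div n, m mod n)) (Suc m) (\<sigma>(m mod n := snd (?o m))) (fst (?o m)) bs \<longleftrightarrow>
    (Suc m \<le> i * n + j \<longrightarrow> val (outputs C u (i, j)))"
  proof (rule Cons.IH)
    show "bs = drop (Suc m) (concat C)" by (rule bs)
    show "Suc m \<le> n * n" using m by simp
    show "fst (?o m) = fst (?o (Suc m - 1))" by simp
    fix k assume k: "k < Suc m" "Suc m \<le> k + n"
    show "(\<sigma>(m mod n := snd (?o m))) (k mod n) = snd (?o k)"
    proof (cases "k = m")
      case False
      then have "k < m" "m < k + n" using k by auto
      \<comment> \<open>Distinct cells whose numbers differ by less than \<open>n\<close> lie in
        different columns.\<close>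
      then have "k mod n \<noteq> m mod n"
        using mod_eq_dvd_iff_nat[of k m n] by (auto dest: dvd_imp_le)
      then show ?thesis using Cons.prems(3)[of k] \<open>k < m\<close> \<open>m < k + n\<close> by simp
    qed simp
  qed
  moreover have "?o m = outputs C u (i, j)" if "m = i * n + j"
    using that ij by simp
  ultimately show ?case
    unfolding good_for.simps out Let_def using m border by (auto simp: Suc_le_eq le_less)
qed

lemma good_iff_satisfiable:
  assumes "grid_circuit C" "length C = n" "i < n" "j < n"
  shows "good val n i j 0 (\<lambda>_. False) False (concat C) \<longleftrightarrow> satisfiable val C (i, j)"
proof -
  have *: "good_for val n i j (\<lambda>m. u (m div n, m mod n)) 0 (\<lambda>_. False) False (concat C) \<longleftrightarrow> val (outputs C u (i, j))" for u
    using good_for_outputs[OF assms, of "concat C" 0 "\<lambda>_. False" u False val] by simp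
  have "good_for val n i j U 0 (\<lambda>_. False) False (concat C) \<longleftrightarrow>
      val (outputs C (\<lambda>(r, c). U (r * n + c)) (i, j))" for U
  proof -
    \<comment> \<open>Every guess function on cell numbers comes from an assignment on
      coordinates.\<close>
    have "(\<lambda>m. (\<lambda>(r, c). U (r * n + c)) (m div n, m mod n)) = U" by simp
    then show ?thesis using *[of "\<lambda>(r, c). U (r * n + c)"] by simp
  qed
  then show ?thesis unfolding good_iff_good_for satisfiable_def using * by metis
qed

text \<open>A successful run has itself checked the number of cells and the fixed border, so any
  list it accepts is that of a grid circuit.\<close>

lemma good_square:
  assumes "good val n i j 0 \<sigma> w bs" "0 < n"
  shows "\<exists>C. grid_circuit C \<and> length C = n \<and> concat C = bs"
proof -
  have b: "length bs = n * n" "\<And>k. k < n * n \<Longrightarrow> k < n \<or> k mod n = 0 \<Longrightarrow> bs ! k = Fixed"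
    using good_border[OF assms(1)] by auto
  define C where "C = map (\<lambda>r. map (\<lambda>c. bs ! (r * n + c)) [0..<n]) [0..<n]"
  have len: "length C = n" "\<forall>row\<in>set C. length row = n" by (auto simp: C_def)
  have nth: "C ! r ! c = bs ! (r * n + c)" if "r < n" "c < n" for r c using that by (simp add: C_def)
  have "C ! r ! c = Fixed" if "r < n" "c < n" "r = 0 \<or> c = 0" for r c
    unfolding nth[OF that(1,2)] using that mult_add_less[OF that(1,2)] by (intro b(2)) auto
  then have "grid_circuit C" using len by (auto simp: grid_circuit_def)
  moreover have "concat C = map ((!) bs) [0..<n * n]"
    unfolding concat_square[OF len]
  proof (intro map_cong refl)
    fix m assume "m \<in> set [0..<n * n]"
    then have "C ! (m div n) ! (m mod n) = bs ! (m div n * n + m mod n)"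
      using assms(2) by (intro nth) (simp_all add: less_mult_imp_div_less)
    then show "C ! (m div n) ! (m mod n) = bs ! m" by simp
  qed
  then have "concat C = bs" using map_nth[of bs] b(1) by simp
  ultimately show ?thesis using len by blast
qed

lemma vacc_iff_sat:
  "vacc val (Read_Size, (contents x, 0), (\<lambda>_. 0, 0), (\<lambda>_. 0, 0)) \<longleftrightarrow> x \<in> grid_circuit_sat val"
proof
  assume "vacc val (Read_Size, (contents x, 0), (\<lambda>_. 0, 0), (\<lambda>_. 0, 0))"
  then obtain n i j bs where x: "x = unary n @ unary i @ unary j @ concat (map block_code bs)"
    and ij: "i < n" "j < n" and g: "good val n i j 0 (\<lambda>_. False) False bs"
    unfolding vacc_init by blast
  obtain C where C: "grid_circuit C" "length C = n" "concat C = bs"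
    using good_square[OF g] ij by auto
  have "satisfiable val C (i, j)" using good_iff_satisfiable[OF C(1,2) ij] g C(3) by simp
  moreover have "x = encode C (i, j)" using x C by simp
  ultimately show "x \<in> grid_circuit_sat val" unfolding grid_circuit_sat_def using C ij by blast
next
  assume "x \<in> grid_circuit_sat val"
  then obtain C i j where C: "x = encode C (i, j)" "grid_circuit C" "i < length C" "j < length C"
    "satisfiable val C (i, j)" unfolding grid_circuit_sat_def by blast
  then have "good val (length C) i j 0 (\<lambda>_. False) False (concat C)"
    using good_iff_satisfiable[OF C(2) refl C(3,4)] by simp
  then show "vacc val (Read_Size, (contents x, 0), (\<lambda>_. 0, 0), (\<lambda>_. 0, 0))"
    unfolding vacc_init using C(1,3,4) by (intro exI conjI) (rule trans, assumption, simp)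
qed

section \<open>Running time of the verifier\<close>

fun cost :: "vstate \<Rightarrow> int" where
  "cost Rewind_Size = 5" | "cost Rewind_Row = 3" | "cost Rewind_Col = 3" | "cost (Cell_Done fr w) = 5" | "cost (Rewind_Grid w) = 6" | "cost (Row_Start w) = 1"
| "cost _ = 0"

text \<open>Left of 0 the work tapes are blank, so a rewinding head stops at -1. The conditions on
  particular states cover left moves made without testing for a nonblank symbol on that
  tape.\<close>

fun vinv :: "bool list \<Rightarrow> vconf \<Rightarrow> bool" where
  "vinv x (s, (f0, h0), (f1, h1), (f2, h2)) \<longleftrightarrow>
     f0 = contents x \<and> 0 \<le> h0 \<and> h0 \<le> int (length x) \<and> -1 \<le> h1 \<and> -1 \<le> h2 \<and>
     (\<forall>z<0. f1 z = 0) \<and> (\<forall>z<0. f2 z = 0) \<and>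
     (s = Read_Size \<longrightarrow> h1 = h2 \<and> 0 \<le> h1) \<and> (s = Rewind_Size \<longrightarrow> h1 = h2) \<and> (\<forall>fr w. s = Cell_Done fr w \<longrightarrow> 0 \<le> h1)"

text \<open>An input symbol is worth 10, which pays for the head moves and the cost of the next
  state. Steps that read nothing move heads left or are paid by \<open>cost\<close>: leaving
  \<open>Rewind_Size\<close>, for instance, moves two heads right at a price of 4, covered by
  5.\<close>

fun potential :: "bool list \<Rightarrow> vconf \<Rightarrow> int" where
  "potential x (s, (f0, h0), (f1, h1), (f2, h2)) = 10 * (int (length x) - h0) + 2 * h1 + 2 * h2 + cost s"

lemma contents_nonzero: "contents x z \<noteq> 0 \<longleftrightarrow> 0 \<le> z \<and> z < int (length x)"
  by (simp add: contents_def)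

lemma nonzero_nonneg: "\<forall>z<0. f z = 0 \<Longrightarrow> f (h :: int) \<noteq> (0 :: nat) \<Longrightarrow> 0 \<le> h"
  by (meson not_le)

lemma vstep_potential:
  assumes "vstep val v v'" "vinv x v"
  shows "vinv x v' \<and> potential x v' < potential x v"
proof -
  obtain s f0 h0 f1 h1 f2 h2 where v: "v = (s, (f0, h0), (f1, h1), (f2, h2))" by (metis prod.exhaust)
  obtain s' p q r where mem: "(s', p, q, r) \<in> vtr val s (f0 h0) (f1 h1) (f2 h2)"
    and v': "v' = (s', act p (f0, h0), act q (f1, h1), act r (f2, h2))"
    using assms(1) unfolding vstep_def v by auto
  have inv: "f0 = contents x" "0 \<le> h0" "h0 \<le> int (length x)" "-1 \<le> h1" "-1 \<le> h2"
     "\<And>z. z < 0 \<Longrightarrow> f1 z = 0" "\<And>z. z < 0 \<Longrightarrow> f2 z = 0"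
     "s = Read_Size \<Longrightarrow> h1 = h2 \<and> 0 \<le> h1" "s = Rewind_Size \<Longrightarrow> h1 = h2" "\<And>fr w. s = Cell_Done fr w \<Longrightarrow> 0 \<le> h1"
    using assms(2) unfolding v by auto
  have nz: "f0 h0 \<noteq> 0 \<Longrightarrow> h0 < int (length x)" "f1 h1 \<noteq> 0 \<Longrightarrow> 0 \<le> h1" "f2 h2 \<noteq> 0 \<Longrightarrow> 0 \<le> h2"
    using inv(1) contents_nonzero nonzero_nonneg[of f1 h1] nonzero_nonneg[of f2 h2] inv(6,7) by auto
  have triv: "f0(h0 := f0 h0) = f0" "f1(h1 := f1 h1) = f1" "f2(h2 := f2 h2) = f2" by simp_all
  show ?thesis
  proof (cases s)
    case (Code2 fr fc w b1 b2)
    then have "f0 h0 \<noteq> 0" "f1 h1 \<noteq> 0" using mem by (auto split: if_splits)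
    moreover obtain E a where "s' = Cell_Done fr E" "p = (f0 h0, Go_Right)" "q = (a, Go_Right)" "r = (f2 h2, Stay)"
      using mem Code2 by (auto simp: block_actions_def split: if_splits)
    ultimately show ?thesis using inv nz Code2 unfolding v v' by auto
  qed (use mem inv nz in \<open>auto simp: v v' triv split: if_splits\<close>)
qed

lemma vsteps_bound:
  assumes "(vstep val ^^ t) v v'" "vinv x v"
  shows "vinv x v' \<and> potential x v' + int t \<le> potential x v"
  using assms(1)
proof (induction t arbitrary: v')
  case 0
  then show ?case using assms(2) by simp
next
  case (Suc t)
  then obtain u where "(vstep val ^^ t) v u" "vstep val u v'" by auto
  then show ?case using Suc.IH[of u] vstep_potential[of val u v' x] by auto
qed

lemma potential_ge:
  assumes "vinv x v"
  shows "-4 \<le> potential x v"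
proof -
  obtain s f0 h0 f1 h1 f2 h2 where v: "v = (s, (f0, h0), (f1, h1), (f2, h2))" by (metis prod.exhaust)
  have "0 \<le> cost s" by (cases s) auto
  then show ?thesis using assms unfolding v by auto
qed

section \<open>The verifier as a machine with numbered states\<close>

lemma finite_vstate: "finite (UNIV :: vstate set)"
proof -
  have "(UNIV :: vstate set) \<subseteq> {Read_Size, Rewind_Size, Read_Row, Rewind_Row, Read_Col, Rewind_Col, Done} \<union>
    (\<lambda>(a, b, c). Code0 a b c) ` UNIV \<union> (\<lambda>(a, b, c, d). Code1 a b c d) ` UNIV \<union>
    (\<lambda>(a, b, c, d, e). Code2 a b c d e) ` UNIV \<union> (\<lambda>(a, b). Cell_Done a b) ` UNIV \<union> Rewind_Grid ` UNIV \<union> Row_Start ` UNIV"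
    (is "_ \<subseteq> ?A")
  proof
    fix s :: vstate
    show "s \<in> ?A" by (cases s) (force simp: image_iff split_paired_Ex)+
  qed
  then show ?thesis by (rule finite_subset) simp
qed

definition state_code :: "vstate \<Rightarrow> nat" where
  "state_code = (SOME g. bij_betw g UNIV {0..<card (UNIV :: vstate set)})"

lemma bij_state_code: "bij_betw state_code UNIV {0..<card (UNIV :: vstate set)}"
  unfolding state_code_def using ex_bij_betw_finite_nat[OF finite_vstate] by (rule someI_ex)

lemma state_code_inject: "state_code s = state_code s' \<longleftrightarrow> s = s'"
  using bij_state_code by (auto simp: bij_betw_def inj_on_def)

lemma state_code_less: "state_code s < card (UNIV :: vstate set)"
  using bij_state_code by (auto simp: bij_betw_def)

text \<open>The five symbols are the blank and the column marks 1 to 4.\<close>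

definition verifier :: "(bool \<times> bool \<Rightarrow> bool) \<Rightarrow> tm" where
  "verifier val = \<lparr>num_tapes = 3, num_states = card (UNIV :: vstate set), num_symbols = 5,
     start_state = state_code Read_Size, accept_states = {state_code Done},
     trans = (\<lambda>q ss. {(state_code s', [a, b, c]) | s s' a b c.
       q = state_code s \<and> (s', a, b, c) \<in> vtr val s (ss ! 0) (ss ! 1) (ss ! 2)})\<rparr>"

fun conf_of :: "vconf \<Rightarrow> config" where
  "conf_of (s, t0, t1, t2) = (state_code s, [t0, t1, t2])"

lemma step_verifier: "step (verifier val) (conf_of v) c \<longleftrightarrow> (\<exists>v'. vstep val v v' \<and> c = conf_of v')"
proof -
  obtain s t0 t1 t2 where v: "v = (s, t0, t1, t2)" by (metis prod.exhaust)
  have "step (verifier val) (conf_of v) c \<longleftrightarrow>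
    (\<exists>s' p q r. (s', p, q, r) \<in> vtr val s (read t0) (read t1) (read t2) \<and>
      c = (state_code s', [act p t0, act q t1, act r t2]))"
  proof
    assume "step (verifier val) (conf_of v) c"
    then obtain q' as where t: "(q', as) \<in> trans (verifier val) (state_code s) [read t0, read t1, read t2]"
      and c: "c = (q', map2 act as [t0, t1, t2])"
      unfolding step_def v by auto
    from t obtain s1 s' p q r where "q' = state_code s'" "as = [p, q, r]" "state_code s = state_code s1"
      "(s', p, q, r) \<in> vtr val s1 (read t0) (read t1) (read t2)"
      unfolding verifier_def by (simp add: numeral_2_eq_2) blast
    then show "\<exists>s' p q r. (s', p, q, r) \<in> vtr val s (read t0) (read t1) (read t2) \<and>
      c = (state_code s', [act p t0, act q t1, act r t2])"
      using c by (intro exI[of _ s'] exI[of _ p] exI[of _ q] exI[of _ r]) (simp add: state_code_inject)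
  next
    assume "\<exists>s' p q r. (s', p, q, r) \<in> vtr val s (read t0) (read t1) (read t2) \<and>
      c = (state_code s', [act p t0, act q t1, act r t2])"
    then obtain s' p q r where *: "(s', p, q, r) \<in> vtr val s (read t0) (read t1) (read t2)"
      "c = (state_code s', [act p t0, act q t1, act r t2])" by blast
    then have "(state_code s', [p, q, r]) \<in> trans (verifier val) (fst (conf_of v)) (map read (snd (conf_of v)))"
      unfolding v by (auto simp: verifier_def numeral_2_eq_2)
    then show "step (verifier val) (conf_of v) c"
      unfolding step_def using *(2) by (intro bexI) (auto simp: v)
  qed
  also have "\<dots> \<longleftrightarrow> (\<exists>v'. vstep val v v' \<and> c = conf_of v')"
    unfolding vstep_def v by (auto simp: case_prod_beta Bex_def) (metis fst_conv snd_conv conf_of.simps)+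
  finally show ?thesis .
qed

lemma steps_verifier: "(step (verifier val) ^^ t) (conf_of v) c \<longleftrightarrow> (\<exists>v'. (vstep val ^^ t) v v' \<and> c = conf_of v')"
proof (induction t arbitrary: c)
  case 0
  then show ?case by auto
next
  case (Suc t)
  have "(step (verifier val) ^^ Suc t) (conf_of v) c \<longleftrightarrow>
    (\<exists>u. (vstep val ^^ t) v u \<and> step (verifier val) (conf_of u) c)"
    using Suc.IH by (auto simp: relcompp_apply)
  then show ?case unfolding step_verifier by (auto simp: relcompp_apply)
qed

lemma init_verifier: "init (verifier val) x = conf_of (Read_Size, (contents x, 0), (\<lambda>_. 0, 0), (\<lambda>_. 0, 0))"
proof -
  have "contents [] = (\<lambda>_. 0)" by (auto simp: contents_def)
  then show ?thesis by (simp add: init_def verifier_def numeral_2_eq_2)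
qed

lemma accepts_verifier: "tm_accepts (verifier val) x \<longleftrightarrow> x \<in> grid_circuit_sat val"
proof -
  let ?i = "(Read_Size, (contents x, 0), (\<lambda>_. 0, 0), (\<lambda>_. 0, 0)) :: vconf"
  have steps: "(step (verifier val))\<^sup>*\<^sup>* (conf_of ?i) c \<longleftrightarrow> (\<exists>v. (vstep val)\<^sup>*\<^sup>* ?i v \<and> c = conf_of v)" for c
    unfolding rtranclp_power steps_verifier by blast
  have acc: "fst (conf_of v) \<in> accept_states (verifier val) \<longleftrightarrow> (\<exists>ts. v = (Done, ts))" for v
    by (cases v) (auto simp: verifier_def state_code_inject)
  have halt: "halting (verifier val) (conf_of (Done, ts))" for ts
    unfolding halting_def step_verifier by (cases ts) (auto simp: vstep_def)
  have "tm_accepts (verifier val) x \<longleftrightarrow>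
      (\<exists>v. (vstep val)\<^sup>*\<^sup>* ?i v \<and> halting (verifier val) (conf_of v) \<and> fst (conf_of v) \<in> accept_states (verifier val))"
    unfolding tm_accepts_def init_verifier steps by blast
  also have "\<dots> \<longleftrightarrow> vacc val ?i"
    unfolding vacc_def acc using halt by blast
  also have "\<dots> \<longleftrightarrow> x \<in> grid_circuit_sat val" by (rule vacc_iff_sat)
  finally show ?thesis .
qed

lemma vtr_symbols:
  assumes "(s', p, q, r) \<in> vtr val s a b c" "a < 5" "b < 5" "c < 5"
  shows "fst p < 5 \<and> fst q < 5 \<and> fst r < 5"
  using assms by (cases s) (auto simp: block_actions_def split: if_splits)

lemma wf_verifier: "wf_tm (verifier val)"
proof -
  have "\<forall>(q', as)\<in>trans (verifier val) q ss. q' < num_states (verifier val) \<and> length as = 3 \<and> fst ` set as \<subseteq> {..<5}"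
    if "length ss = 3" "set ss \<subseteq> {..<5}" for q ss
  proof -
    have "ss ! k < 5" if "k < 3" for k
    proof -
      have "ss ! k \<in> set ss" using \<open>length ss = 3\<close> \<open>k < 3\<close> by simp
      then show ?thesis using \<open>set ss \<subseteq> {..<5}\<close> by auto
    qed
    then have "ss ! 0 < 5" "ss ! 1 < 5" "ss ! 2 < 5" by simp_all
    note sym = vtr_symbols[OF _ this]
    show ?thesis
      unfolding verifier_def using sym state_code_less by (auto dest: sym)
  qed
  then have "\<forall>q<num_states (verifier val). \<forall>ss. length ss = 3 \<and> set ss \<subseteq> {..<5} \<longrightarrow>
      (\<forall>(q', as)\<in>trans (verifier val) q ss. q' < num_states (verifier val) \<and> length as = 3 \<and> fst ` set as \<subseteq> {..<5})"
    by blast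
  moreover have "num_tapes (verifier val) = 3" "num_symbols (verifier val) = 5"
    "start_state (verifier val) < num_states (verifier val)"
    using state_code_less by (simp_all add: verifier_def)
  ultimately show ?thesis
    unfolding wf_tm_def by (simp only:) simp
qed

theorem grid_circuit_sat_in_NP: "grid_circuit_sat val \<in> NP"
  unfolding NP_def mem_Collect_eq
\<comment> \<open>The initial potential is 10 times the input length, and -4 is a lower bound
  because both work heads stay at or right of -1.\<close>
proof (intro exI[of _ "verifier val"] exI[of _ "[:4, 10:]"] conjI allI impI)
  show "wf_tm (verifier val)" by (rule wf_verifier)
  fix x
  show "x \<in> grid_circuit_sat val \<longleftrightarrow> tm_accepts (verifier val) x" by (simp add: accepts_verifier)
  fix t c
  let ?i = "(Read_Size, (contents x, 0), (\<lambda>_. 0, 0), (\<lambda>_. 0, 0)) :: vconf"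
  assume "(step (verifier val) ^^ t) (init (verifier val) x) c"
  then obtain v where "(vstep val ^^ t) ?i v"
    unfolding init_verifier steps_verifier by blast
  moreover have "vinv x ?i" by simp
  ultimately have "vinv x v" "potential x v + int t \<le> potential x ?i" using vsteps_bound by blast+
  moreover have "potential x ?i = 10 * int (length x)" by simp
  ultimately have "int t \<le> 10 * int (length x) + 4" using potential_ge[of x v] by linarith
  then show "t \<le> poly [:4, 10:] (length x)" by (simp add: algebra_simps)
qed

theorem theorem4:
  fixes val :: "bool \<times> bool \<Rightarrow> bool"
  assumes "value_convention val"
  shows "NP_complete (grid_circuit_sat val)"
  using grid_circuit_sat_NP_hard[OF assms] grid_circuit_sat_in_NP
  by (simp add: NP_complete_def)

end
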